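(* Let $n\ge 2$ be an integer, let $1<p\le\infty$, and let $q$ be the exponent conjugate to $p$, i.e. $\frac1p+\frac1q=1$. For all $u\in h^p(B^n)$ and all $x\in B^n$ the inequality $$|u(x)|\le \frac{C_p}{(1-|x|^2)^{(n-1)/p}}\,\|u\|_{h^p(B^n)}$$ holds, where $$C_p=\begin{cases}1, & \text{if } q\le 2-\frac2n,\\[4pt] \left(\dfrac{2^{nq-n}\,\Gamma\left(\frac n2\right)\Gamma\left(\frac{1+nq-n}{2}\right)}{\sqrt{\pi}\,\Gamma\left(\frac{nq}{2}\right)}\right)^{1/q}, & \text{if } q>2-\frac2n,\end{cases}$$ and the inequality is sharp: the constant $C_p$ cannot be replaced by any smaller constant so that the inequality remains valid for all $u\in h^p(B^n)$ and all $x\in B^n$.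
   Context: $B^n=\{x\in\mathbf R^n:|x|<1\}$ is the open unit ball of Euclidean space $\mathbf R^n$, $S=S^{n-1}$ is the unit sphere, and $\sigma$ is the unique rotation invariant Borel measure on $S$ normalized by $\sigma(S)=1$. For $1\le p<\infty$, the harmonic Hardy space $h^p(B^n)$ is the space of all harmonic functions $u$ on $B^n$ with $$\|u\|_{h^p(B^n)}^p=\sup_{0<r<1}\int_S|u(r\zeta)|^p\,d\sigma(\zeta)<\infty,$$ and $h^\infty(B^n)$ is the space of bounded harmonic functions on $B^n$ with $\|u\|_{h^\infty(B^n)}=\sup_{x\in B^n}|u(x)|$. When $p=\infty$ one has $q=1$ and $(n-1)/p=0$. $\Gamma$ is the Euler Gamma function. *)

theory Defs
  imports "HOL-Analysis.Analysis"
begin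

definition rotation_invariant_prob :: "(real^'n) measure \<Rightarrow> bool" where
  "rotation_invariant_prob \<sigma> \<longleftrightarrow>
     sets \<sigma> = sets (restrict_space borel (sphere 0 1)) \<and>
     emeasure \<sigma> (sphere 0 1) = 1 \<and>
     (\<forall>Q. rotation_matrix Q \<longrightarrow>
        (\<forall>A\<in>sets \<sigma>. emeasure \<sigma> ((\<lambda>x. Q *v x) ` A) = emeasure \<sigma> A))"

lemma distr_lborel_orthogonal:
  fixes T :: "'a::euclidean_space \<Rightarrow> 'a"
  assumes T: "orthogonal_transformation T"
  shows "distr lborel borel T = lborel"
proof -
  define M where "M = distr lborel borel T"
  have lin: "linear T" and nT: "\<And>x. norm (T x) = norm x"
    using T by (auto simp: orthogonal_transformation)
  have Tm[measurable]: "T \<in> borel_measurable borel"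
    by (intro borel_measurable_continuous_onI linear_continuous_on linear_conv_bounded_linear[THEN iffD1] lin)
  have eM: "emeasure M A = emeasure lborel (T -` A)" if "A \<in> sets borel" for A
    using that by (simp add: M_def emeasure_distr)
  have [measurable_cong, simp]: "sets M = sets borel" by (simp add: M_def)
  have spM[simp]: "space M = UNIV" by (simp add: M_def)
  have nn_M: "(\<integral>\<^sup>+x. f x \<partial>M) = (\<integral>\<^sup>+x. f (T x) \<partial>lborel)" if "f \<in> borel_measurable borel" for f
    using that by (simp add: M_def nn_integral_distr)
  have trL: "(\<integral>\<^sup>+x. f (x + a) \<partial>lborel) = (\<integral>\<^sup>+x. f x \<partial>lborel)"
    if [measurable]: "f \<in> borel_measurable borel" for f :: "'a \<Rightarrow> ennreal" and a
  proof -
    have "(\<integral>\<^sup>+x. f x \<partial>lborel) = (\<integral>\<^sup>+x. f x \<partial>distr lborel borel ((+) a))"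
      by (simp add: lborel_distr_plus)
    also have "\<dots> = (\<integral>\<^sup>+x. f (x + a) \<partial>lborel)"
      by (subst nn_integral_distr) (auto simp: add.commute)
    finally show ?thesis by simp
  qed
  have trM: "(\<integral>\<^sup>+x. f (x + a) \<partial>M) = (\<integral>\<^sup>+x. f x \<partial>M)"
    if [measurable]: "f \<in> borel_measurable borel" for f :: "'a \<Rightarrow> ennreal" and a
  proof -
    obtain b where b: "T b = a"
      using T orthogonal_transformation_surj by (metis surjD)
    have "(\<integral>\<^sup>+x. f (x + a) \<partial>M) = (\<integral>\<^sup>+x. f (T (x + b)) \<partial>lborel)"
      by (subst nn_M) (auto simp: linear_add[OF lin] b)
    also have "\<dots> = (\<integral>\<^sup>+x. f (T x) \<partial>lborel)"
      by (rule trL) simp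
    finally show ?thesis by (simp add: nn_M)
  qed
  define B :: "'a set" where "B = ball 0 1"
  have Bm[measurable]: "B \<in> sets borel" by (simp add: B_def)
  have TB: "T -` B = B" by (auto simp: B_def nT)
  have Bpos: "emeasure lborel B \<noteq> 0" "emeasure lborel B \<noteq> \<infinity>"
  proof -
    show "emeasure lborel B \<noteq> \<infinity>" unfolding B_def using emeasure_lborel_ball_finite[of "0::'a" 1] by auto
    have "negligible B \<longleftrightarrow> B = {}" unfolding B_def by (metis open_ball open_not_negligible negligible_empty)
    then show "emeasure lborel B \<noteq> 0"
      by (metis B_def Bm ball_eq_empty emeasure_lborel_ball_finite negligible_iff_null_sets not_one_le_zero null_setsI null_sets_completionI sets_lborel)
  qed
  have sfM: "sigma_finite_measure M"
  proof (rule sigma_finite_measure.intro, intro exI conjI)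
    show "countable (range (\<lambda>n::nat. ball 0 (real n) :: 'a set))" by simp
    show "range (\<lambda>n::nat. ball 0 (real n)) \<subseteq> sets M" by auto
    show "\<Union> (range (\<lambda>n::nat. ball 0 (real n))) = space M"
      by (auto simp: reals_Archimedean2)
    show "\<forall>a\<in>range (\<lambda>n::nat. ball 0 (real n)). emeasure M a \<noteq> \<infinity>"
    proof safe
      fix n :: nat
      assume "emeasure M (ball 0 (real n)) = \<infinity>"
      moreover have "T -` ball 0 (real n) = ball 0 (real n)" by (auto simp: nT)
      ultimately show False using emeasure_lborel_ball_finite[of "0::'a" "real n"] by (simp add: eM)
    qed
  qed
  interpret pair_sigma_finite M lborel
    using sfM by (simp add: pair_sigma_finite_def lborel.sigma_finite_measure_axioms)
  show ?thesis
  proof (rule measure_eqI)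
    show "sets (distr lborel borel T) = sets lborel" by simp
    fix A assume "A \<in> sets (distr lborel borel T)"
    then have A[measurable]: "A \<in> sets borel" by simp
    have "emeasure M A * emeasure lborel B = (\<integral>\<^sup>+x. indicator A x * emeasure lborel B \<partial>M)"
      by (simp add: nn_integral_multc)
    also have "\<dots> = (\<integral>\<^sup>+x. (\<integral>\<^sup>+y. indicator A x * indicator B (y - x) \<partial>lborel) \<partial>M)"
    proof (rule nn_integral_cong)
      fix x
      have "(\<integral>\<^sup>+y. indicator B (y + (- x)) \<partial>lborel) = (\<integral>\<^sup>+y. indicator B y \<partial>(lborel::'a measure))"
        by (rule trL) simp
      then show "indicator A x * emeasure lborel B = (\<integral>\<^sup>+y. indicator A x * indicator B (y - x) \<partial>lborel)"
        by (simp add: nn_integral_cmult)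
    qed
    also have "\<dots> = (\<integral>\<^sup>+y. (\<integral>\<^sup>+x. indicator A x * indicator B (y - x) \<partial>M) \<partial>lborel)"
      by (rule Fubini'[symmetric]) measurable
    also have "\<dots> = (\<integral>\<^sup>+y. (\<integral>\<^sup>+x. indicator A (x + y) * indicator B x \<partial>M) \<partial>lborel)"
    proof (rule nn_integral_cong)
      fix y
      have "(\<integral>\<^sup>+x. indicator A (x + y) * indicator B (y - (x + y)) \<partial>M)
          = (\<integral>\<^sup>+x. indicator A x * indicator B (y - x) \<partial>M)"
        by (rule trM) simp
      moreover have "indicator B (y - (x + y)) = (indicator B x :: ennreal)" for x
        by (auto simp: indicator_def B_def)
      ultimately show "(\<integral>\<^sup>+x. indicator A x * indicator B (y - x) \<partial>M)
          = (\<integral>\<^sup>+x. indicator A (x + y) * indicator B x \<partial>M)" by simp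
    qed
    also have "\<dots> = (\<integral>\<^sup>+x. (\<integral>\<^sup>+y. indicator A (x + y) * indicator B x \<partial>lborel) \<partial>M)"
      by (rule Fubini') measurable
    also have "\<dots> = (\<integral>\<^sup>+x. emeasure lborel A * indicator B x \<partial>M)"
    proof (rule nn_integral_cong)
      fix x
      have "(\<integral>\<^sup>+y. indicator A (y + x) \<partial>lborel) = (\<integral>\<^sup>+y. indicator A y \<partial>(lborel::'a measure))"
        by (rule trL) simp
      then show "(\<integral>\<^sup>+y. indicator A (x + y) * indicator B x \<partial>lborel) = emeasure lborel A * indicator B x"
        by (simp add: nn_integral_multc add.commute)
    qed
    also have "\<dots> = emeasure lborel A * emeasure lborel B"
      by (simp add: nn_integral_cmult eM TB)
    finally show "emeasure (distr lborel borel T) A = emeasure lborel A"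
      using Bpos unfolding M_def by (metis ennreal_mult_divide_eq infinity_ennreal_def)
  qed
qed

lemma rotation_invariant_prob_exists:
  "\<exists>\<sigma> :: (real^'n) measure. rotation_invariant_prob \<sigma>"
proof -
  define B :: "(real^'n) set" where "B = ball 0 1 - {0}"
  define S :: "(real^'n) set" where "S = sphere 0 1"
  define \<pi> :: "real^'n \<Rightarrow> real^'n" where "\<pi> = (\<lambda>x. if x = 0 then axis undefined 1 else x /\<^sub>R norm x)"
  define \<sigma> where "\<sigma> = distr (uniform_measure lborel B) (restrict_space borel S) \<pi>"
  have B[measurable]: "B \<in> sets borel" by (simp add: B_def)
  have \<pi>m: "\<pi> \<in> uniform_measure lborel B \<rightarrow>\<^sub>M restrict_space borel S"
  proof (rule measurable_restrict_space2)
    show "\<pi> \<in> space (uniform_measure lborel B) \<rightarrow> S"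
      by (auto simp: \<pi>_def S_def)
    have "\<pi> \<in> borel_measurable borel" unfolding \<pi>_def by measurable
    then show "\<pi> \<in> uniform_measure lborel B \<rightarrow>\<^sub>M borel"
      by (simp cong: measurable_cong_sets)
  qed
  have \<pi>b[measurable]: "\<pi> \<in> borel_measurable borel" unfolding \<pi>_def by measurable
  have setsS: "A \<in> sets (restrict_space borel S) \<longleftrightarrow> A \<in> sets borel \<and> A \<subseteq> S" for A
    by (subst sets_restrict_space_iff) (auto simp: S_def)
  have em: "emeasure \<sigma> A = emeasure lborel (B \<inter> \<pi> -` A) / emeasure lborel B"
    if "A \<in> sets borel" "A \<subseteq> S" for A
  proof -
    have "\<pi> -` A \<in> sets borel" using measurable_sets[OF \<pi>b that(1)] by simp
    then show ?thesis
      using that by (simp add: \<sigma>_def emeasure_distr[OF \<pi>m] setsS)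
  qed
  have B_fin: "emeasure lborel B \<noteq> \<infinity>"
  proof -
    have "emeasure lborel B \<le> emeasure lborel (ball 0 1 :: (real^'n) set)"
      by (rule emeasure_mono) (auto simp: B_def)
    then show ?thesis using emeasure_lborel_ball_finite[of "0::real^'n" 1] by auto
  qed
  have B_pos: "emeasure lborel B \<noteq> 0"
  proof
    assume "emeasure lborel B = 0"
    then have "negligible B"
      by (simp add: negligible_iff_null_sets null_setsI null_sets_completionI)
    moreover have "open B" by (simp add: B_def open_Diff)
    moreover have "B \<noteq> {}"
    proof -
      have "(1/2) *\<^sub>R axis undefined 1 \<in> B" by (simp add: B_def axis_eq_0_iff)
      then show ?thesis by blast
    qed
    ultimately show False using open_not_negligible by blast
  qed
  have "rotation_invariant_prob \<sigma>"
    unfolding rotation_invariant_prob_def S_def[symmetric]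
  proof (intro conjI allI impI ballI)
    show sets: "sets \<sigma> = sets (restrict_space borel S)" by (simp add: \<sigma>_def)
    have "B \<inter> \<pi> -` S = B" by (auto simp: \<pi>_def S_def B_def)
    then show "emeasure \<sigma> S = 1"
      using B_pos B_fin by (simp add: em S_def[symmetric] ennreal_divide_self less_top)
        (simp add: em S_def ennreal_divide_self less_top)
    fix Q :: "real^'n^'n" and A
    assume Q: "rotation_matrix Q" and "A \<in> sets \<sigma>"
    then have A: "A \<in> sets borel" "A \<subseteq> S" by (auto simp: sets setsS)
    define T where "T = (\<lambda>x. Q *v x)"
    have T: "orthogonal_transformation T"
      using Q by (simp add: T_def rotation_matrix_def orthogonal_transformation_matrix)
    obtain T' where T': "orthogonal_transformation T'" "\<And>x. T (T' x) = x" "\<And>x. T' (T x) = x"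
      using T orthogonal_transformation_inv orthogonal_transformation_bij
      by (metis bij_inv_eq_iff)
    have n: "norm (T x) = norm x" "norm (T' x) = norm x" for x
      using T T'(1) by (auto simp: orthogonal_transformation)
    have l: "linear T" "linear T'"
      using T T'(1) by (auto simp: orthogonal_transformation)
    have Tm[measurable]: "T \<in> borel_measurable borel" "T' \<in> borel_measurable borel"
      by (auto intro!: borel_measurable_continuous_onI linear_continuous_on linear_conv_bounded_linear[THEN iffD1] l)
    have im: "T ` A = T' -` A" using T'(2,3) by (auto simp: image_iff) (metis T'(2))
    have TA: "T ` A \<in> sets borel" "T ` A \<subseteq> S"
      using measurable_sets[OF Tm(2) A(1)] A(2) by (auto simp: im) (auto simp: S_def n subset_eq)
    have pre: "T' -` (B \<inter> \<pi> -` A) = B \<inter> \<pi> -` (T ` A)"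
    proof -
      have z: "T' x = 0 \<longleftrightarrow> x = 0" for x using n(2)[of x] by (metis norm_eq_zero)
      have "\<pi> (T' x) = T' (\<pi> x)" if "x \<noteq> 0" for x
        using that z by (simp add: \<pi>_def n linear_scale[OF l(2)])
      then show ?thesis by (auto simp: im B_def z n)
    qed
    have "B \<inter> \<pi> -` A \<in> sets borel" using measurable_sets[OF \<pi>b A(1)] by auto
    then have "emeasure (distr lborel borel T') (B \<inter> \<pi> -` A) = emeasure lborel (B \<inter> \<pi> -` (T ` A))"
      by (subst emeasure_distr) (simp_all add: pre del: vimage_Int)
    then show "emeasure \<sigma> ((\<lambda>x. Q *v x) ` A) = emeasure \<sigma> A"
      unfolding T_def[symmetric] by (simp add: em TA A distr_lborel_orthogonal[OF T'(1)])
  qed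
  then show ?thesis by blast
qed

lemma rotation_invariant_prob_le:
  fixes \<mu> \<nu> :: "(real^'n) measure"
  assumes n: "CARD('n) \<ge> 2" and \<mu>: "rotation_invariant_prob \<mu>" and \<nu>: "rotation_invariant_prob \<nu>"
    and U: "open U"
  shows "emeasure \<mu> (U \<inter> sphere 0 1) \<le> emeasure \<nu> (U \<inter> sphere 0 1)"
proof -
  define S :: "(real^'n) set" where "S = sphere 0 1"
  note defs = \<mu>[unfolded rotation_invariant_prob_def] \<nu>[unfolded rotation_invariant_prob_def]
  have sets: "sets \<mu> = sets (restrict_space borel S)" "sets \<nu> = sets (restrict_space borel S)"
    using defs by (auto simp: S_def)
  note [measurable_cong] = sets
  have sp: "space \<mu> = S" "space \<nu> = S"
    using sets[THEN sets_eq_imp_space_eq] by (auto simp: space_restrict_space)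
  have one: "emeasure \<mu> S = 1" "emeasure \<nu> S = 1"
    using defs by (auto simp: S_def)
  interpret M: finite_measure \<mu> by (intro finite_measureI) (simp add: sp one)
  interpret N: finite_measure \<nu> by (intro finite_measureI) (simp add: sp one)
  interpret P: pair_sigma_finite \<mu> \<nu> ..
  have inS: "A \<inter> S \<in> sets (restrict_space borel S)" if "A \<in> sets borel" for A
    using that by (subst sets_restrict_space_iff) (auto simp: S_def)
  have cap: "ball y r \<inter> S \<in> sets \<mu>" "ball y r \<inter> S \<in> sets \<nu>" for y r
    by (auto simp: sets inS)
  have const: "emeasure \<rho> (ball y r \<inter> S) = emeasure \<rho> (ball x r \<inter> S)"
    if \<rho>: "rotation_invariant_prob \<rho>" and "x \<in> S" "y \<in> S" for \<rho> :: "(real^'n) measure" and x y r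
  proof -
    obtain f where f: "orthogonal_transformation f" "det (matrix f) = 1" "f x = y"
    proof (rule rotation_exists_1[OF n, of x y])
      show "norm x = 1" "norm y = 1" using \<open>x \<in> S\<close> \<open>y \<in> S\<close> by (auto simp: S_def)
    qed
    have l: "linear f" using f by (simp add: orthogonal_transformation)
    have Q: "rotation_matrix (matrix f)"
      using f by (simp add: rotation_matrix_def orthogonal_transformation_matrix)
    have img: "(\<lambda>x. matrix f *v x) ` (ball x r \<inter> S) = ball y r \<inter> S"
    proof -
      have "f ` ball x r = ball y r" using image_orthogonal_transformation_ball[OF f(1)] f(3) by simp
      moreover have "f ` S = S"
      proof -
        have "norm (f z) = norm z" for z using f(1) by (simp add: orthogonal_transformation)
        moreover have "surj f" using f(1) orthogonal_transformation_surj by blast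
        ultimately show ?thesis by (force simp: S_def dest: surjD)
      qed
      moreover have "inj f" using f(1) orthogonal_transformation_inj by blast
      ultimately show ?thesis by (simp add: image_Int matrix_works[OF l[folded linear_matrix_vector_mul_eq]])
    qed
    have "ball x r \<inter> S \<in> sets \<rho>" using \<rho> inS by (auto simp: rotation_invariant_prob_def S_def)
    with \<rho> Q img show ?thesis unfolding rotation_invariant_prob_def by metis
  qed
  define e :: "real^'n" where "e = axis undefined 1"
  have e: "e \<in> S" by (simp add: e_def S_def)
  define g where "g r = emeasure \<mu> (ball e r \<inter> S)" for r
  define h where "h r = emeasure \<nu> (ball e r \<inter> S)" for r
  have g: "emeasure \<mu> (ball y r \<inter> S) = g r" if "y \<in> S" for y r
    unfolding g_def by (rule const) (use that e \<mu> in auto)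
  have h: "emeasure \<nu> (ball y r \<inter> S) = h r" if "y \<in> S" for y r
    unfolding h_def by (rule const) (use that e \<nu> in auto)
  define k :: "real \<Rightarrow> real^'n \<Rightarrow> real^'n \<Rightarrow> ennreal"
    where "k r x y = indicator {..<r} (dist x y)" for r x y
  define V where "V = U \<inter> S"
  have Vm[measurable]: "V \<in> sets \<mu>" "V \<in> sets \<nu>" using U by (auto simp: V_def sets inS)
  have Ub[measurable]: "U \<in> sets borel" using U by simp
  have id1: "(\<lambda>x. x) \<in> \<mu> \<rightarrow>\<^sub>M borel" "(\<lambda>x. x) \<in> \<nu> \<rightarrow>\<^sub>M borel"
    unfolding measurable_cong_sets[OF sets(1) refl] measurable_cong_sets[OF sets(2) refl]
    by (auto intro: measurable_restrict_space1)
  have id2[measurable]: "fst \<in> \<mu> \<Otimes>\<^sub>M \<nu> \<rightarrow>\<^sub>M borel" "snd \<in> \<mu> \<Otimes>\<^sub>M \<nu> \<rightarrow>\<^sub>M borel"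
    using measurable_compose[OF measurable_fst id1(1)] measurable_compose[OF measurable_snd id1(2)] by auto
  have km: "case_prod (k r) \<in> borel_measurable (\<mu> \<Otimes>\<^sub>M \<nu>)" for r
    unfolding k_def case_prod_beta by measurable
  have kVm: "(\<lambda>(x, y). indicator V x * indicator V y * k r x y) \<in> borel_measurable (\<mu> \<Otimes>\<^sub>M \<nu>)" for r
    using km[of r] unfolding case_prod_beta by measurable
  have k\<nu>: "(\<integral>\<^sup>+y. indicator A y * k r x y \<partial>\<nu>) = emeasure \<nu> (A \<inter> ball x r)"
    if "A \<in> sets \<nu>" for A x r
  proof -
    have "A \<subseteq> S" using sets.sets_into_space[OF that] sp by simp
    then have eq: "A \<inter> ball x r = A \<inter> (ball x r \<inter> S)" by auto
    have "(\<integral>\<^sup>+y. indicator A y * k r x y \<partial>\<nu>) = (\<integral>\<^sup>+y. indicator (A \<inter> ball x r) y \<partial>\<nu>)"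
      by (intro nn_integral_cong) (auto simp: k_def indicator_def)
    then show ?thesis using that cap by (simp add: eq)
  qed
  have k\<mu>: "(\<integral>\<^sup>+x. indicator A x * k r x y \<partial>\<mu>) = emeasure \<mu> (A \<inter> ball y r)"
    if "A \<in> sets \<mu>" for A y r
  proof -
    have "A \<subseteq> S" using sets.sets_into_space[OF that] sp by simp
    then have eq: "A \<inter> ball y r = A \<inter> (ball y r \<inter> S)" by auto
    have "(\<integral>\<^sup>+x. indicator A x * k r x y \<partial>\<mu>) = (\<integral>\<^sup>+x. indicator (A \<inter> ball y r) x \<partial>\<mu>)"
      by (intro nn_integral_cong) (auto simp: k_def indicator_def dist_commute)
    then show ?thesis using that cap by (simp add: eq)
  qed
  have gh: "g r = h r" for r
  proof -
    have fub: "(\<integral>\<^sup>+y. \<integral>\<^sup>+x. k r x y \<partial>\<mu> \<partial>\<nu>) = (\<integral>\<^sup>+x. \<integral>\<^sup>+y. k r x y \<partial>\<nu> \<partial>\<mu>)"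
      by (rule P.Fubini') (rule km)
    have in\<mu>: "(\<integral>\<^sup>+x. k r x y \<partial>\<mu>) = g r" if "y \<in> S" for y
    proof -
      have "(\<integral>\<^sup>+x. k r x y \<partial>\<mu>) = (\<integral>\<^sup>+x. indicator S x * k r x y \<partial>\<mu>)"
        by (intro nn_integral_cong) (simp add: sp)
      also have "\<dots> = emeasure \<mu> (S \<inter> ball y r)"
        by (rule k\<mu>) (metis sets.top sp(1))
      finally show ?thesis using g[OF that] by (simp add: Int_commute)
    qed
    have in\<nu>: "(\<integral>\<^sup>+y. k r x y \<partial>\<nu>) = h r" if "x \<in> S" for x
    proof -
      have "(\<integral>\<^sup>+y. k r x y \<partial>\<nu>) = (\<integral>\<^sup>+y. indicator S y * k r x y \<partial>\<nu>)"
        by (intro nn_integral_cong) (simp add: sp)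
      also have "\<dots> = emeasure \<nu> (S \<inter> ball x r)"
        by (rule k\<nu>) (metis sets.top sp(2))
      finally show ?thesis using h[OF that] by (simp add: Int_commute)
    qed
    have "(\<integral>\<^sup>+y. \<integral>\<^sup>+x. k r x y \<partial>\<mu> \<partial>\<nu>) = (\<integral>\<^sup>+y. g r \<partial>\<nu>)"
      by (rule nn_integral_cong) (simp add: in\<mu> sp)
    moreover have "(\<integral>\<^sup>+x. \<integral>\<^sup>+y. k r x y \<partial>\<nu> \<partial>\<mu>) = (\<integral>\<^sup>+x. h r \<partial>\<mu>)"
      by (rule nn_integral_cong) (simp add: in\<nu> sp)
    ultimately show ?thesis using fub by (simp add: sp one)
  qed
  have hpos: "h r \<noteq> 0" if "r > 0" for r
  proof
    assume 0: "h r = 0"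
    have "compact S" by (simp add: S_def)
    then obtain C where C: "C \<subseteq> S" "finite C" "S \<subseteq> (\<Union>c\<in>C. ball c r)"
      by (rule compactE_image[of S S "\<lambda>c. ball c r"]) (use \<open>r > 0\<close> in \<open>auto intro: bexI\<close>)
    have "emeasure \<nu> S \<le> emeasure \<nu> (\<Union>c\<in>C. ball c r \<inter> S)"
    proof (rule emeasure_mono)
      show "(\<Union>c\<in>C. ball c r \<inter> S) \<in> sets \<nu>"
        by (rule sets.finite_UN) (rule C(2), rule cap)
    qed (use C(3) in auto)
    also have "\<dots> \<le> (\<Sum>c\<in>C. emeasure \<nu> (ball c r \<inter> S))"
      using C cap by (intro emeasure_subadditive_finite) auto
    also have "\<dots> = 0" using C 0 h by (auto intro!: sum.neutral)
    finally show False using one by simp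
  qed
  have hfin: "h r \<noteq> \<infinity>" for r using N.emeasure_finite by (simp add: h_def)
  define r where "r i = 1 / real (Suc i)" for i
  have rpos: "r i > 0" for i by (simp add: r_def)
  define \<phi> where "\<phi> i x = indicator V x * emeasure \<nu> (V \<inter> ball x (r i)) / h (r i)" for i x
  have inner: "indicator V x * emeasure \<nu> (V \<inter> ball x t) = (\<integral>\<^sup>+y. indicator V x * indicator V y * k t x y \<partial>\<nu>)" for x t
  proof (cases "x \<in> V")
    case True
    then show ?thesis using k\<nu>[OF Vm(2)] by simp
  qed simp
  have \<phi>m: "\<phi> i \<in> borel_measurable \<mu>" for i
  proof -
    have "(\<lambda>x. \<integral>\<^sup>+y. indicator V x * indicator V y * k (r i) x y \<partial>\<nu>) \<in> borel_measurable \<mu>"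
      using kVm[of "r i"] by (intro N.borel_measurable_nn_integral) simp
    then have "(\<lambda>x. indicator V x * emeasure \<nu> (V \<inter> ball x (r i))) \<in> borel_measurable \<mu>"
      by (simp add: inner)
    then show ?thesis unfolding \<phi>_def by measurable
  qed
  have int_\<phi>: "(\<integral>\<^sup>+x. \<phi> i x \<partial>\<mu>) \<le> emeasure \<nu> V" for i
  proof -
    let ?h = "h (r i)"
    have m: "(\<lambda>x. indicator V x * emeasure \<nu> (V \<inter> ball x (r i))) \<in> borel_measurable \<mu>"
      unfolding inner using kVm[of "r i"] by (intro N.borel_measurable_nn_integral) simp
    have "(\<integral>\<^sup>+x. indicator V x * emeasure \<nu> (V \<inter> ball x (r i)) \<partial>\<mu>)
        = (\<integral>\<^sup>+x. \<integral>\<^sup>+y. indicator V x * indicator V y * k (r i) x y \<partial>\<nu> \<partial>\<mu>)"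
      by (simp add: inner)
    also have "\<dots> = (\<integral>\<^sup>+y. \<integral>\<^sup>+x. indicator V x * indicator V y * k (r i) x y \<partial>\<mu> \<partial>\<nu>)"
      by (rule P.Fubini'[symmetric]) (rule kVm)
    also have "\<dots> \<le> (\<integral>\<^sup>+y. ?h * indicator V y \<partial>\<nu>)"
    proof (intro nn_integral_mono)
      fix y assume "y \<in> space \<nu>"
      then have y: "y \<in> S" by (simp add: sp)
      show "(\<integral>\<^sup>+x. indicator V x * indicator V y * k (r i) x y \<partial>\<mu>) \<le> ?h * indicator V y"
      proof (cases "y \<in> V")
        case True
        then have "(\<integral>\<^sup>+x. indicator V x * indicator V y * k (r i) x y \<partial>\<mu>) = emeasure \<mu> (V \<inter> ball y (r i))"
          using k\<mu>[OF Vm(1)] by simp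
        also have "\<dots> \<le> emeasure \<mu> (ball y (r i) \<inter> S)"
          using cap by (intro emeasure_mono) (auto simp: V_def)
        also have "\<dots> = ?h" using g[OF y] gh by simp
        finally show ?thesis using True by simp
      qed simp
    qed
    also have "\<dots> = ?h * emeasure \<nu> V" by (simp add: nn_integral_cmult_indicator)
    finally have le: "(\<integral>\<^sup>+x. indicator V x * emeasure \<nu> (V \<inter> ball x (r i)) \<partial>\<mu>) \<le> ?h * emeasure \<nu> V" .
    have "(\<integral>\<^sup>+x. \<phi> i x \<partial>\<mu>) = (\<integral>\<^sup>+x. indicator V x * emeasure \<nu> (V \<inter> ball x (r i)) \<partial>\<mu>) / ?h"
      unfolding \<phi>_def by (rule nn_integral_divide) (rule m)
    also have "\<dots> \<le> ?h * emeasure \<nu> V / ?h" by (rule divide_right_mono_ennreal) (rule le)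
    also have "\<dots> = emeasure \<nu> V"
      using hpos[OF rpos[of i]] hfin[of "r i"] by (simp add: ennreal_mult_divide_eq mult.commute[of ?h])
    finally show ?thesis .
  qed
  have lim: "liminf (\<lambda>i. \<phi> i x) = 1" if x: "x \<in> V" for x
  proof -
    obtain d where d: "d > 0" "ball x d \<subseteq> U" using U x by (auto simp: V_def open_contains_ball)
    have "r \<longlonglongrightarrow> 0" unfolding r_def by (rule LIMSEQ_Suc[OF lim_1_over_n])
    then have "eventually (\<lambda>i. r i < d) sequentially" using d(1) by (rule order_tendstoD(2))
    then have "eventually (\<lambda>i. \<phi> i x = 1) sequentially"
    proof eventually_elim
      case (elim i)
      then have "ball x (r i) \<subseteq> U" using d(2) by force
      then have "V \<inter> ball x (r i) = ball x (r i) \<inter> S" by (auto simp: V_def)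
      moreover have "x \<in> S" using x by (simp add: V_def)
      ultimately show ?case
        using x h hpos[OF rpos[of i]] hfin[of "r i"] by (simp add: \<phi>_def ennreal_divide_self less_top)
    qed
    then have "(\<lambda>i. \<phi> i x) \<longlonglongrightarrow> 1" by (rule tendsto_eventually)
    then show ?thesis by (rule lim_imp_Liminf[OF sequentially_bot])
  qed
  have "emeasure \<mu> V = (\<integral>\<^sup>+x. indicator V x \<partial>\<mu>)" by simp
  also have "\<dots> \<le> (\<integral>\<^sup>+x. liminf (\<lambda>i. \<phi> i x) \<partial>\<mu>)"
    by (intro nn_integral_mono) (auto simp: indicator_def lim)
  also have "\<dots> \<le> liminf (\<lambda>i. \<integral>\<^sup>+x. \<phi> i x \<partial>\<mu>)"
    by (intro nn_integral_liminf \<phi>m)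
  also have "\<dots> \<le> liminf (\<lambda>i::nat. emeasure \<nu> V)"
    by (intro Liminf_mono always_eventually allI int_\<phi>)
  also have "\<dots> = emeasure \<nu> V" by (simp add: Liminf_const)
  finally show ?thesis by (simp add: V_def S_def)
qed

lemma rotation_invariant_prob_ex1:
  assumes n: "CARD('n) \<ge> 2"
  shows "\<exists>!\<sigma> :: (real^'n) measure. rotation_invariant_prob \<sigma>"
proof (rule ex_ex1I)
  show "\<exists>\<sigma> :: (real^'n) measure. rotation_invariant_prob \<sigma>"
    by (rule rotation_invariant_prob_exists)
  fix \<mu> \<nu> :: "(real^'n) measure"
  assume \<mu>: "rotation_invariant_prob \<mu>" and \<nu>: "rotation_invariant_prob \<nu>"
  define S :: "(real^'n) set" where "S = sphere 0 1"
  define E where "E = (\<lambda>U. U \<inter> S) ` {U. open U}"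
  have gen: "sets (restrict_space borel S) = sigma_sets S E"
  proof -
    have "sets (restrict_space borel S) = (\<inter>) S ` sigma_sets UNIV {U. open U}"
      by (simp add: sets_restrict_space borel_def)
    also have "\<dots> = sigma_sets S ((\<inter>) S ` {U. open U})"
      by (rule sigma_sets_Int) (use borel_closed[of S] in \<open>simp_all add: S_def borel_def\<close>)
    also have "(\<inter>) S ` {U. open U} = E" by (auto simp: E_def Int_commute)
    finally show ?thesis .
  qed
  show "\<mu> = \<nu>"
  proof (rule measure_eqI_generator_eq[where E = E and \<Omega> = S and A = "\<lambda>_. S"])
    show "Int_stable E"
    proof (rule Int_stableI)
      fix a b assume "a \<in> E" "b \<in> E"
      then obtain U W where "a = U \<inter> S" "b = W \<inter> S" "open U" "open W" by (auto simp: E_def)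
      then have "a \<inter> b = (U \<inter> W) \<inter> S" "open (U \<inter> W)" by auto
      then show "a \<inter> b \<in> E" by (auto simp: E_def)
    qed
    show "E \<subseteq> Pow S" by (auto simp: E_def)
    show "emeasure \<mu> X = emeasure \<nu> X" if "X \<in> E" for X
      using that rotation_invariant_prob_le[OF n \<mu> \<nu>] rotation_invariant_prob_le[OF n \<nu> \<mu>]
      by (auto simp: E_def S_def intro!: antisym)
    show "sets \<mu> = sigma_sets S E" "sets \<nu> = sigma_sets S E"
      using \<mu> \<nu> gen by (auto simp: rotation_invariant_prob_def S_def)
    show "range (\<lambda>_. S) \<subseteq> E" by (auto simp: E_def intro!: image_eqI[of _ _ UNIV])
    show "(\<Union>i::nat. S) = S" by simp
    show "emeasure \<mu> S \<noteq> \<infinity>" using \<mu> by (simp add: rotation_invariant_prob_def S_def)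
  qed
qed

text \<open>Meaningful in dimension at least two, by the preceding lemma; in dimension one the only
  rotation (determinant one) is the identity and uniqueness fails.\<close>

definition sphere_measure :: "(real^'n) measure" where
  "sphere_measure = (THE \<sigma>. rotation_invariant_prob \<sigma>)"

lemma rotation_invariant_prob_sphere_measure:
  assumes "CARD('n) \<ge> 2"
  shows "rotation_invariant_prob (sphere_measure :: (real^'n) measure)"
  unfolding sphere_measure_def by (rule theI'[OF rotation_invariant_prob_ex1[OF assms]])

text \<open>On an open set \<open>D\<close>: \<open>u\<close> is twice continuously differentiable, with gradient \<open>g\<close> and
  Hessian matrix \<open>H\<close>, and its Laplacian (the sum of the pure second partial derivatives) is zero.
  Only the values of \<open>u\<close> on \<open>D\<close> matter.\<close>

definition harmonic_on :: "(real^'n \<Rightarrow> real) \<Rightarrow> (real^'n) set \<Rightarrow> bool" where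
  "harmonic_on u D \<longleftrightarrow> open D \<and>
     (\<exists>(g :: real^'n \<Rightarrow> real^'n) (H :: real^'n \<Rightarrow> real^'n^'n).
        (\<forall>x\<in>D. (u has_derivative (\<lambda>h. g x \<bullet> h)) (at x)) \<and>
        (\<forall>x\<in>D. (g has_derivative (\<lambda>h. H x *v h)) (at x)) \<and>
        continuous_on D H \<and>
        (\<forall>x\<in>D. (\<Sum>i\<in>UNIV. H x $ i $ i) = 0))"

text \<open>The supremum over \<open>0 < r < 1\<close> of the integral means of \<open>\<bar>u\<bar> powr p\<close>, as an extended
  nonnegative number, so that finiteness is a meaningful condition.\<close>

definition hardy_mean_sup :: "real \<Rightarrow> (real^'n \<Rightarrow> real) \<Rightarrow> ennreal" where
  "hardy_mean_sup p u =
     (SUP r\<in>{0<..<1}. \<integral>\<^sup>+\<zeta>. ennreal (\<bar>u (r *\<^sub>R \<zeta>)\<bar> powr p) \<partial>sphere_measure)"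

definition hardy_space :: "ereal \<Rightarrow> (real^'n \<Rightarrow> real) set" where
  "hardy_space p = {u. harmonic_on u (ball 0 1) \<and>
     (if p = \<infinity> then bounded (u ` ball 0 1)
      else hardy_mean_sup (real_of_ereal p) u < \<infinity>)}"

definition hardy_norm :: "ereal \<Rightarrow> (real^'n \<Rightarrow> real) \<Rightarrow> real" where
  "hardy_norm p u =
     (if p = \<infinity> then (SUP x\<in>ball 0 1. \<bar>u x\<bar>)
      else enn2real (hardy_mean_sup (real_of_ereal p) u) powr (1 / real_of_ereal p))"

definition hardy_const :: "nat \<Rightarrow> real \<Rightarrow> real" where
  "hardy_const n q =
     (if q \<le> 2 - 2 / real n then 1
      else (2 powr (real n * q - real n) * Gamma (real n / 2) * Gamma ((1 + real n * q - real n) / 2)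
            / (sqrt pi * Gamma (real n * q / 2))) powr (1 / q))"

end

theory Submission
  imports Defs
begin

text \<open>Write \<open>n\<close> for the dimension, \<open>\<sigma>\<close> for the rotation invariant probability on the unit sphere and
  \<open>P x z = (1 - \<bar>x\<bar>\<^sup>2) / \<bar>x - z\<bar>\<^sup>n\<close> for the Poisson kernel. A function that is harmonic near the closed
  ball is the Poisson integral of its boundary values, so applying Hoelder's inequality to the dilates
  \<open>u (r x)\<close> and letting \<open>r\<close> tend to \<open>1\<close> gives \<open>\<bar>u x\<bar> \<le> (\<integral> P x z powr q d\<sigma>) powr (1/q) \<cdot> \<parallel>u\<parallel>\<close>. For \<open>1 < p < \<infinity>\<close>
  equality occurs at \<open>x\<close> for the Poisson integral of \<open>P x powr (q - 1)\<close>. Hence the best constant is the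
  supremum over the ball of \<open>(1 - \<bar>x\<bar>\<^sup>2) powr ((n - 1) / p) \<cdot> (\<integral> P x z powr q d\<sigma>) powr (1/q)\<close>.
  The case \<open>p = \<infinity>\<close> is immediate, and the function \<open>1\<close> is extremal there.

  The heart of the matter is to compute this supremum. Let \<open>sqdist_mean m x\<close> be the mean of
  \<open>\<bar>x - z\<bar> powr (2 m)\<close> over \<open>z\<close> on the sphere, so that \<open>\<integral> P x z powr q d\<sigma>\<close> is a power of \<open>1 - \<bar>x\<bar>\<^sup>2\<close> times
  \<open>sqdist_mean (- (n q / 2)) x\<close>. The reflection identity \<open>sqdist_mean_reflection\<close> turns the last
  factor into a power of \<open>1 - \<bar>x\<bar>\<^sup>2\<close> times \<open>sqdist_mean m x\<close> with \<open>m = n q / 2 - n + 1\<close>, and the powers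
  of \<open>1 - \<bar>x\<bar>\<^sup>2\<close> cancel exactly (\<open>integral_poisson_kernel_powr\<close>). The quantity to be maximised is therefore
  \<open>sqdist_mean m x powr (1/q)\<close>. The Laplacian of \<open>\<bar>x - z\<bar> powr (2 m)\<close> has the sign of \<open>m (2 m + n - 2)\<close>,
  and \<open>2 m + n - 2 = n (q - 1)\<close> is nonnegative. So if \<open>m \<le> 0\<close>, that is \<open>q \<le> 2 - 2/n\<close>, then \<open>sqdist_mean m\<close> is
  superharmonic and radial, and its supremum is the value \<open>1\<close> at the centre. If \<open>m > 0\<close> it is
  subharmonic, the supremum is the limit at the boundary, and that limit is a Beta integral
  which the duplication formula brings to the form of \<open>hardy_const\<close>.

  Integrals of functions of one coordinate over the sphere are reduced to Beta integrals
  (\<open>integral_sphere_coordinate\<close>): differentiating the invariance under plane rotations yields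
  a recursion for the moments of \<open>(1 - z $ i) / 2\<close> which is that of a Beta distribution, and
  polynomials are dense. In one dimension the reflection identity is a change of variables
  by an involution. The facts on harmonic functions (harmonicity and total mass of the Poisson
  kernel, the Poisson representation) all rest on the maximum principle for
  \<open>C\<^sup>2\<close> functions and on differentiation under the integral sign.\<close>

section \<open>Integration over the sphere\<close>

lemma sets_sphere_measure:
  assumes "2 \<le> CARD('n::finite)"
  shows "sets (sphere_measure :: (real^'n) measure) = sets (restrict_space borel (sphere 0 1))"
  using rotation_invariant_prob_sphere_measure[OF assms]
  by (simp add: rotation_invariant_prob_def)

lemma space_sphere_measure:
  assumes "2 \<le> CARD('n::finite)"
  shows "space (sphere_measure :: (real^'n) measure) = sphere 0 1"
  using sets_eq_imp_space_eq[OF sets_sphere_measure[OF assms]]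
  by (simp add: space_restrict_space)

lemma emeasure_sphere_measure_space:
  assumes "2 \<le> CARD('n::finite)"
  shows "emeasure (sphere_measure :: (real^'n) measure) (space sphere_measure) = 1"
  using rotation_invariant_prob_sphere_measure[OF assms]
  by (simp add: space_sphere_measure[OF assms] rotation_invariant_prob_def)

lemma finite_measure_sphere_measure:
  assumes "2 \<le> CARD('n::finite)"
  shows "finite_measure (sphere_measure :: (real^'n) measure)"
  by (rule finite_measureI) (simp add: emeasure_sphere_measure_space[OF assms])

lemma measurable_sphere_continuous:
  fixes f :: "real^'n::finite \<Rightarrow> 'b::topological_space"
  assumes "2 \<le> CARD('n)" "continuous_on (sphere 0 1) f"
  shows "f \<in> borel_measurable sphere_measure"
  using borel_measurable_continuous_on_restrict[OF assms(2)]
  by (simp cong: measurable_cong_sets add: sets_sphere_measure[OF assms(1)])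

lemma integrable_sphere_continuous:
  fixes f :: "real^'n::finite \<Rightarrow> 'b::{banach,second_countable_topology}"
  assumes n: "2 \<le> CARD('n)" and f: "continuous_on (sphere 0 1) f"
  shows "integrable sphere_measure f"
proof -
  interpret finite_measure "sphere_measure :: (real^'n) measure"
    by (rule finite_measure_sphere_measure[OF n])
  have "bounded (f ` sphere 0 1)"
    by (intro compact_imp_bounded compact_continuous_image f) auto
  then obtain B where "\<And>z. z \<in> sphere 0 1 \<Longrightarrow> norm (f z) \<le> B"
    unfolding bounded_iff by blast
  then show ?thesis
    by (intro integrable_const_bound[where B = B] measurable_sphere_continuous n f)
       (auto simp: space_sphere_measure[OF n])
qed

lemma integral_sphere_cong:
  fixes f g :: "real^'n::finite \<Rightarrow> 'b::{banach,second_countable_topology}"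
  assumes n: "2 \<le> CARD('n)" and "\<And>z. z \<in> sphere 0 1 \<Longrightarrow> f z = g z"
  shows "integral\<^sup>L sphere_measure f = integral\<^sup>L sphere_measure g"
  by (rule Bochner_Integration.integral_cong) (auto simp: space_sphere_measure[OF n] assms)

lemma integral_sphere_const:
  fixes c :: "'b::{banach,second_countable_topology}"
  assumes n: "2 \<le> CARD('n::finite)"
  shows "(\<integral>z. c \<partial>(sphere_measure :: (real^'n) measure)) = c"
proof -
  interpret finite_measure "sphere_measure :: (real^'n) measure"
    by (rule finite_measure_sphere_measure[OF n])
  show ?thesis by (simp add: measure_def emeasure_sphere_measure_space[OF n])
qed

lemma integral_sphere_mono:
  fixes f g :: "real^'n::finite \<Rightarrow> real"
  assumes n: "2 \<le> CARD('n)" and f: "continuous_on (sphere 0 1) f"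
    and g: "continuous_on (sphere 0 1) g"
    and "\<And>z. z \<in> sphere 0 1 \<Longrightarrow> f z \<le> g z"
  shows "integral\<^sup>L sphere_measure f \<le> integral\<^sup>L sphere_measure g"
  by (intro integral_mono integrable_sphere_continuous n f g)
     (auto simp: space_sphere_measure[OF n] assms)

lemma integral_sphere_norm_le:
  fixes f :: "real^'n::finite \<Rightarrow> 'b::{banach,second_countable_topology}"
  assumes n: "2 \<le> CARD('n)" and f: "continuous_on (sphere 0 1) f"
    and "\<And>z. z \<in> sphere 0 1 \<Longrightarrow> norm (f z) \<le> B"
  shows "norm (integral\<^sup>L sphere_measure f) \<le> B"
proof -
  have "norm (integral\<^sup>L sphere_measure f) \<le> (\<integral>z. norm (f z) \<partial>sphere_measure)"
    by (rule integral_norm_bound)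
  also have "\<dots> \<le> (\<integral>z. B \<partial>(sphere_measure :: (real^'n) measure))"
    by (intro integral_sphere_mono n continuous_intros f assms)
  finally show ?thesis unfolding integral_sphere_const[OF n] .
qed

lemma integral_sphere_rotation:
  fixes f :: "real^'n::finite \<Rightarrow> 'b::{banach,second_countable_topology}"
  assumes n: "2 \<le> CARD('n)" and Q: "rotation_matrix Q" and f: "continuous_on (sphere 0 1) f"
  shows "(\<integral>z. f (Q *v z) \<partial>sphere_measure) = integral\<^sup>L sphere_measure f"
proof -
  let ?S = "sphere_measure :: (real^'n) measure"
  let ?T = "\<lambda>z. Q *v z"
  have T: "orthogonal_transformation ?T"
    using Q by (simp add: rotation_matrix_def orthogonal_transformation_matrix)
  have nT: "norm (?T z) = norm z" for z
    using T by (simp add: orthogonal_transformation)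
  have bT: "bij ?T" using T by (rule orthogonal_transformation_bij)
  have "continuous_on (sphere 0 1) ?T"
    by (intro linear_continuous_on) (simp add: linear_conv_bounded_linear[symmetric])
  then have "?T \<in> restrict_space borel (sphere 0 1) \<rightarrow>\<^sub>M restrict_space borel (sphere 0 1)"
    by (intro measurable_restrict_space2 borel_measurable_continuous_on_restrict)
       (auto simp: space_restrict_space nT)
  then have Tm: "?T \<in> ?S \<rightarrow>\<^sub>M ?S"
    by (simp cong: measurable_cong_sets add: sets_sphere_measure[OF n])
  have "distr ?S ?S ?T = ?S"
  proof (rule measure_eqI)
    fix A assume "A \<in> sets (distr ?S ?S ?T)"
    then have A: "A \<in> sets ?S" by simp
    let ?B = "?T -` A \<inter> space ?S"
    have B: "?B \<in> sets ?S" by (rule measurable_sets[OF Tm A])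
    have "A \<subseteq> sphere 0 1" using sets.sets_into_space[OF A] by (simp add: space_sphere_measure[OF n])
    then have "?B = ?T -` A"
      using nT by (auto simp: space_sphere_measure[OF n] subset_iff)
    then have "?T ` ?B = A"
      using bT by (simp add: bij_is_surj surj_image_vimage_eq)
    moreover have "emeasure ?S (?T ` ?B) = emeasure ?S ?B"
      using rotation_invariant_prob_sphere_measure[OF n] Q B
      unfolding rotation_invariant_prob_def by blast
    ultimately show "emeasure (distr ?S ?S ?T) A = emeasure ?S A"
      by (simp add: emeasure_distr[OF Tm A])
  qed simp
  then show ?thesis
    using integral_distr[OF Tm measurable_sphere_continuous[OF n f]] by simp
qed

text \<open>In dimension at least two some rotation carries \<open>x\<close> to any \<open>y\<close> of the same norm. This is what makes
  averages of \<open>\<bar>x - z\<bar>\<close> over the sphere radial in \<open>x\<close>.\<close>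

lemma integral_sphere_zonal_norm_eq:
  fixes x y :: "real^'n::finite" and f :: "real \<Rightarrow> real"
  assumes n: "2 \<le> CARD('n)" and xy: "norm x = norm y"
    and f: "continuous_on {- norm x..norm x} f"
  shows "(\<integral>z. f (x \<bullet> z) \<partial>sphere_measure) = (\<integral>z. f (y \<bullet> z) \<partial>sphere_measure)"
proof -
  obtain h where h: "orthogonal_transformation h" "det (matrix h) = 1" "h x = y"
    using rotation_exists[OF n xy] by metis
  then have Q: "rotation_matrix (matrix h)"
    by (simp add: rotation_matrix_def orthogonal_transformation_matrix)
  have hQ: "matrix h *v z = h z" for z
    using h(1) by (simp add: orthogonal_transformation matrix_works linear_matrix_vector_mul_eq)
  have "\<bar>y \<bullet> z\<bar> \<le> norm y" if "z \<in> sphere 0 1" for z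
    using Cauchy_Schwarz_ineq2[of y z] that by simp
  then have "y \<bullet> z \<in> {- norm x..norm x}" if "z \<in> sphere 0 1" for z
    using that xy by (force simp: abs_le_iff)
  then have c: "continuous_on (sphere 0 1) (\<lambda>z. f (y \<bullet> z))"
    by (intro continuous_on_compose2[OF f] continuous_intros) auto
  have "(\<integral>z. f (y \<bullet> z) \<partial>sphere_measure) = (\<integral>z. f (y \<bullet> h z) \<partial>sphere_measure)"
    using integral_sphere_rotation[OF n Q c] by (simp add: hQ)
  also have "(\<lambda>z. y \<bullet> h z) = (\<lambda>z. x \<bullet> z)"
    using h(1) unfolding orthogonal_transformation_def h(3)[symmetric] by blast
  finally show ?thesis by (simp add: fun_eq_iff)
qed

lemma continuous_on_slice:
  assumes "continuous_on (D \<times> C) (\<lambda>p. K (fst p) (snd p))" "x \<in> D"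
  shows "continuous_on C (K x)"
proof -
  have "continuous_on C (\<lambda>z. K (fst (x, z)) (snd (x, z)))"
    by (rule continuous_on_compose2[OF assms(1)]) (auto intro!: continuous_intros simp: assms(2))
  then show ?thesis by simp
qed

lemma continuous_on_integral_sphere:
  fixes K :: "'a::metric_space \<Rightarrow> real^'n::finite \<Rightarrow> 'b::{banach,second_countable_topology}"
  assumes n: "2 \<le> CARD('n)"
    and K: "continuous_on (D \<times> sphere 0 1) (\<lambda>p. K (fst p) (snd p))"
  shows "continuous_on D (\<lambda>x. \<integral>z. K x z \<partial>sphere_measure)"
  unfolding continuous_on_iff
proof (intro ballI allI impI)
  fix x and e :: real assume x: "x \<in> D" and e: "e > 0"
  obtain X where X: "x \<in> X" "open X"
    and le: "\<And>y z. y \<in> X \<inter> D \<Longrightarrow> z \<in> sphere 0 1 \<Longrightarrow> dist (K y z) (K x z) \<le> e/2"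
    using continuous_on_prod_compactE[OF K compact_sphere x, of "e/2"] e
    by (metis fst_conv snd_conv half_gt_zero)
  obtain d where d: "d > 0" "ball x d \<subseteq> X" using X by (auto simp: open_contains_ball)
  have cont: "continuous_on (sphere 0 1) (K y)" if "y \<in> D" for y
    by (rule continuous_on_slice[OF K that])
  have "dist (\<integral>z. K y z \<partial>sphere_measure) (\<integral>z. K x z \<partial>sphere_measure) < e"
    if y: "y \<in> D" "dist y x < d" for y
  proof -
    have yX: "y \<in> X \<inter> D" using y d by (auto simp: dist_commute)
    have "norm (\<integral>z. K y z - K x z \<partial>sphere_measure) \<le> e/2"
      using le[OF yX] by (intro integral_sphere_norm_le n continuous_intros cont y x) (auto simp: dist_norm)
    then show ?thesis
      using e by (simp add: dist_norm integrable_sphere_continuous[OF n] cont y x)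
  qed
  with d show "\<exists>d>0. \<forall>y\<in>D. dist y x < d \<longrightarrow>
      dist (\<integral>z. K y z \<partial>sphere_measure) (\<integral>z. K x z \<partial>sphere_measure) < e" by blast
qed

text \<open>A linearization error governed by the oscillation of the gradient alone: for a kernel with
  jointly continuous gradient the bound is uniform over a compact parameter set, so it can be
  integrated.\<close>

lemma gradient_bound_linearization:
  fixes f :: "'a::euclidean_space \<Rightarrow> real"
  assumes der: "\<And>w. w \<in> ball x d \<Longrightarrow> (f has_derivative (\<lambda>h. g w \<bullet> h)) (at w)"
    and le: "\<And>w. w \<in> ball x d \<Longrightarrow> norm (g w - g x) \<le> e" and y: "y \<in> ball x d"
  shows "norm (f y - f x - g x \<bullet> (y - x)) \<le> e * norm (y - x)"
proof -
  have 1: "x + t *\<^sub>R (y - x) \<in> ball x d" if t: "t \<in> {0..1}" for t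
  proof -
    have "(1 - t) *\<^sub>R x + t *\<^sub>R y \<in> ball x d"
      using t y by (intro convexD[OF convex_ball]) (auto simp: order.strict_trans1[OF zero_le_dist])
    then show ?thesis by (simp add: algebra_simps)
  qed
  have 2: "(f has_derivative (\<lambda>h. g w \<bullet> h)) (at w within ball x d)" if "w \<in> ball x d" for w
    using der[OF that] by (rule has_derivative_at_withinI)
  have 3: "onorm ((\<lambda>h. g w \<bullet> h) - (\<lambda>h. g x \<bullet> h)) \<le> e" if w: "w \<in> ball x d" for w
  proof (rule onorm_le)
    fix h
    have "norm (((\<lambda>h. g w \<bullet> h) - (\<lambda>h. g x \<bullet> h)) h) = \<bar>(g w - g x) \<bullet> h\<bar>"
      by (simp add: inner_diff_left)
    also have "\<dots> \<le> norm (g w - g x) * norm h" by (rule Cauchy_Schwarz_ineq2)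
    also have "\<dots> \<le> e * norm h"
      by (intro mult_right_mono le w) auto
    finally show "norm (((\<lambda>h. g w \<bullet> h) - (\<lambda>h. g x \<bullet> h)) h) \<le> e * norm h" .
  qed
  have 4: "x \<in> ball x d" using y by (auto intro: le_less_trans[OF zero_le_dist])
  show ?thesis
    using differentiable_bound_linearization[where f = f and a = x and b = y and S = "ball x d"
        and f' = "\<lambda>w h. g w \<bullet> h" and ?x0.0 = x and B = e, OF 1 2 3 4]
    by (simp add: mult.commute)
qed

text \<open>The sphere being compact, the gradients are close to the gradient at \<open>x\<close> uniformly in \<open>z\<close>, and the
  uniform linearization error integrates to an error of the same size.\<close>

lemma has_derivative_integral_sphere:
  fixes K :: "'a::euclidean_space \<Rightarrow> real^'n::finite \<Rightarrow> real"
    and g :: "'a \<Rightarrow> real^'n \<Rightarrow> 'a"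
  assumes n: "2 \<le> CARD('n)" and D: "open D" "x \<in> D"
    and K: "\<And>y. y \<in> D \<Longrightarrow> continuous_on (sphere 0 1) (K y)"
    and g: "continuous_on (D \<times> sphere 0 1) (\<lambda>p. g (fst p) (snd p))"
    and der: "\<And>y z. y \<in> D \<Longrightarrow> z \<in> sphere 0 1 \<Longrightarrow>
        ((\<lambda>y. K y z) has_derivative (\<lambda>h. g y z \<bullet> h)) (at y)"
  shows "((\<lambda>y. \<integral>z. K y z \<partial>sphere_measure) has_derivative
      (\<lambda>h. (\<integral>z. g x z \<partial>sphere_measure) \<bullet> h)) (at x)"
  unfolding has_derivative_at_alt
proof (intro conjI allI impI)
  show "bounded_linear (\<lambda>h. (\<integral>z. g x z \<partial>sphere_measure) \<bullet> h)"
    by (rule bounded_linear_inner_right)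
  fix e :: real assume e: "e > 0"
  obtain X where X: "x \<in> X" "open X"
    and le: "\<And>y z. y \<in> X \<inter> D \<Longrightarrow> z \<in> sphere 0 1 \<Longrightarrow> dist (g y z) (g x z) \<le> e"
    using continuous_on_prod_compactE[OF g compact_sphere D(2) e]
    by (metis fst_conv snd_conv)
  have "open (X \<inter> D)" using X D by auto
  then obtain d where d: "d > 0" "ball x d \<subseteq> X \<inter> D"
    using X(1) D(2) by (meson IntI open_contains_ball)
  have gc: "continuous_on (sphere 0 1) (g x)" by (rule continuous_on_slice[OF g D(2)])
  have "norm ((\<integral>z. K y z \<partial>sphere_measure) - (\<integral>z. K x z \<partial>sphere_measure)
      - (\<integral>z. g x z \<partial>sphere_measure) \<bullet> (y - x)) \<le> e * norm (y - x)" if y: "norm (y - x) < d" for y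
  proof -
    have yb: "y \<in> ball x d" using y by (simp add: dist_norm norm_minus_commute)
    then have yD: "y \<in> D" using d by blast
    have eq: "(\<integral>z. K y z \<partial>sphere_measure) - (\<integral>z. K x z \<partial>sphere_measure)
      - (\<integral>z. g x z \<partial>sphere_measure) \<bullet> (y - x)
      = (\<integral>z. K y z - K x z - g x z \<bullet> (y - x) \<partial>sphere_measure)"
      by (simp add: integrable_sphere_continuous[OF n] K yD D gc continuous_intros)
    have "norm (K y z - K x z - g x z \<bullet> (y - x)) \<le> e * norm (y - x)" if z: "z \<in> sphere 0 1" for z
    proof (rule gradient_bound_linearization[OF _ _ yb])
      fix w assume "w \<in> ball x d"
      then have w: "w \<in> X \<inter> D" using d(2) by blast
      show "((\<lambda>y. K y z) has_derivative (\<lambda>h. g w z \<bullet> h)) (at w)" using w z by (intro der) auto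
      show "norm (g w z - g x z) \<le> e" using le[OF w z] by (simp add: dist_norm)
    qed
    then show ?thesis
      unfolding eq by (intro integral_sphere_norm_le n continuous_intros K yD D gc)
  qed
  with d show "\<exists>d>0. \<forall>y. norm (y - x) < d \<longrightarrow> norm ((\<integral>z. K y z \<partial>sphere_measure)
      - (\<integral>z. K x z \<partial>sphere_measure) - (\<integral>z. g x z \<partial>sphere_measure) \<bullet> (y - x)) \<le> e * norm (y - x)"
    by blast
qed

section \<open>Twice continuously differentiable functions and the maximum principle\<close>

text \<open>The regularity required of a harmonic function, with gradient and Hessian as explicit
  witnesses. Sub- and superharmonic functions are expressed by the sign of \<open>trace (H x)\<close>.\<close>

definition C2_on :: "(real^'n \<Rightarrow> real) \<Rightarrow> (real^'n \<Rightarrow> real^'n) \<Rightarrow> (real^'n \<Rightarrow> real^'n^'n)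
    \<Rightarrow> (real^'n) set \<Rightarrow> bool" where
  "C2_on u g H D \<longleftrightarrow>
     (\<forall>x\<in>D. (u has_derivative (\<lambda>h. g x \<bullet> h)) (at x)) \<and>
     (\<forall>x\<in>D. (g has_derivative (\<lambda>h. H x *v h)) (at x)) \<and> continuous_on D H"

lemma harmonic_on_iff_C2_on:
  "harmonic_on u D \<longleftrightarrow> open D \<and> (\<exists>g H. C2_on u g H D \<and> (\<forall>x\<in>D. trace (H x) = 0))"
  by (auto simp: harmonic_on_def C2_on_def trace_def)

lemma harmonic_onI:
  assumes "open D" "C2_on u g H D" "\<And>x. x \<in> D \<Longrightarrow> trace (H x) = 0"
  shows "harmonic_on u D"
  unfolding harmonic_on_iff_C2_on using assms by (intro conjI exI[of _ g] exI[of _ H]) auto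

lemma harmonic_onE:
  assumes "harmonic_on u D"
  obtains g H where "C2_on u g H D" "\<forall>x\<in>D. trace (H x) = 0" "open D"
  using assms unfolding harmonic_on_iff_C2_on by (elim conjE exE) (rule that)

lemma C2_on_subset: "C2_on u g H D \<Longrightarrow> E \<subseteq> D \<Longrightarrow> C2_on u g H E"
  by (auto simp: C2_on_def intro: continuous_on_subset)

lemma C2_onD:
  assumes "C2_on u g H D"
  shows "x \<in> D \<Longrightarrow> (u has_derivative (\<lambda>h. g x \<bullet> h)) (at x)"
    and "x \<in> D \<Longrightarrow> (g has_derivative (\<lambda>h. H x *v h)) (at x)"
    and "continuous_on D H"
  using assms by (simp_all add: C2_on_def)

lemma C2_on_continuous: "C2_on u g H D \<Longrightarrow> continuous_on D u"
  by (rule has_derivative_continuous_on[where f' = "\<lambda>x h. g x \<bullet> h"])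
     (rule has_derivative_at_withinI, rule C2_onD(1))

lemma C2_on_continuous_gradient: "C2_on u g H D \<Longrightarrow> continuous_on D g"
  by (rule has_derivative_continuous_on[where f' = "\<lambda>x h. H x *v h"])
     (rule has_derivative_at_withinI, rule C2_onD(2))

lemma has_derivative_vec_component:
  "(g has_derivative g') F \<Longrightarrow> ((\<lambda>x. g x $ i) has_derivative (\<lambda>h. g' h $ i)) F"
  by (rule bounded_linear.has_derivative[OF bounded_linear_vec_nth])

lemma has_derivative_vecI:
  fixes g :: "'a::real_normed_vector \<Rightarrow> real^'n"
  assumes "\<And>i. ((\<lambda>x. g x $ i) has_derivative (\<lambda>h. g' h $ i)) (at x within S)"
  shows "(g has_derivative g') (at x within S)"
  by (subst has_derivative_componentwise_within)
     (auto simp: Basis_vec_def inner_axis assms)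

text \<open>The second derivative is obtained by applying the differentiation lemma again, to each
  component of the gradient; its gradient is the corresponding row of the Hessian.\<close>

lemma C2_on_integral_sphere:
  fixes K :: "real^'n::finite \<Rightarrow> real^'n \<Rightarrow> real"
  assumes n: "2 \<le> CARD('n)" and D: "open D"
    and C2: "\<And>z. z \<in> sphere 0 1 \<Longrightarrow> C2_on (\<lambda>x. K x z) (\<lambda>x. g x z) (\<lambda>x. H x z) D"
    and K: "continuous_on (D \<times> sphere 0 1) (\<lambda>p. K (fst p) (snd p))"
    and g: "continuous_on (D \<times> sphere 0 1) (\<lambda>p. g (fst p) (snd p))"
    and H: "continuous_on (D \<times> sphere 0 1) (\<lambda>p. H (fst p) (snd p))"
  shows "C2_on (\<lambda>x. \<integral>z. K x z \<partial>sphere_measure) (\<lambda>x. \<integral>z. g x z \<partial>sphere_measure)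
    (\<lambda>x. \<integral>z. H x z \<partial>sphere_measure) D"
  unfolding C2_on_def
proof (intro conjI ballI)
  fix x assume x: "x \<in> D"
  show "((\<lambda>x. \<integral>z. K x z \<partial>sphere_measure) has_derivative (\<lambda>h. (\<integral>z. g x z \<partial>sphere_measure) \<bullet> h)) (at x)"
    using C2 by (intro has_derivative_integral_sphere[OF n D x _ g])
      (auto simp: C2_on_def intro: continuous_on_slice[OF K])
  show "((\<lambda>x. \<integral>z. g x z \<partial>sphere_measure) has_derivative (\<lambda>h. (\<integral>z. H x z \<partial>sphere_measure) *v h)) (at x)"
  proof (rule has_derivative_vecI)
    fix i
    have gi: "integrable sphere_measure (g y)" if "y \<in> D" for y
      by (intro integrable_sphere_continuous n continuous_on_slice[OF g that])
    have "((\<lambda>y. \<integral>z. g y z $ i \<partial>sphere_measure) has_derivative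
        (\<lambda>h. (\<integral>z. H x z $ i \<partial>sphere_measure) \<bullet> h)) (at x)"
    proof (rule has_derivative_integral_sphere[OF n D x])
      show "continuous_on (sphere 0 1) (\<lambda>z. g y z $ i)" if "y \<in> D" for y
        by (intro continuous_intros continuous_on_slice[OF g that])
      show "continuous_on (D \<times> sphere 0 1) (\<lambda>p. H (fst p) (snd p) $ i)"
        by (intro continuous_intros H)
      show "((\<lambda>y. g y z $ i) has_derivative (\<bullet>) (H y z $ i)) (at y)"
        if "y \<in> D" "z \<in> sphere 0 1" for y z
        using C2[OF that(2)] that(1) has_derivative_vec_component[of "\<lambda>y. g y z" "(*v) (H y z)" "at y" i]
        by (auto simp: C2_on_def matrix_vector_mul_component)
    qed
    also have "(\<integral>z. H x z $ i \<partial>sphere_measure) = (\<integral>z. H x z \<partial>sphere_measure) $ i"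
      by (intro integral_bounded_linear bounded_linear_vec_nth integrable_sphere_continuous n
          continuous_on_slice[OF H x])
    finally have "((\<lambda>y. \<integral>z. g y z $ i \<partial>sphere_measure) has_derivative
        (\<lambda>h. ((\<integral>z. H x z \<partial>sphere_measure) *v h) $ i)) (at x)"
      by (simp add: matrix_vector_mul_component)
    then show "((\<lambda>y. (\<integral>z. g y z \<partial>sphere_measure) $ i) has_derivative
        (\<lambda>h. ((\<integral>z. H x z \<partial>sphere_measure) *v h) $ i)) (at x)"
      by (rule has_derivative_transform_within_open[OF _ D x])
         (use gi integral_bounded_linear[OF bounded_linear_vec_nth] in auto)
  qed
qed (rule continuous_on_integral_sphere[OF n H])

lemma trace_scaleR: "trace (c *\<^sub>R A) = c * trace (A :: real^'n^'n)"
  by (simp add: trace_def sum_distrib_left)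

lemma trace_integral_sphere:
  fixes H :: "real^'n::finite \<Rightarrow> real^'n^'n"
  assumes n: "2 \<le> CARD('n)" and H: "continuous_on (sphere 0 1) H"
  shows "trace (\<integral>z. H z \<partial>sphere_measure) = (\<integral>z. trace (H z) \<partial>sphere_measure)"
proof -
  have "bounded_linear (trace :: real^'n^'n \<Rightarrow> real)"
    by (auto simp: linear_conv_bounded_linear[symmetric] trace_add trace_scaleR intro!: linearI)
  from integral_bounded_linear[OF this integrable_sphere_continuous[OF n H]] show ?thesis by simp
qed

text \<open>The rank-one matrix \<open>a b\<^sup>T\<close>; such terms appear in the Hessian of a product.\<close>

definition outer :: "real^'n \<Rightarrow> real^'n \<Rightarrow> real^'n^'n" where
  "outer a b = (\<chi> i j. a $ i * b $ j)"

lemma outer_mult_vec: "outer a b *v h = (b \<bullet> h) *\<^sub>R a"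
  by (simp add: outer_def vec_eq_iff matrix_vector_mult_def inner_vec_def sum_distrib_left mult_ac)

lemma trace_outer: "trace (outer a b) = a \<bullet> b"
  by (simp add: outer_def trace_def inner_vec_def)

lemma continuous_on_outer:
  "continuous_on D a \<Longrightarrow> continuous_on D b \<Longrightarrow> continuous_on D (\<lambda>x. outer (a x) (b x))"
  unfolding outer_def by (intro continuous_intros)

lemma C2_on_mult:
  assumes u: "C2_on u gu Hu D" and v: "C2_on v gv Hv D"
  shows "C2_on (\<lambda>x. u x * v x) (\<lambda>x. u x *\<^sub>R gv x + v x *\<^sub>R gu x)
    (\<lambda>x. u x *\<^sub>R Hv x + v x *\<^sub>R Hu x + outer (gv x) (gu x) + outer (gu x) (gv x)) D"
  unfolding C2_on_def
proof (intro conjI ballI)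
  fix x assume x: "x \<in> D"
  have du: "(u has_derivative (\<lambda>h. gu x \<bullet> h)) (at x)" "(v has_derivative (\<lambda>h. gv x \<bullet> h)) (at x)"
    "(gu has_derivative (\<lambda>h. Hu x *v h)) (at x)" "(gv has_derivative (\<lambda>h. Hv x *v h)) (at x)"
    using u v x by (auto simp: C2_on_def)
  show "((\<lambda>x. u x * v x) has_derivative (\<lambda>h. (u x *\<^sub>R gv x + v x *\<^sub>R gu x) \<bullet> h)) (at x)"
    by (rule has_derivative_eq_rhs[OF has_derivative_mult[OF du(1,2)]])
       (simp add: fun_eq_iff inner_add_left mult.commute)
  show "((\<lambda>x. u x *\<^sub>R gv x + v x *\<^sub>R gu x) has_derivative
     (\<lambda>h. (u x *\<^sub>R Hv x + v x *\<^sub>R Hu x + outer (gv x) (gu x) + outer (gu x) (gv x)) *v h)) (at x)"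
    by (rule has_derivative_eq_rhs[OF has_derivative_add[OF has_derivative_scaleR[OF du(1,4)]
            has_derivative_scaleR[OF du(2,3)]]])
       (simp add: fun_eq_iff matrix_vector_mult_add_rdistrib scaleR_matrix_vector_assoc[symmetric] outer_mult_vec add_ac)
next
  have c: "continuous_on D gu" "continuous_on D gv" "continuous_on D Hu" "continuous_on D Hv"
    using C2_on_continuous_gradient[OF u] C2_on_continuous_gradient[OF v] u v
    unfolding C2_on_def by blast+
  show "continuous_on D (\<lambda>x. u x *\<^sub>R Hv x + v x *\<^sub>R Hu x + outer (gv x) (gu x) + outer (gu x) (gv x))"
    by (intro continuous_intros continuous_on_outer c C2_on_continuous[OF u] C2_on_continuous[OF v])
qed

lemma C2_on_add:
  assumes u: "C2_on u gu Hu D" and v: "C2_on v gv Hv D"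
  shows "C2_on (\<lambda>x. u x + v x) (\<lambda>x. gu x + gv x) (\<lambda>x. Hu x + Hv x) D"
  using assms by (auto simp: C2_on_def inner_add_left matrix_vector_mult_add_rdistrib
      intro!: continuous_intros has_derivative_eq_rhs[OF has_derivative_add])

lemma C2_on_cmult:
  assumes u: "C2_on u gu Hu D"
  shows "C2_on (\<lambda>x. c * u x) (\<lambda>x. c *\<^sub>R gu x) (\<lambda>x. c *\<^sub>R Hu x) D"
  using assms by (auto simp: C2_on_def scaleR_matrix_vector_assoc[symmetric]
      intro!: continuous_intros has_derivative_eq_rhs[OF has_derivative_scaleR_right]
       has_derivative_eq_rhs[OF has_derivative_mult_right])

lemma C2_on_norm_square:
  "C2_on (\<lambda>x. x \<bullet> x) (\<lambda>x. 2 *\<^sub>R x) (\<lambda>x. mat 2) D"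
  unfolding C2_on_def
proof (intro conjI ballI)
  fix x :: "real^'n"
  show "((\<lambda>x. x \<bullet> x) has_derivative (\<lambda>h. (2 *\<^sub>R x) \<bullet> h)) (at x)"
    by (auto intro!: derivative_eq_intros simp: inner_commute)
  have "mat 2 *v h = 2 *\<^sub>R h" for h :: "real^'n"
    by (simp add: vec_eq_iff matrix_vector_mult_def mat_def if_distrib[of "\<lambda>a. a * _"] cong: if_cong)
  then show "((\<lambda>x. 2 *\<^sub>R x) has_derivative (\<lambda>h. mat 2 *v h)) (at x)"
    by (auto intro!: derivative_eq_intros)
qed simp

lemma trace_mat: "trace (mat c :: real^'n^'n) = real CARD('n) * c"
  by (simp add: trace_def mat_def)

text \<open>Along each coordinate axis the one-variable second derivative test applies, so every diagonal
  entry of the Hessian is nonpositive at an interior maximum.\<close>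

lemma trace_nonpos_at_max:
  fixes u :: "real^'n::finite \<Rightarrow> real"
  assumes C2: "C2_on u g H (ball x r)" and r: "r > 0"
    and max: "\<And>y. y \<in> ball x r \<Longrightarrow> u y \<le> u x"
  shows "trace (H x) \<le> 0"
  unfolding trace_def
proof (rule sum_nonpos)
  fix i :: 'n
  define \<phi> where "\<phi> t = u (x + t *\<^sub>R axis i 1)" for t
  define \<psi> where "\<psi> t = g (x + t *\<^sub>R axis i 1) $ i" for t
  have inb: "x + t *\<^sub>R axis i 1 \<in> ball x r" if "\<bar>t\<bar> < r" for t
    using that by (simp add: dist_norm)
  have der: "(\<phi> has_real_derivative \<psi> t) (at t)" if "\<bar>t\<bar> < r" for t
  proof -
    have "(u has_derivative (\<lambda>h. g (x + t *\<^sub>R axis i 1) \<bullet> h)) (at (x + t *\<^sub>R axis i 1))"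
      using C2 inb[OF that] by (auto simp: C2_on_def)
    then have "(\<phi> has_derivative (\<lambda>s. g (x + t *\<^sub>R axis i 1) \<bullet> (s *\<^sub>R axis i 1))) (at t)"
      unfolding \<phi>_def
      by (rule has_derivative_compose[rotated]) (auto intro!: derivative_eq_intros)
    then show ?thesis
      by (rule has_derivative_imp_has_field_derivative) (simp add: inner_axis \<psi>_def)
  qed
  have der2: "(\<psi> has_real_derivative H x $ i $ i) (at 0)"
  proof -
    have "(g has_derivative (\<lambda>h. H x *v h)) (at x)"
      using C2 r by (auto simp: C2_on_def)
    then have "((\<lambda>y. g y $ i) has_derivative (\<lambda>h. (H x *v h) $ i)) (at (x + 0 *\<^sub>R axis i 1))"
      by (auto intro: has_derivative_vec_component)
    then have "(\<psi> has_derivative (\<lambda>s. (H x *v (s *\<^sub>R axis i 1)) $ i)) (at 0)"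
      unfolding \<psi>_def
      by (rule has_derivative_compose[rotated]) (auto intro!: derivative_eq_intros)
    then show ?thesis
      by (rule has_derivative_imp_has_field_derivative)
         (simp add: matrix_vector_mul_component inner_axis)
  qed
  have \<psi>0: "\<psi> 0 = 0"
  proof (rule DERIV_local_max[OF der r])
    show "\<forall>y. \<bar>0 - y\<bar> < r \<longrightarrow> \<phi> y \<le> \<phi> 0" using max inb by (auto simp: \<phi>_def)
  qed (use r in simp)
  show "H x $ i $ i \<le> 0"
  proof (rule ccontr)
    assume "\<not> H x $ i $ i \<le> 0"
    then obtain d where d: "d > 0" "\<And>t. 0 < t \<Longrightarrow> t < d \<Longrightarrow> \<psi> 0 < \<psi> (0 + t)"
      using DERIV_pos_inc_right[OF der2] by fastforce
    define t where "t = min d r / 2"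
    have t: "0 < t" "t < d" "t < r" using d r by (auto simp: t_def min_def)
    obtain s where s: "0 < s" "s < t" "\<phi> t - \<phi> 0 = (t - 0) * \<psi> s"
      using MVT2[of 0 t \<phi> \<psi>] t der by force
    have "\<psi> s > 0" using d(2)[of s] s t \<psi>0 by simp
    then have "\<phi> t > \<phi> 0" using s t by (metis diff_gt_0_iff_gt diff_zero mult_pos_pos)
    moreover have "\<phi> t \<le> \<phi> 0" using max[OF inb[of t]] t by (simp add: \<phi>_def)
    ultimately show False by simp
  qed
qed

text \<open>Adding a small multiple of \<open>\<bar>x\<bar>\<^sup>2\<close> makes the Laplacian strictly positive. The perturbed function then has
  no interior maximum, so its maximum lies on the bounding sphere.\<close>

lemma subharmonic_max_principle:
  fixes u :: "real^'n::finite \<Rightarrow> real"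
  assumes C2: "C2_on u g H D" and D: "cball 0 r \<subseteq> D"
    and sub: "\<And>x. x \<in> ball 0 r \<Longrightarrow> trace (H x) \<ge> 0"
    and bd: "\<And>x. norm x = r \<Longrightarrow> u x \<le> M" and x: "x \<in> cball 0 r"
  shows "u x \<le> M"
proof (rule field_le_epsilon)
  fix e :: real assume e: "e > 0"
  \<comment> \<open>The denominator makes the perturbation at most \<open>e\<close> on the sphere of radius \<open>r\<close>, also when \<open>r = 0\<close>.\<close>
  define \<eta> where "\<eta> = e / (r\<^sup>2 + 1)"
  have \<eta>: "\<eta> > 0" "\<eta> * r\<^sup>2 \<le> e"
    using e by (auto simp: \<eta>_def field_simps add_pos_nonneg)
  define w where "w x = u x + \<eta> * (x \<bullet> x)" for x
  have Cw: "C2_on w (\<lambda>x. g x + \<eta> *\<^sub>R 2 *\<^sub>R x) (\<lambda>x. H x + \<eta> *\<^sub>R mat 2) D"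
    unfolding w_def by (intro C2_on_add C2 C2_on_cmult C2_on_norm_square)
  have "continuous_on (cball 0 r) w"
    using C2_on_continuous[OF Cw] D by (rule continuous_on_subset)
  then obtain y where y: "y \<in> cball 0 r" "\<And>z. z \<in> cball 0 r \<Longrightarrow> w z \<le> w y"
    using continuous_attains_sup[OF compact_cball, of 0 r w] x by blast
  have "norm y = r"
  proof (rule ccontr)
    assume "norm y \<noteq> r"
    then have r': "r - norm y > 0" using y by auto
    have sb: "ball y (r - norm y) \<subseteq> ball 0 r"
      by (subst ball_subset_ball_iff) (auto simp: dist_norm)
    then have "ball y (r - norm y) \<subseteq> cball 0 r" by force
    then have "trace (H y + \<eta> *\<^sub>R mat 2) \<le> 0"
      using r' y D by (intro trace_nonpos_at_max[OF C2_on_subset[OF Cw]]) auto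
    moreover have "trace (H y) \<ge> 0" using sub[of y] r' by simp
    moreover have "\<eta> * (real CARD('n) * 2) > 0" using \<eta> by simp
    ultimately show False by (simp add: trace_add trace_scaleR trace_mat)
  qed
  then have "w y \<le> M + \<eta> * r\<^sup>2" using bd[of y] by (simp add: w_def dot_square_norm)
  moreover have "u x \<le> w x" using \<eta> by (simp add: w_def)
  ultimately show "u x \<le> M + e" using y(2)[OF x] \<eta> by linarith
qed


text \<open>The maximum principle for \<open>u\<close> and \<open>-u\<close>. The centre \<open>a\<close> allows the use with \<open>M = 0\<close> for functions that are
  constant on a sphere.\<close>

lemma harmonic_max_principle:
  fixes u :: "real^'n::finite \<Rightarrow> real"
  assumes u: "harmonic_on u D" and D: "cball 0 r \<subseteq> D"
    and bd: "\<And>x. norm x = r \<Longrightarrow> \<bar>u x - a\<bar> \<le> M" and x: "x \<in> cball 0 r"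
  shows "\<bar>u x - a\<bar> \<le> M"
proof -
  obtain g H where C: "C2_on u g H D" and tr: "\<forall>x\<in>D. trace (H x) = 0" and "open D"
    by (rule harmonic_onE[OF u])
  have sub: "y \<in> ball 0 r \<Longrightarrow> y \<in> D" for y using D by auto
  have 1: "0 \<le> trace (H y)" "0 \<le> trace (-1 *\<^sub>R H y)" if "y \<in> ball 0 r" for y
    unfolding trace_scaleR using bspec[OF tr sub[OF that]] by simp_all
  have 2: "u y \<le> a + M" "-1 * u y \<le> - a + M" if "norm y = r" for y
    using bd[OF that] by (simp_all add: abs_le_iff)
  have "u x \<le> a + M"
    by (rule subharmonic_max_principle[OF C D 1(1) 2(1) x])
  moreover have "-1 * u x \<le> - a + M"
    by (rule subharmonic_max_principle[OF C2_on_cmult[OF C] D 1(2) 2(2) x])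
  ultimately show ?thesis by (simp add: abs_le_iff)
qed

lemma harmonic_on_subset:
  assumes u: "harmonic_on u D" and E: "E \<subseteq> D" "open E"
  shows "harmonic_on u E"
proof -
  obtain g H where C: "C2_on u g H D" and tr: "\<forall>x\<in>D. trace (H x) = 0" and "open D"
    by (rule harmonic_onE[OF u])
  show ?thesis
    by (rule harmonic_onI[OF E(2) C2_on_subset[OF C E(1)] bspec[OF tr subsetD[OF E(1)]]])
qed

lemma harmonic_on_continuous:
  assumes u: "harmonic_on u D"
  shows "continuous_on D u"
proof -
  obtain g H where C: "C2_on u g H D" and "\<forall>x\<in>D. trace (H x) = 0" and "open D"
    by (rule harmonic_onE[OF u])
  show ?thesis by (rule C2_on_continuous[OF C])
qed

lemma harmonic_on_diff:
  assumes u: "harmonic_on u D" and v: "harmonic_on v D"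
  shows "harmonic_on (\<lambda>x. u x - v x) D"
proof -
  obtain gu Hu where Cu: "C2_on u gu Hu D" "\<forall>x\<in>D. trace (Hu x) = 0" "open D"
    by (rule harmonic_onE[OF u])
  obtain gv Hv where Cv: "C2_on v gv Hv D" "\<forall>x\<in>D. trace (Hv x) = 0" "open D"
    by (rule harmonic_onE[OF v])
  have C: "C2_on (\<lambda>x. u x + -1 * v x) (\<lambda>x. gu x + -1 *\<^sub>R gv x) (\<lambda>x. Hu x + -1 *\<^sub>R Hv x) D"
    by (rule C2_on_add[OF Cu(1) C2_on_cmult[OF Cv(1)]])
  have "trace (Hu x + -1 *\<^sub>R Hv x) = 0" if "x \<in> D" for x
    using bspec[OF Cu(2) that] bspec[OF Cv(2) that] by (simp only: trace_add trace_scaleR)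
  from harmonic_onI[OF Cu(3) C this] show ?thesis by simp
qed

lemma harmonic_on_scaleR:
  fixes u :: "real^'n \<Rightarrow> real"
  assumes u: "harmonic_on u (ball 0 1)" and r: "r > 0"
  shows "harmonic_on (\<lambda>x. u (r *\<^sub>R x)) (ball 0 (1 / r))"
proof -
  obtain g H where C: "C2_on u g H (ball 0 1)" and tr: "\<forall>x\<in>ball 0 1. trace (H x) = 0" and "open (ball (0::real^'n) 1)"
    by (rule harmonic_onE[OF u])
  have sub: "r *\<^sub>R x \<in> ball 0 1" if "x \<in> ball 0 (1 / r)" for x :: "real^'n"
    using that r by (simp add: field_simps)
  have d: "((*\<^sub>R) r has_derivative (*\<^sub>R) r) (at x)" for x :: "real^'n"
    by (auto intro!: derivative_eq_intros)
  have "C2_on (\<lambda>x. u (r *\<^sub>R x)) (\<lambda>x. r *\<^sub>R g (r *\<^sub>R x)) (\<lambda>x. (r * r) *\<^sub>R H (r *\<^sub>R x)) (ball 0 (1 / r))"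
    unfolding C2_on_def
  proof (intro conjI ballI)
    fix x :: "real^'n" assume x: "x \<in> ball 0 (1 / r)"
    show "((\<lambda>x. u (r *\<^sub>R x)) has_derivative (\<lambda>h. (r *\<^sub>R g (r *\<^sub>R x)) \<bullet> h)) (at x)"
      using has_derivative_compose[OF d C2_onD(1)[OF C sub[OF x]]] by simp
    show "((\<lambda>x. r *\<^sub>R g (r *\<^sub>R x)) has_derivative (\<lambda>h. ((r * r) *\<^sub>R H (r *\<^sub>R x)) *v h)) (at x)"
      using has_derivative_scaleR_right[OF has_derivative_compose[OF d C2_onD(2)[OF C sub[OF x]]], of r]
      by (simp add: scaleR_matrix_vector_assoc[symmetric] matrix_vector_mult_scaleR)
  next
    have "continuous_on (ball 0 (1 / r)) (\<lambda>x. H (r *\<^sub>R x))"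
      by (rule continuous_on_compose2[OF C2_onD(3)[OF C]]) (use sub in \<open>auto intro!: continuous_intros simp del: mem_ball\<close>)
    then show "continuous_on (ball 0 (1 / r)) (\<lambda>x. (r * r) *\<^sub>R H (r *\<^sub>R x))"
      by (intro continuous_intros)
  qed
  from harmonic_onI[OF open_ball this] show ?thesis
    using bspec[OF tr sub] by (simp add: trace_scaleR del: mem_ball)
qed

section \<open>Powers of the distance\<close>

definition sqdist_powr :: "real \<Rightarrow> real^'n \<Rightarrow> real^'n \<Rightarrow> real" where
  "sqdist_powr m x z = ((x - z) \<bullet> (x - z)) powr m"

definition sqdist_powr_grad :: "real \<Rightarrow> real^'n \<Rightarrow> real^'n \<Rightarrow> real^'n" where
  "sqdist_powr_grad m x z = (2 * m * sqdist_powr (m - 1) x z) *\<^sub>R (x - z)"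

definition sqdist_powr_hess :: "real \<Rightarrow> real^'n \<Rightarrow> real^'n \<Rightarrow> real^'n^'n" where
  "sqdist_powr_hess m x z = (2 * m * sqdist_powr (m - 1) x z) *\<^sub>R mat 1
     + (4 * m * (m - 1) * sqdist_powr (m - 2) x z) *\<^sub>R outer (x - z) (x - z)"

lemma sqdist_powr_nonneg: "0 \<le> sqdist_powr m x z"
  by (simp add: sqdist_powr_def)

lemma sqdist_powr_pos: "x \<noteq> z \<Longrightarrow> 0 < sqdist_powr m x z"
  by (simp add: sqdist_powr_def)

lemma has_derivative_sqdist_powr:
  assumes "x \<noteq> z"
  shows "((\<lambda>x. sqdist_powr m x z) has_derivative (\<lambda>h. sqdist_powr_grad m x z \<bullet> h)) (at x)"
proof -
  have N: "(x - z) \<bullet> (x - z) > 0" using assms by simp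
  have "((\<lambda>x. (x - z) \<bullet> (x - z)) has_derivative (\<lambda>h. 2 * ((x - z) \<bullet> h))) (at x)"
    by (auto intro!: derivative_eq_intros simp: inner_commute)
  moreover have "((\<lambda>s. s powr m) has_derivative (*) (m * ((x - z) \<bullet> (x - z)) powr (m - 1)))
      (at ((x - z) \<bullet> (x - z)))"
    using has_real_derivative_powr[OF N, of m] by (simp add: has_field_derivative_def)
  ultimately have "((\<lambda>x. ((x - z) \<bullet> (x - z)) powr m) has_derivative
      (\<lambda>h. (m * ((x - z) \<bullet> (x - z)) powr (m - 1)) * (2 * ((x - z) \<bullet> h)))) (at x)"
    by (rule has_derivative_compose)
  then show ?thesis
    by (simp add: sqdist_powr_def sqdist_powr_grad_def mult_ac)
qed

lemma C2_on_sqdist_powr: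
  "C2_on (\<lambda>x. sqdist_powr m x z) (\<lambda>x. sqdist_powr_grad m x z) (\<lambda>x. sqdist_powr_hess m x z) (- {z})"
  unfolding C2_on_def
proof (intro conjI ballI)
  fix x assume "x \<in> - {z}"
  then have x: "x \<noteq> z" by simp
  show "((\<lambda>x. sqdist_powr m x z) has_derivative (\<lambda>h. sqdist_powr_grad m x z \<bullet> h)) (at x)"
    by (rule has_derivative_sqdist_powr[OF x])
  have d1: "((\<lambda>x. x - z) has_derivative (\<lambda>h. h)) (at x)"
    by (auto intro!: derivative_eq_intros)
  have d2: "((\<lambda>x. 2 * m * sqdist_powr (m - 1) x z) has_derivative
      (\<lambda>h. 2 * m * (sqdist_powr_grad (m - 1) x z \<bullet> h))) (at x)"
    by (rule has_derivative_mult_right[OF has_derivative_sqdist_powr[OF x]])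
  show "((\<lambda>x. sqdist_powr_grad m x z) has_derivative (\<lambda>h. sqdist_powr_hess m x z *v h)) (at x)"
    unfolding sqdist_powr_grad_def[of m]
    by (rule has_derivative_eq_rhs[OF has_derivative_scaleR[OF d2 d1]])
       (simp add: fun_eq_iff sqdist_powr_hess_def matrix_vector_mult_add_rdistrib
         scaleR_matrix_vector_assoc[symmetric] outer_mult_vec sqdist_powr_grad_def mult_ac)
next
  show "continuous_on (- {z}) (\<lambda>x. sqdist_powr_hess m x z)"
    unfolding sqdist_powr_hess_def sqdist_powr_def
    by (intro continuous_intros continuous_on_outer) auto
qed

text \<open>The Laplacian of \<open>\<bar>x - z\<bar> powr (2 m)\<close>. Its sign is that of \<open>m (2 m + n - 2)\<close>; this sign decides between the two
  cases of the sharp constant.\<close>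

lemma trace_sqdist_powr_hess:
  fixes x z :: "real^'n"
  assumes "x \<noteq> z"
  shows "trace (sqdist_powr_hess m x z) = 2 * m * (2 * m + real CARD('n) - 2) * sqdist_powr (m - 1) x z"
proof -
  have N: "(x - z) \<bullet> (x - z) > 0" using assms by simp
  have "sqdist_powr (m - 2) x z * ((x - z) \<bullet> (x - z)) = sqdist_powr (m - 1) x z"
    using N powr_add[of "(x - z) \<bullet> (x - z)" "m - 2" 1] by (simp add: sqdist_powr_def)
  then have "trace (sqdist_powr_hess m x z) =
      2 * m * sqdist_powr (m - 1) x z * real CARD('n) + 4 * m * (m - 1) * sqdist_powr (m - 1) x z"
    by (simp add: sqdist_powr_hess_def trace_add trace_scaleR trace_mat trace_outer mult.assoc)
  then show ?thesis by (simp add: algebra_simps)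
qed

lemma ball_sphere_ne: "x \<in> ball 0 1 \<Longrightarrow> z \<in> sphere 0 1 \<Longrightarrow> x \<noteq> z"
  by auto

lemma continuous_on_sqdist_powr:
  "continuous_on (ball 0 1 \<times> sphere 0 1) (\<lambda>p. sqdist_powr m (fst p) (snd p))"
  "continuous_on (ball 0 1 \<times> sphere 0 1) (\<lambda>p. sqdist_powr_grad m (fst p) (snd p))"
  "continuous_on (ball 0 1 \<times> sphere 0 1) (\<lambda>p. sqdist_powr_hess m (fst p) (snd p))"
  unfolding sqdist_powr_grad_def sqdist_powr_hess_def sqdist_powr_def
  by (intro continuous_intros continuous_on_outer; auto)+

section \<open>The Poisson kernel and the Poisson integral\<close>

definition poisson_kernel :: "real^'n \<Rightarrow> real^'n \<Rightarrow> real" where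
  "poisson_kernel x z = (1 - x \<bullet> x) * sqdist_powr (- (real CARD('n) / 2)) x z"

lemma C2_on_one_minus_norm_square:
  "C2_on (\<lambda>x. 1 - x \<bullet> x) (\<lambda>x. (-2) *\<^sub>R x) (\<lambda>x. (-2) *\<^sub>R mat 1) D"
  unfolding C2_on_def
proof (intro conjI ballI)
  fix x :: "real^'n"
  show "((\<lambda>x. 1 - x \<bullet> x) has_derivative (\<lambda>h. ((-2) *\<^sub>R x) \<bullet> h)) (at x)"
    by (auto intro!: derivative_eq_intros simp: inner_commute)
  show "((\<lambda>x. (-2) *\<^sub>R x) has_derivative (\<lambda>h. ((-2) *\<^sub>R mat 1) *v h)) (at x)"
    by (auto intro!: derivative_eq_intros simp: fun_eq_iff scaleR_matrix_vector_assoc[symmetric]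
        simp del: scaleR_minus_left)
qed simp

lemma norm_less_one_inner: "x \<in> ball 0 1 \<Longrightarrow> x \<bullet> x < (1::real)"
  using power_strict_mono[of "norm x" 1 2] by (simp add: dot_square_norm)

lemma poisson_kernel_nonneg: "x \<in> ball 0 1 \<Longrightarrow> 0 \<le> poisson_kernel x z"
  using norm_less_one_inner[of x] by (auto simp: poisson_kernel_def intro!: mult_nonneg_nonneg sqdist_powr_nonneg)

lemma poisson_kernel_pos: "x \<in> ball 0 1 \<Longrightarrow> z \<in> sphere 0 1 \<Longrightarrow> 0 < poisson_kernel x z"
  using norm_less_one_inner[of x] ball_sphere_ne[of x z]
  by (auto simp: poisson_kernel_def intro!: mult_pos_pos sqdist_powr_pos)

lemma continuous_on_poisson_kernel:
  "continuous_on (ball 0 1 \<times> sphere 0 1) (\<lambda>p. poisson_kernel (fst p) (snd p))"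
  unfolding poisson_kernel_def
  by (intro continuous_intros continuous_on_sqdist_powr)

lemma continuous_on_poisson_kernel_sphere:
  "x \<in> ball 0 1 \<Longrightarrow> continuous_on (sphere 0 1) (poisson_kernel x)"
  by (rule continuous_on_slice[OF continuous_on_poisson_kernel])

definition poisson_grad :: "real^'n \<Rightarrow> real^'n \<Rightarrow> real^'n" where
  "poisson_grad x z = (let m = - (real CARD('n) / 2) in
     (1 - x \<bullet> x) *\<^sub>R sqdist_powr_grad m x z + sqdist_powr m x z *\<^sub>R (-2) *\<^sub>R x)"

definition poisson_hess :: "real^'n \<Rightarrow> real^'n \<Rightarrow> real^'n^'n" where
  "poisson_hess x z = (let m = - (real CARD('n) / 2) in
     (1 - x \<bullet> x) *\<^sub>R sqdist_powr_hess m x z + sqdist_powr m x z *\<^sub>R (-2) *\<^sub>R mat 1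
     + outer (sqdist_powr_grad m x z) ((-2) *\<^sub>R x) + outer ((-2) *\<^sub>R x) (sqdist_powr_grad m x z))"

lemma C2_on_poisson_kernel:
  assumes z: "z \<in> sphere 0 1"
  shows "C2_on (\<lambda>x. poisson_kernel x z) (\<lambda>x. poisson_grad x z) (\<lambda>x. poisson_hess x z) (ball 0 1)"
proof -
  have "ball 0 1 \<subseteq> - {z}" using z by auto
  then show ?thesis
    unfolding poisson_kernel_def poisson_grad_def poisson_hess_def Let_def
    by (intro C2_on_mult C2_on_one_minus_norm_square C2_on_subset[OF C2_on_sqdist_powr])
qed

text \<open>After the common power of \<open>\<bar>x - z\<bar>\<close> is taken out, the terms of the product rule add up to a multiple of
  \<open>1 - z \<bullet> z\<close>, which vanishes on the unit sphere.\<close>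

lemma trace_poisson_hess:
  fixes x z :: "real^'n"
  assumes x: "x \<in> ball 0 1" and z: "z \<in> sphere 0 1"
  shows "trace (poisson_hess x z) = 0"
proof -
  define n where "n = real CARD('n)"
  define m where "m = - (n / 2)"
  let ?y = "x - z"
  have ne: "x \<noteq> z" by (rule ball_sphere_ne[OF x z])
  then have "sqdist_powr m x z = sqdist_powr (m - 1) x z * (?y \<bullet> ?y)"
    using powr_add[of "?y \<bullet> ?y" "m - 1" 1] by (simp add: sqdist_powr_def)
  then have sq: "sqdist_powr m x z = sqdist_powr (m - 1) x z * (?y \<bullet> ?y)" .
  have "trace (poisson_hess x z) = (1 - x \<bullet> x) * trace (sqdist_powr_hess m x z)
      - 2 * n * sqdist_powr m x z - 4 * (sqdist_powr_grad m x z \<bullet> x)"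
    by (simp add: poisson_hess_def Let_def trace_add trace_sub trace_scaleR trace_mat trace_outer
        n_def[symmetric] m_def[symmetric] inner_commute)
  also have "\<dots> = sqdist_powr (m - 1) x z *
      ((1 - x \<bullet> x) * (2 * m * (2 * m + n - 2)) - 2 * n * (?y \<bullet> ?y) - 8 * m * (?y \<bullet> x))"
    unfolding trace_sqdist_powr_hess[OF ne] n_def[symmetric] sq sqdist_powr_grad_def[of m]
    by (simp only: inner_scaleR_left) (simp add: algebra_simps del: inner_diff_left inner_diff_right)
  also have "(1 - x \<bullet> x) * (2 * m * (2 * m + n - 2)) - 2 * n * (?y \<bullet> ?y) - 8 * m * (?y \<bullet> x) =
      2 * n * (1 - z \<bullet> z)"
    by (simp add: m_def inner_diff_left inner_diff_right inner_commute algebra_simps)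
  also have "z \<bullet> z = 1" using z by (simp add: dot_square_norm)
  finally show ?thesis by simp
qed

lemma continuous_on_poisson_hess:
  "continuous_on (ball 0 1 \<times> sphere 0 1) (\<lambda>p. poisson_grad (fst p) (snd p))"
  "continuous_on (ball 0 1 \<times> sphere 0 1) (\<lambda>p. poisson_hess (fst p) (snd p))"
  unfolding poisson_grad_def poisson_hess_def Let_def
  by (intro continuous_intros continuous_on_outer continuous_on_sqdist_powr)+

definition poisson_integral :: "(real^'n \<Rightarrow> real) \<Rightarrow> real^'n \<Rightarrow> real" where
  "poisson_integral f x = (\<integral>z. poisson_kernel x z * f z \<partial>sphere_measure)"

lemma harmonic_poisson_integral:
  fixes f :: "real^'n::finite \<Rightarrow> real"
  assumes n: "2 \<le> CARD('n)" and f: "continuous_on (sphere 0 1) f"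
  shows "harmonic_on (poisson_integral f) (ball 0 1)"
proof -
  have f': "continuous_on (ball 0 1 \<times> sphere 0 1) (\<lambda>p::(real^'n) \<times> (real^'n). f (snd p))"
    by (rule continuous_on_compose2[OF f]) (auto intro!: continuous_intros)
  have C: "C2_on (\<lambda>x. \<integral>z. f z * poisson_kernel x z \<partial>sphere_measure)
      (\<lambda>x. \<integral>z. f z *\<^sub>R poisson_grad x z \<partial>sphere_measure)
      (\<lambda>x. \<integral>z. f z *\<^sub>R poisson_hess x z \<partial>sphere_measure) (ball 0 1)"
    by (intro C2_on_integral_sphere n C2_on_cmult C2_on_poisson_kernel continuous_intros f'
        continuous_on_poisson_kernel continuous_on_poisson_hess) auto
  have "trace (\<integral>z. f z *\<^sub>R poisson_hess x z \<partial>sphere_measure) = 0" if x: "x \<in> ball 0 1" for x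
  proof -
    have "continuous_on (sphere 0 1) (\<lambda>z. f z *\<^sub>R poisson_hess x z)"
      by (intro continuous_intros f continuous_on_slice[OF continuous_on_poisson_hess(2) x])
    then have "trace (\<integral>z. f z *\<^sub>R poisson_hess x z \<partial>sphere_measure)
        = (\<integral>z. trace (f z *\<^sub>R poisson_hess x z) \<partial>sphere_measure)"
      by (rule trace_integral_sphere[OF n])
    also have "\<dots> = (\<integral>z. 0 \<partial>(sphere_measure :: (real^'n) measure))"
      by (intro integral_sphere_cong n) (simp add: trace_scaleR trace_poisson_hess[OF x])
    finally show ?thesis by simp
  qed
  moreover have "poisson_integral f = (\<lambda>x. \<integral>z. f z * poisson_kernel x z \<partial>sphere_measure)"
    by (simp add: poisson_integral_def fun_eq_iff mult.commute)
  ultimately show ?thesis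
    using harmonic_onI[OF open_ball C] by simp
qed

lemma sqdist_expand: "(x - z) \<bullet> (x - z) = x \<bullet> x + z \<bullet> z - 2 * (x \<bullet> z)"
  by (simp add: inner_diff_left inner_diff_right inner_commute)

lemma integral_sqdist_powr_radial:
  fixes x y :: "real^'n::finite"
  assumes n: "2 \<le> CARD('n)" and xy: "norm x = norm y" and x: "x \<in> ball 0 1"
  shows "(\<integral>z. sqdist_powr m x z \<partial>sphere_measure) = (\<integral>z. sqdist_powr m y z \<partial>sphere_measure)"
proof -
  have eq: "sqdist_powr m w z = (x \<bullet> x + 1 - 2 * (w \<bullet> z)) powr m"
    if "norm w = norm x" "z \<in> sphere 0 1" for w z :: "real^'n"
    using that by (simp only: sqdist_powr_def sqdist_expand) (simp add: dot_square_norm)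
  have pos: "x \<bullet> x + 1 - 2 * t > 0" if "t \<in> {- norm x..norm x}" for t
  proof -
    have "(1 - norm x)\<^sup>2 > 0" using x by simp
    then show ?thesis using that unfolding dot_square_norm by (simp add: power2_diff)
  qed
  have "continuous_on {- norm x..norm x} (\<lambda>t. (x \<bullet> x + 1 - 2 * t) powr m)"
    using pos by (intro continuous_intros) force
  note * = integral_sphere_zonal_norm_eq[OF n xy this]
  have "(\<integral>z. sqdist_powr m x z \<partial>sphere_measure) = (\<integral>z. (x \<bullet> x + 1 - 2 * (x \<bullet> z)) powr m \<partial>sphere_measure)"
    by (intro integral_sphere_cong n eq) auto
  also note *
  also have "(\<integral>z. (x \<bullet> x + 1 - 2 * (y \<bullet> z)) powr m \<partial>sphere_measure) = (\<integral>z. sqdist_powr m y z \<partial>sphere_measure)"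
    by (intro integral_sphere_cong n eq[symmetric]) (auto simp: xy)
  finally show ?thesis .
qed

lemma sqdist_powr_zero: "z \<in> sphere 0 1 \<Longrightarrow> sqdist_powr m 0 z = 1"
  by (simp add: sqdist_powr_def dot_square_norm)

text \<open>The total mass of the kernel is a radial harmonic function of \<open>x\<close>. Being constant on the sphere
  through \<open>x\<close>, by the maximum principle it has there the same value as at the centre.\<close>

lemma integral_poisson_kernel:
  fixes x :: "real^'n::finite"
  assumes n: "2 \<le> CARD('n)" and x: "x \<in> ball 0 1"
  shows "(\<integral>z. poisson_kernel x z \<partial>sphere_measure) = 1"
proof -
  define \<phi> where "\<phi> = poisson_integral (\<lambda>_::real^'n. 1)"
  have \<phi>: "\<phi> y = (1 - y \<bullet> y) * (\<integral>z. sqdist_powr (- (real CARD('n) / 2)) y z \<partial>sphere_measure)" for y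
    by (simp add: \<phi>_def poisson_integral_def poisson_kernel_def)
  have h: "harmonic_on \<phi> (ball 0 1)"
    unfolding \<phi>_def by (intro harmonic_poisson_integral n continuous_intros)
  have "\<bar>\<phi> 0 - \<phi> x\<bar> \<le> 0"
  proof (rule harmonic_max_principle[OF h])
    show "cball 0 (norm x) \<subseteq> ball 0 1" using x by auto
    show "\<bar>\<phi> y - \<phi> x\<bar> \<le> 0" if "norm y = norm x" for y
      using that x integral_sqdist_powr_radial[OF n that]
      by (simp add: \<phi> dot_square_norm)
  qed auto
  moreover have "\<phi> 0 = 1"
    using integral_sphere_cong[OF n sqdist_powr_zero[where m = "- (real CARD('n) / 2)"]]
    by (simp only: \<phi> integral_sphere_const[OF n]) simp
  ultimately show ?thesis by (simp add: \<phi>_def poisson_integral_def)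
qed

text \<open>The kernel is an approximate identity, uniformly at the boundary: the sphere points near \<open>x\<close> are
  controlled by the uniform continuity of \<open>v\<close>, and for the others the factor \<open>1 - \<bar>x\<bar>\<^sup>2\<close> makes the kernel small.
  Comparing with \<open>v x\<close> at the interior point keeps the statement inside the ball.\<close>

lemma poisson_integral_boundary:
  fixes v :: "real^'n::finite \<Rightarrow> real"
  assumes n: "2 \<le> CARD('n)" and v: "continuous_on (cball 0 1) v" and e: "e > 0"
  obtains r where "r < 1" "\<And>x. r \<le> norm x \<Longrightarrow> norm x < 1 \<Longrightarrow> \<bar>poisson_integral v x - v x\<bar> \<le> e"
proof -
  have "uniformly_continuous_on (cball 0 1) v"
    by (rule compact_uniformly_continuous[OF v]) simp
  then obtain d where d: "d > 0"
    "\<And>x y. x \<in> cball 0 1 \<Longrightarrow> y \<in> cball 0 1 \<Longrightarrow> dist y x < d \<Longrightarrow> \<bar>v y - v x\<bar> < e/2"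
    using e unfolding uniformly_continuous_on_def dist_real_def by (metis half_gt_zero)
  have "bounded (v ` cball 0 1)"
    by (intro compact_imp_bounded compact_continuous_image v) auto
  then obtain M where M: "\<And>x. x \<in> cball 0 1 \<Longrightarrow> \<bar>v x\<bar> \<le> M"
    unfolding bounded_iff by fastforce
  have M0: "M \<ge> 0" using M[of 0] by simp
  \<comment> \<open>\<open>A (1 - \<bar>x\<bar>\<^sup>2)\<close> bounds the contribution of the points at distance at least \<open>d\<close>.\<close>
  define A where "A = 2 * M * (d\<^sup>2) powr (- (real CARD('n) / 2))"
  have A: "A \<ge> 0" using M0 by (simp add: A_def)
  define \<eta> where "\<eta> = e / (2 * (A + 1))"
  have \<eta>: "\<eta> > 0" "A * \<eta> \<le> e/2" using e A by (auto simp: \<eta>_def field_simps)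
  have vs: "continuous_on (sphere 0 1) v" by (rule continuous_on_subset[OF v]) auto
  have "\<bar>poisson_integral v x - v x\<bar> \<le> e" if xr: "1 - \<eta>/2 \<le> norm x" and x1: "norm x < 1" for x
  proof -
    have x: "x \<in> ball 0 1" using x1 by simp
    note [continuous_intros] = continuous_on_poisson_kernel_sphere[OF x]
    have "1 - x \<bullet> x = (1 - norm x) * (1 + norm x)"
      by (simp add: dot_square_norm algebra_simps power2_eq_square)
    also have "\<dots> \<le> (\<eta>/2) * 2" using xr x1 \<eta> by (intro mult_mono) auto
    finally have x\<eta>: "1 - x \<bullet> x \<le> \<eta>" by simp
    have xx: "0 \<le> 1 - x \<bullet> x" using norm_less_one_inner[OF x] by simp
    have bound: "norm (poisson_kernel x z * (v z - v x)) \<le> poisson_kernel x z * (e/2) + e/2"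
      if z: "z \<in> sphere 0 1" for z
    proof (cases "dist z x < d")
      case True
      then have "\<bar>v z - v x\<bar> \<le> e/2" using d(2)[of x z] x1 z by simp
      then have "norm (poisson_kernel x z * (v z - v x)) \<le> poisson_kernel x z * (e/2)"
        unfolding real_norm_def abs_mult abs_of_nonneg[OF poisson_kernel_nonneg[OF x]]
        by (intro mult_left_mono poisson_kernel_nonneg[OF x])
      then show ?thesis using e by simp
    next
      case False
      have "d\<^sup>2 \<le> (x - z) \<bullet> (x - z)"
        using False d(1) unfolding dot_square_norm by (intro power_mono) (auto simp: dist_norm norm_minus_commute)
      then have "sqdist_powr (- (real CARD('n) / 2)) x z \<le> (d\<^sup>2) powr (- (real CARD('n) / 2))"
        using d(1) unfolding sqdist_powr_def by (intro powr_mono2') auto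
      then have "poisson_kernel x z \<le> \<eta> * (d\<^sup>2) powr (- (real CARD('n) / 2))"
        using xx x\<eta> \<eta> unfolding poisson_kernel_def by (intro mult_mono sqdist_powr_nonneg) auto
      moreover have "\<bar>v z - v x\<bar> \<le> 2 * M" using M[of z] M[of x] z x1 by simp
      ultimately have "norm (poisson_kernel x z * (v z - v x)) \<le> \<eta> * (d\<^sup>2) powr (- (real CARD('n) / 2)) * (2 * M)"
        using \<eta> unfolding real_norm_def abs_mult abs_of_nonneg[OF poisson_kernel_nonneg[OF x]]
        by (intro mult_mono) auto
      also have "\<dots> = A * \<eta>" by (simp add: A_def)
      also have "\<dots> \<le> poisson_kernel x z * (e/2) + e/2"
        using \<eta> mult_nonneg_nonneg[OF poisson_kernel_nonneg[OF x, of z], of "e/2"] e by simp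
      finally show ?thesis .
    qed
    have "poisson_integral v x - v x = (\<integral>z. poisson_kernel x z * v z \<partial>sphere_measure)
        - (\<integral>z. poisson_kernel x z * v x \<partial>sphere_measure)"
      using integral_poisson_kernel[OF n x] by (simp add: poisson_integral_def)
    also have "\<dots> = (\<integral>z. poisson_kernel x z * (v z - v x) \<partial>sphere_measure)"
      by (subst Bochner_Integration.integral_diff[symmetric])
         (auto intro!: integrable_sphere_continuous n continuous_intros vs simp: right_diff_distrib)
    finally have "\<bar>poisson_integral v x - v x\<bar> \<le> (\<integral>z. norm (poisson_kernel x z * (v z - v x)) \<partial>sphere_measure)"
      using integral_norm_bound[of sphere_measure "\<lambda>z. poisson_kernel x z * (v z - v x)"] by simp
    also have "\<dots> \<le> (\<integral>z. poisson_kernel x z * (e/2) + e/2 \<partial>sphere_measure)"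
      by (intro integral_sphere_mono n continuous_intros vs bound)
    also have "\<dots> = (\<integral>z. poisson_kernel x z * (e/2) \<partial>sphere_measure) + (\<integral>z. e/2 \<partial>(sphere_measure :: (real^'n) measure))"
      by (intro Bochner_Integration.integral_add integrable_sphere_continuous n continuous_intros)
    also have "\<dots> = e"
      using integral_poisson_kernel[OF n x] integral_sphere_const[OF n, of "e/2"] e by simp
    finally show ?thesis .
  qed
  then show ?thesis using \<eta> by (intro that[of "1 - \<eta>/2"]) auto
qed

text \<open>Both sides are harmonic in the ball and their difference is uniformly small near the boundary,
  hence small everywhere by the maximum principle.\<close>

lemma poisson_representation:
  fixes v :: "real^'n::finite \<Rightarrow> real"
  assumes n: "2 \<le> CARD('n)" and v: "harmonic_on v D" "cball 0 1 \<subseteq> D" and x: "x \<in> ball 0 1"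
  shows "v x = poisson_integral v x"
proof -
  have cv: "continuous_on (cball 0 1) v"
    by (rule continuous_on_subset[OF harmonic_on_continuous[OF v(1)] v(2)])
  then have cs: "continuous_on (sphere 0 1) v" by (rule continuous_on_subset) auto
  have vb: "harmonic_on v (ball 0 1)"
    using v(1) by (rule harmonic_on_subset) (use v(2) ball_subset_cball[of 0 "1::real"] in auto)
  have h: "harmonic_on (\<lambda>x. poisson_integral v x - v x) (ball 0 1)"
    by (intro harmonic_on_diff harmonic_poisson_integral n cs vb)
  have "\<bar>poisson_integral v x - v x\<bar> \<le> 0 + e" if e: "e > 0" for e
  proof -
    obtain r where r: "r < 1" "\<And>x. r \<le> norm x \<Longrightarrow> norm x < 1 \<Longrightarrow> \<bar>poisson_integral v x - v x\<bar> \<le> e"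
      using poisson_integral_boundary[OF n cv e] by blast
    have "\<bar>poisson_integral v x - v x - 0\<bar> \<le> e"
      by (rule harmonic_max_principle[OF h, where r = "max r (norm x)"])
         (use r x in \<open>auto intro!: r(2)\<close>)
    then show ?thesis by simp
  qed
  then have "\<bar>poisson_integral v x - v x\<bar> \<le> 0" by (rule field_le_epsilon)
  then show ?thesis by simp
qed


section \<open>The distribution of a coordinate on the sphere\<close>

text \<open>The rotation in the plane of coordinates \<open>i\<close> and \<open>j\<close>, written as a perturbation of \<open>x\<close> so that
  linearity and preservation of the norm are computations with two axis vectors.\<close>

definition plane_rotation :: "'n \<Rightarrow> 'n \<Rightarrow> real \<Rightarrow> real^'n \<Rightarrow> real^'n" where
  "plane_rotation i j t x = x
     + (cos t * x $ i - sin t * x $ j - x $ i) *\<^sub>R axis i 1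
     + (sin t * x $ i + cos t * x $ j - x $ j) *\<^sub>R axis j 1"

lemma plane_rotation_nth:
  assumes "i \<noteq> j"
  shows "plane_rotation i j t x $ i = cos t * x $ i - sin t * x $ j"
    and "plane_rotation i j t x $ j = sin t * x $ i + cos t * x $ j"
  using assms by (simp_all add: plane_rotation_def axis_def)

lemma orthogonal_plane_rotation:
  fixes i j :: "'n::finite"
  assumes "i \<noteq> j"
  shows "orthogonal_transformation (plane_rotation i j t)"
  unfolding orthogonal_transformation
proof (intro conjI allI)
  show "linear (plane_rotation i j t)"
    by (rule linearI) (simp_all add: plane_rotation_def algebra_simps)
  fix x :: "real^'n"
  define a where "a = cos t * x $ i - sin t * x $ j - x $ i"
  define b where "b = sin t * x $ i + cos t * x $ j - x $ j"
  have ij: "axis i (1::real) $ j = 0" "axis j (1::real) $ i = 0"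
    using assms by (simp_all add: axis_def)
  have "plane_rotation i j t x \<bullet> plane_rotation i j t x
      = x \<bullet> x + 2 * a * x $ i + 2 * b * x $ j + a * a + b * b"
    unfolding plane_rotation_def a_def[symmetric] b_def[symmetric]
    by (simp add: inner_add_left inner_add_right inner_axis inner_axis' ij algebra_simps)
  also have "\<dots> = x \<bullet> x"
  proof -
    have "2 * (c * p - s * q - p) * p + 2 * (s * p + c * q - q) * q + (c * p - s * q - p) * (c * p - s * q - p)
        + (s * p + c * q - q) * (s * p + c * q - q) = (c\<^sup>2 + s\<^sup>2 - 1) * (p\<^sup>2 + q\<^sup>2)" for c s p q :: real
      by (simp add: algebra_simps power2_eq_square)
    from this[of "cos t" "x $ i" "sin t" "x $ j"] show ?thesis
      by (simp add: a_def b_def)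
  qed
  finally show "norm (plane_rotation i j t x) = norm x" by (simp add: norm_eq_sqrt_inner)
qed

lemma plane_rotation_add:
  assumes "i \<noteq> j"
  shows "plane_rotation i j (s + t) = plane_rotation i j s \<circ> plane_rotation i j t"
proof
  fix x
  show "plane_rotation i j (s + t) x = (plane_rotation i j s \<circ> plane_rotation i j t) x"
    using assms by (simp add: vec_eq_iff plane_rotation_def axis_def sin_add cos_add algebra_simps)
qed

text \<open>A rotation by \<open>t\<close> is the square of the rotation by \<open>t/2\<close>, so its determinant is the square of \<open>1\<close>
  or \<open>-1\<close>. This spares the expansion of a determinant of arbitrary size.\<close>

lemma rotation_matrix_plane_rotation:
  assumes ij: "i \<noteq> j"
  shows "rotation_matrix (matrix (plane_rotation i j t))"
proof -
  let ?R = "plane_rotation i j"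
  have lin: "linear (?R s)" for s
    using orthogonal_plane_rotation[OF ij] by (simp add: orthogonal_transformation)
  have "matrix (?R t) = matrix (?R (t/2)) ** matrix (?R (t/2))"
    using matrix_compose[OF lin lin] plane_rotation_add[OF ij, of "t/2" "t/2"] by simp
  then have "det (matrix (?R t)) = det (matrix (?R (t/2))) * det (matrix (?R (t/2)))"
    by (simp add: det_mul)
  moreover have "orthogonal_matrix (matrix (?R s))" for s
    using orthogonal_plane_rotation[OF ij, of s] orthogonal_transformation_matrix by blast
  ultimately show ?thesis
    using det_orthogonal_matrix[of "matrix (?R (t/2))"] by (auto simp: rotation_matrix_def)
qed

text \<open>The mean of \<open>g (z $ i) \<cdot> z $ j\<close> over the sphere does not change when \<open>z\<close> is rotated in the plane of \<open>i\<close> and \<open>j\<close>;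
  the claim is that its derivative at angle \<open>0\<close> vanishes.\<close>

lemma integral_sphere_plane_rotation:
  fixes g g' :: "real \<Rightarrow> real" and i j :: "'n::finite"
  assumes n: "2 \<le> CARD('n)" and ij: "i \<noteq> j"
    and g: "\<And>t. (g has_real_derivative g' t) (at t)" and g': "continuous_on UNIV g'"
  shows "(\<integral>z. g (z $ i) * z $ i - g' (z $ i) * (z $ j)\<^sup>2 \<partial>(sphere_measure :: (real^'n) measure)) = 0"
proof -
  define A where "A t z = cos t * z $ i - sin t * z $ j" for t and z :: "real^'n"
  define B where "B t z = sin t * z $ i + cos t * z $ j" for t and z :: "real^'n"
  define K where "K t z = g (A t z) * B t z" for t and z :: "real^'n"
  define K' where "K' t z = g (A t z) * A t z - g' (A t z) * (B t z)\<^sup>2" for t and z :: "real^'n"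
  have gc: "continuous_on UNIV g"
    using g by (auto intro!: continuous_at_imp_continuous_on DERIV_isCont)
  have Ac: "continuous_on (UNIV \<times> sphere 0 1) (\<lambda>p. A (fst p) (snd p))"
    and Bc: "continuous_on (UNIV \<times> sphere 0 1) (\<lambda>p. B (fst p) (snd p))"
    unfolding A_def B_def by (intro continuous_intros)+
  have gAc: "continuous_on (UNIV \<times> sphere 0 1) (\<lambda>p. g (A (fst p) (snd p)))"
    and g'Ac: "continuous_on (UNIV \<times> sphere 0 1) (\<lambda>p. g' (A (fst p) (snd p)))"
    by (rule continuous_on_compose2[OF gc Ac] continuous_on_compose2[OF g' Ac]; simp)+
  have Kc: "continuous_on (sphere 0 1) (K t)" for t
    by (rule continuous_on_slice[where D = UNIV])
       (auto simp: K_def intro!: continuous_intros gAc Bc)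
  have K'c: "continuous_on (UNIV \<times> sphere 0 1) (\<lambda>p. K' (fst p) (snd p))"
    unfolding K'_def by (intro continuous_intros gAc g'Ac Ac Bc)
  have der: "((\<lambda>t. K t z) has_derivative (\<lambda>h. K' t z \<bullet> h)) (at t)" for t z
  proof -
    have "((\<lambda>t. A t z) has_real_derivative - B t z) (at t)"
      "((\<lambda>t. B t z) has_real_derivative A t z) (at t)"
      unfolding A_def B_def by (auto intro!: derivative_eq_intros)
    then have "((\<lambda>t. K t z) has_real_derivative K' t z) (at t)"
      unfolding K_def K'_def
      by (auto intro!: derivative_eq_intros DERIV_chain2[OF g] simp: power2_eq_square)
    then show ?thesis by (simp add: has_field_derivative_def inner_real_def)
  qed
  have "((\<lambda>t. \<integral>z. K t z \<partial>sphere_measure) has_derivative (\<lambda>h. (\<integral>z. K' 0 z \<partial>sphere_measure) \<bullet> h)) (at 0)"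
    by (rule has_derivative_integral_sphere[OF n open_UNIV UNIV_I Kc K'c der])
  then have "((\<lambda>t. \<integral>z. K t z \<partial>sphere_measure) has_real_derivative (\<integral>z. K' 0 z \<partial>sphere_measure)) (at 0)"
    by (simp add: has_field_derivative_def inner_real_def)
  moreover have "(\<integral>z. K t z \<partial>sphere_measure) = (\<integral>z. K 0 z \<partial>sphere_measure)" for t
  proof -
    have "K t z = K 0 (matrix (plane_rotation i j t) *v z)" for z
    proof -
      have "matrix (plane_rotation i j t) *v z = plane_rotation i j t z"
        using orthogonal_plane_rotation[OF ij, of t]
        by (simp add: orthogonal_transformation matrix_works linear_matrix_vector_mul_eq)
      then show ?thesis by (simp add: K_def A_def B_def plane_rotation_nth[OF ij])
    qed
    then show ?thesis
      using integral_sphere_rotation[OF n rotation_matrix_plane_rotation[OF ij, of t] Kc[of 0]] by simp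
  qed
  then have "(\<lambda>t. \<integral>z. K t z \<partial>sphere_measure) = (\<lambda>t. \<integral>z. K 0 z \<partial>sphere_measure)" by (rule ext)
  ultimately have "(\<integral>z. K' 0 z \<partial>sphere_measure) = 0"
    using DERIV_unique[OF _ DERIV_const] by metis
  then show ?thesis by (simp add: K'_def A_def B_def)
qed

text \<open>Summing the infinitesimal invariance over all \<open>j\<close> other than \<open>i\<close> eliminates the other coordinates, since
  their squares add up to \<open>1 - (z $ i)\<^sup>2\<close>. The result is integration by parts against the density
  \<open>(1 - t\<^sup>2) powr ((n - 3) / 2)\<close> of a coordinate, obtained without knowing that density.\<close>

lemma integral_sphere_coordinate_by_parts:
  fixes g g' :: "real \<Rightarrow> real" and i :: "'n::finite"
  assumes n: "2 \<le> CARD('n)"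
    and g: "\<And>t. (g has_real_derivative g' t) (at t)" and g': "continuous_on UNIV g'"
  shows "(real CARD('n) - 1) * (\<integral>z. g (z $ i) * z $ i \<partial>(sphere_measure :: (real^'n) measure))
    = (\<integral>z. g' (z $ i) * (1 - (z $ i)\<^sup>2) \<partial>sphere_measure)"
proof -
  let ?S = "sphere_measure :: (real^'n) measure"
  have gc: "continuous_on UNIV g"
    using g by (auto intro!: continuous_at_imp_continuous_on DERIV_isCont)
  have c: "continuous_on (sphere 0 1) (\<lambda>z::real^'n. g (z $ i))"
    "continuous_on (sphere 0 1) (\<lambda>z::real^'n. g' (z $ i))"
    by (rule continuous_on_compose2[OF gc] continuous_on_compose2[OF g']; auto intro!: continuous_intros)+
  have I: "integrable ?S (\<lambda>z. g (z $ i) * z $ i - g' (z $ i) * (z $ j)\<^sup>2)" for j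
    by (intro integrable_sphere_continuous n continuous_intros c)
  have sq: "(\<Sum>j\<in>UNIV - {i}. (z $ j)\<^sup>2) = 1 - (z $ i)\<^sup>2" if "z \<in> sphere 0 1" for z :: "real^'n"
  proof -
    have "(\<Sum>j\<in>UNIV. (z $ j)\<^sup>2) = z \<bullet> z" by (simp add: inner_vec_def power2_eq_square)
    also have "\<dots> = 1" using that by (simp add: dot_square_norm)
    finally show ?thesis using sum.remove[of UNIV i "\<lambda>j. (z $ j)\<^sup>2"] by simp
  qed
  have "0 = (\<Sum>j\<in>UNIV - {i}. \<integral>z. g (z $ i) * z $ i - g' (z $ i) * (z $ j)\<^sup>2 \<partial>?S)"
    using integral_sphere_plane_rotation[OF n _ g g'] by (intro sum.neutral[symmetric]) auto
  also have "\<dots> = (\<integral>z. (\<Sum>j\<in>UNIV - {i}. g (z $ i) * z $ i - g' (z $ i) * (z $ j)\<^sup>2) \<partial>?S)"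
    using I by (simp add: Bochner_Integration.integral_sum)
  also have "\<dots> = (\<integral>z. (real CARD('n) - 1) * (g (z $ i) * z $ i) - g' (z $ i) * (1 - (z $ i)\<^sup>2) \<partial>?S)"
  proof (rule integral_sphere_cong[OF n])
    fix z :: "real^'n" assume "z \<in> sphere 0 1"
    then show "(\<Sum>j\<in>UNIV - {i}. g (z $ i) * z $ i - g' (z $ i) * (z $ j)\<^sup>2)
       = (real CARD('n) - 1) * (g (z $ i) * z $ i) - g' (z $ i) * (1 - (z $ i)\<^sup>2)"
      using n by (simp add: sum_subtractf sum_distrib_left[symmetric] sq of_nat_diff)
  qed
  also have "\<dots> = (real CARD('n) - 1) * (\<integral>z. g (z $ i) * z $ i \<partial>?S)
      - (\<integral>z. g' (z $ i) * (1 - (z $ i)\<^sup>2) \<partial>?S)"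
    by (subst Bochner_Integration.integral_diff)
       (auto intro!: integrable_sphere_continuous n continuous_intros c)
  finally show ?thesis by simp
qed

text \<open>With \<open>g t = ((1 - t) / 2) ^ k\<close> the integration by parts becomes the recursion \<open>(2 \<alpha> + k) M (k + 1) = (\<alpha> + k) M k\<close>,
  which is also the recursion of \<open>Beta (\<alpha> + k) \<alpha>\<close>.\<close>

lemma sphere_moment:
  fixes i :: "'n::finite"
  assumes n: "2 \<le> CARD('n)"
  defines "\<alpha> \<equiv> (real CARD('n) - 1) / 2"
  shows "Beta \<alpha> \<alpha> * (\<integral>z. ((1 - z $ i) / 2) ^ k \<partial>(sphere_measure :: (real^'n) measure)) = Beta (\<alpha> + real k) \<alpha>"
proof (induction k)
  case 0
  show ?case using integral_sphere_const[OF n, of "1::real"] by simp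
next
  case (Suc k)
  let ?S = "sphere_measure :: (real^'n) measure"
  define M where "M k = (\<integral>z. ((1 - z $ i) / 2) ^ k \<partial>?S)" for k
  have I: "integrable ?S (\<lambda>z. ((1 - z $ i) / 2) ^ k)" for k
    by (intro integrable_sphere_continuous n continuous_intros) auto
  have "(real CARD('n) - 1) * (\<integral>z. ((1 - z $ i) / 2) ^ k * z $ i \<partial>?S)
      = (\<integral>z. (- (real k / 2) * ((1 - z $ i) / 2) ^ (k - 1)) * (1 - (z $ i)\<^sup>2) \<partial>?S)"
    by (rule integral_sphere_coordinate_by_parts[OF n])
       (auto intro!: derivative_eq_intros continuous_intros)
  moreover have "((1 - t) / 2) ^ k * t = ((1 - t) / 2) ^ k - 2 * ((1 - t) / 2) ^ Suc k" for t :: real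
    by (simp add: field_simps)
  moreover have "(- (real k / 2) * ((1 - t) / 2) ^ (k - 1)) * (1 - t\<^sup>2)
      = - 2 * real k * (((1 - t) / 2) ^ k - ((1 - t) / 2) ^ Suc k)" for t :: real
  proof (cases k)
    case (Suc l)
    define s where "s = (1 - t) / 2"
    have t: "t = 1 - 2 * s" by (simp add: s_def field_simps)
    show ?thesis unfolding s_def[symmetric] t Suc
      by (simp add: field_simps power2_eq_square)
  qed simp
  ultimately have "(real CARD('n) - 1) * (\<integral>z. ((1 - z $ i) / 2) ^ k - 2 * ((1 - z $ i) / 2) ^ Suc k \<partial>?S)
      = (\<integral>z. - 2 * real k * (((1 - z $ i) / 2) ^ k - ((1 - z $ i) / 2) ^ Suc k) \<partial>?S)"
    by (simp only:)
  then have "(real CARD('n) - 1) * (M k - 2 * M (Suc k)) = - 2 * real k * (M k - M (Suc k))"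
    unfolding M_def using I[of k] I[of "Suc k"]
    by (simp del: power_Suc)
  moreover have "real CARD('n) - 1 = 2 * \<alpha>" by (simp add: \<alpha>_def)
  ultimately have "2 * \<alpha> * (M k - 2 * M (Suc k)) = - 2 * real k * (M k - M (Suc k))"
    by (simp only:)
  then have rec: "(2 * \<alpha> + real k) * M (Suc k) = (\<alpha> + real k) * M k"
    by (simp add: algebra_simps)
  have \<alpha>: "\<alpha> > 0" using n by (simp add: \<alpha>_def)
  then have "\<alpha> + real k \<notin> \<int>\<^sub>\<le>\<^sub>0" by (auto elim!: nonpos_Ints_cases)
  then have "(2 * \<alpha> + real k) * Beta (\<alpha> + real (Suc k)) \<alpha> = (\<alpha> + real k) * Beta (\<alpha> + real k) \<alpha>"
    using Beta_plus1_left[of "\<alpha> + real k" \<alpha>] by (simp add: algebra_simps)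
  also have "\<dots> = Beta \<alpha> \<alpha> * ((\<alpha> + real k) * M k)"
    using Suc.IH by (simp add: M_def)
  also have "\<dots> = (2 * \<alpha> + real k) * (Beta \<alpha> \<alpha> * M (Suc k))"
    by (simp add: rec[symmetric])
  finally show ?case using \<alpha> by (simp add: M_def)
qed

definition beta_weight :: "real \<Rightarrow> real \<Rightarrow> real" where
  "beta_weight a s = s powr (a - 1) * (1 - s) powr (a - 1)"

lemma beta_weight_absolutely_integrable:
  assumes "a > 0" "continuous_on {0..1} f"
  shows "(\<lambda>s. f s * beta_weight a s) absolutely_integrable_on {0..1}"
proof (rule absolutely_integrable_bounded_measurable_product_real)
  show "f \<in> borel_measurable (lebesgue_on {0..1})"
    by (intro continuous_imp_measurable_on_sets_lebesgue assms) auto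
  show "bounded (f ` {0..1})"
    by (intro compact_imp_bounded compact_continuous_image assms) auto
  show "beta_weight a absolutely_integrable_on {0..1}"
    using has_integral_integrable[OF has_integral_Beta_real[OF assms(1) assms(1)]]
    unfolding beta_weight_def[abs_def] by (intro nonnegative_absolutely_integrable_1) auto
qed auto

text \<open>The variable \<open>(1 - z $ i) / 2\<close> is Beta distributed with both parameters \<open>(n - 1) / 2\<close>: the two functionals have
  the same moments, and by Weierstrass approximation they agree on continuous functions. The
  density is unbounded for \<open>n = 2\<close>, but its integral is finite, which is all that the approximation needs.\<close>

lemma integral_sphere_coordinate:
  fixes i :: "'n::finite"
  assumes n: "2 \<le> CARD('n)" and f: "continuous_on {0..1} f"
  defines "\<alpha> \<equiv> (real CARD('n) - 1) / 2"
  shows "Beta \<alpha> \<alpha> * (\<integral>z. f ((1 - z $ i) / 2) \<partial>(sphere_measure :: (real^'n) measure))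
    = integral {0..1} (\<lambda>s. f s * beta_weight \<alpha> s)"
proof -
  let ?S = "sphere_measure :: (real^'n) measure"
  let ?w = "beta_weight \<alpha>"
  have \<alpha>: "\<alpha> > 0" using n by (simp add: \<alpha>_def)
  have z01: "(1 - z $ i) / 2 \<in> {0..1}" if "z \<in> sphere 0 1" for z :: "real^'n"
    using component_le_norm_cart[of z i] that by (auto simp: abs_le_iff)
  have cc: "continuous_on (sphere 0 1) (\<lambda>z::real^'n. h ((1 - z $ i) / 2))"
    if "continuous_on {0..1} h" for h :: "real \<Rightarrow> real"
    by (rule continuous_on_compose2[OF that]) (use z01 in \<open>auto intro!: continuous_intros\<close>)
  have Iz: "integrable ?S (\<lambda>z. h ((1 - z $ i) / 2))" if "continuous_on {0..1} h" for h :: "real \<Rightarrow> real"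
    by (intro integrable_sphere_continuous n cc that)
  have Iw: "(\<lambda>s. h s * ?w s) integrable_on {0..1}" if "continuous_on {0..1} h" for h
    using beta_weight_absolutely_integrable[OF \<alpha> that] by (rule set_lebesgue_integral_eq_integral(1))
  have B: "integral {0..1} ?w = Beta \<alpha> \<alpha>"
    using has_integral_Beta_real[OF \<alpha> \<alpha>] by (auto simp: beta_weight_def[abs_def] intro: integral_unique)
  have w0: "?w s \<ge> 0" for s by (simp add: beta_weight_def)
  have Bpos: "Beta \<alpha> \<alpha> \<ge> 0" unfolding B[symmetric] by (intro integral_nonneg) (use Iw[of "\<lambda>_. 1"] w0 in auto)
  \<comment> \<open>The difference of the two functionals vanishes on monomials and is bounded in the sup norm.\<close>
  define T where "T h = integral {0..1} (\<lambda>s. h s * ?w s) - Beta \<alpha> \<alpha> * (\<integral>z. h ((1 - z $ i) / 2) \<partial>?S)" for h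
  have mono: "T (\<lambda>s. s ^ k) = 0" for k
  proof -
    have "((\<lambda>s. s powr (\<alpha> + real k - 1) * (1 - s) powr (\<alpha> - 1)) has_integral Beta (\<alpha> + real k) \<alpha>) {0..1}"
      by (rule has_integral_Beta_real) (use \<alpha> in auto)
    then have "((\<lambda>s. s ^ k * ?w s) has_integral Beta (\<alpha> + real k) \<alpha>) {0<..<1}"
      unfolding has_integral_Icc_iff_Ioo
      by (rule has_integral_eq[rotated])
         (auto simp: beta_weight_def powr_realpow[symmetric] powr_add[symmetric] algebra_simps)
    then have "integral {0..1} (\<lambda>s. s ^ k * ?w s) = Beta (\<alpha> + real k) \<alpha>"
      unfolding has_integral_Icc_iff_Ioo[symmetric] by (rule integral_unique)
    then show ?thesis
      using sphere_moment[OF n, of i k] by (simp add: T_def \<alpha>_def)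
  qed
  have sum: "T (\<lambda>s. \<Sum>k\<le>N. a k * s ^ k) = 0" for a and N :: nat
  proof -
    have "integral {0..1} (\<lambda>s. (\<Sum>k\<le>N. a k * s ^ k) * ?w s)
        = integral {0..1} (\<lambda>s. \<Sum>k\<le>N. a k * (s ^ k * ?w s))"
      by (simp add: sum_distrib_right mult.assoc)
    also have "\<dots> = (\<Sum>k\<le>N. a k * integral {0..1} (\<lambda>s. s ^ k * ?w s))"
    proof (subst Henstock_Kurzweil_Integration.integral_sum)
      show "(\<lambda>s. a k * (s ^ k * ?w s)) integrable_on {0..1}" for k
        by (intro integrable_on_mult_right Iw continuous_intros)
    qed simp_all
    also have "\<dots> = (\<Sum>k\<le>N. a k * (Beta \<alpha> \<alpha> * (\<integral>z. ((1 - z $ i) / 2) ^ k \<partial>?S)))"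
      using mono by (simp add: T_def)
    also have "\<dots> = Beta \<alpha> \<alpha> * (\<integral>z. (\<Sum>k\<le>N. a k * ((1 - z $ i) / 2) ^ k) \<partial>?S)"
    proof (subst Bochner_Integration.integral_sum)
      show "integrable ?S (\<lambda>z. a k * ((1 - z $ i) / 2) ^ k)" for k
        by (intro integrable_mult_right Iz continuous_intros)
    qed (simp add: sum_distrib_left mult_ac)
    finally show ?thesis by (simp add: T_def)
  qed
  have bound: "\<bar>T h\<bar> \<le> 2 * Beta \<alpha> \<alpha> * e"
    if h: "continuous_on {0..1} h" and he: "\<And>s. s \<in> {0..1} \<Longrightarrow> \<bar>h s\<bar> \<le> e" for h e
  proof -
    have "norm (integral {0..1} (\<lambda>s. h s * ?w s)) \<le> integral {0..1} (\<lambda>s. e * ?w s)"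
    proof (rule integral_norm_bound_integral)
      show "(\<lambda>s. e * ?w s) integrable_on {0..1}" using Iw[of "\<lambda>_. e"] by auto
      show "norm (h s * ?w s) \<le> e * ?w s" if "s \<in> {0..1}" for s
        using he[OF that] w0[of s] by (simp add: abs_mult mult_right_mono)
    qed (rule Iw[OF h])
    then have 1: "\<bar>integral {0..1} (\<lambda>s. h s * ?w s)\<bar> \<le> Beta \<alpha> \<alpha> * e" by (simp add: B mult.commute)
    have "norm (\<integral>z. h ((1 - z $ i) / 2) \<partial>?S) \<le> e"
      by (rule integral_sphere_norm_le[OF n cc[OF h]]) (use he z01 in auto)
    then have "\<bar>Beta \<alpha> \<alpha> * (\<integral>z. h ((1 - z $ i) / 2) \<partial>?S)\<bar> \<le> Beta \<alpha> \<alpha> * e"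
      using Bpos by (simp add: abs_mult mult_left_mono)
    with 1 show ?thesis
      unfolding T_def mult.assoc mult_2 distrib_right by (intro order_trans[OF abs_triangle_ineq4] add_mono)
  qed
  have "\<bar>T f\<bar> \<le> 0 + \<epsilon>" if \<epsilon>: "\<epsilon> > 0" for \<epsilon>
  proof -
    define e where "e = \<epsilon> / (2 * Beta \<alpha> \<alpha> + 1)"
    have e: "e > 0" "2 * Beta \<alpha> \<alpha> * e \<le> \<epsilon>" using \<epsilon> Bpos by (auto simp: e_def field_simps)
    obtain p where p: "real_polynomial_function p" "\<And>s. s \<in> {0..1} \<Longrightarrow> \<bar>f s - p s\<bar> < e"
      using Stone_Weierstrass_real_polynomial_function[OF _ f e(1)] by (metis compact_Icc)
    then obtain a N where pa: "p = (\<lambda>s. \<Sum>k\<le>N. a k * s ^ k)"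
      unfolding real_polynomial_function_iff_sum by blast
    have pc: "continuous_on {0..1} p" unfolding pa by (intro continuous_intros)
    have "\<bar>T (\<lambda>s. f s - p s)\<bar> \<le> 2 * Beta \<alpha> \<alpha> * e"
      using p(2) by (intro bound continuous_intros f pc) (auto intro: less_imp_le)
    moreover have "T (\<lambda>s. f s - p s) = T f - T p"
      unfolding T_def using Iw[OF f] Iw[OF pc] Iz[OF f] Iz[OF pc]
      by (simp add: left_diff_distrib Henstock_Kurzweil_Integration.integral_diff right_diff_distrib)
    moreover have "T p = 0" unfolding pa by (rule sum)
    ultimately show ?thesis using e by simp
  qed
  then have "\<bar>T f\<bar> \<le> 0" by (rule field_le_epsilon)
  then show ?thesis by (simp add: T_def)
qed


section \<open>Power means of the distance to the sphere\<close>

definition sqdist_mean :: "real \<Rightarrow> real^'n \<Rightarrow> real" where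
  "sqdist_mean m x = (\<integral>z. sqdist_powr m x z \<partial>sphere_measure)"

text \<open>In the coordinate \<open>s = (1 - z $ i) / 2\<close> the squared distance from a point on the axis is affine, which
  is the reason for using this coordinate.\<close>

lemma sqdist_powr_axis:
  fixes z :: "real^'n::finite"
  assumes "z \<in> sphere 0 1"
  shows "sqdist_powr m (\<rho> *\<^sub>R axis i 1) z = ((1 - \<rho>)\<^sup>2 + 4 * \<rho> * ((1 - z $ i) / 2)) powr m"
proof -
  have "(\<rho> *\<^sub>R axis i 1 - z) \<bullet> (\<rho> *\<^sub>R axis i 1 - z) = (1 - \<rho>)\<^sup>2 + 4 * \<rho> * ((1 - z $ i) / 2)"
    unfolding sqdist_expand using assms
    by (simp add: inner_axis' inner_axis_axis dot_square_norm[of z] power2_eq_square field_simps)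
  then show ?thesis by (simp only: sqdist_powr_def)
qed

lemma sqdist_mean_eq_beta_integral:
  fixes x :: "real^'n::finite"
  assumes n: "2 \<le> CARD('n)" and x: "x \<in> ball 0 1"
  defines "\<alpha> \<equiv> (real CARD('n) - 1) / 2"
  shows "Beta \<alpha> \<alpha> * sqdist_mean m x
    = integral {0..1} (\<lambda>s. ((1 - norm x)\<^sup>2 + 4 * norm x * s) powr m * beta_weight \<alpha> s)"
proof -
  define i :: 'n where "i = undefined"
  let ?y = "norm x *\<^sub>R axis i 1 :: real^'n"
  have pos: "(1 - norm x)\<^sup>2 + 4 * norm x * s > 0" if "s \<in> {0..1}" for s
    using that x by (intro add_pos_nonneg) auto
  have c: "continuous_on {0..1} (\<lambda>s. ((1 - norm x)\<^sup>2 + 4 * norm x * s) powr m)"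
    using pos by (intro continuous_intros) force
  have "sqdist_mean m x = sqdist_mean m ?y"
    unfolding sqdist_mean_def by (rule integral_sqdist_powr_radial[OF n _ x]) simp
  also have "\<dots> = (\<integral>z. ((1 - norm x)\<^sup>2 + 4 * norm x * ((1 - z $ i) / 2)) powr m \<partial>(sphere_measure :: (real^'n) measure))"
    unfolding sqdist_mean_def by (intro integral_sphere_cong n sqdist_powr_axis)
  finally show ?thesis
    using integral_sphere_coordinate[OF n c, of i] by (simp add: \<alpha>_def)
qed

text \<open>All factors are positive, so in terms of the logarithms this is a linear identity. It is the
  transformation of the integrand in the change of variables below, where \<open>X = 1 - \<rho>\<close>, \<open>Y = 1 + \<rho>\<close>, \<open>d = D s\<close>
  and \<open>t = 1 - s\<close>.\<close>

lemma reflection_powr_identity: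
  fixes X Y d s t a b :: real
  assumes "X > 0" "Y > 0" "d > 0" "s > 0" "t > 0"
  shows "(X * Y)\<^sup>2 / d\<^sup>2 * (((X * Y)\<^sup>2 / d) powr a * ((X\<^sup>2 * t / d) powr (b - 1) * (Y\<^sup>2 * s / d) powr (b - 1)))
    = (X * Y) powr (2 * a + 2 * b) * (d powr (- a - 2 * b) * (s powr (b - 1) * t powr (b - 1)))"
proof -
  obtain x y e u v where "X = exp x" "Y = exp y" "d = exp e" "s = exp u" "t = exp v"
    using assms by (metis exp_ln)
  then show ?thesis
    by (simp add: power2_eq_square exp_powr_real flip: exp_add exp_diff) (simp add: algebra_simps)
qed

text \<open>The substitution \<open>g s = (1 - \<rho>)\<^sup>2 (1 - s) / D s\<close> is an involution of the unit interval which satisfies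
  \<open>D s \<cdot> D (g s) = (1 - \<rho>\<^sup>2)\<^sup>2\<close> and multiplies the measure \<open>beta_weight \<alpha> s ds\<close> by \<open>((1 - \<rho>\<^sup>2) / D s) powr (2 \<alpha>)\<close>. It is the
  effect on one coordinate of the conformal involution of the sphere belonging to a point at
  distance \<open>\<rho>\<close> from the centre.\<close>

lemma beta_integral_reflection:
  fixes \<rho> a \<alpha> :: real
  assumes \<rho>: "0 \<le> \<rho>" "\<rho> < 1" and \<alpha>: "\<alpha> > 0"
  defines "D \<equiv> \<lambda>s. (1 - \<rho>)\<^sup>2 + 4 * \<rho> * s"
  shows "integral {0..1} (\<lambda>s. D s powr a * beta_weight \<alpha> s)
    = (1 - \<rho>\<^sup>2) powr (2 * a + 2 * \<alpha>) * integral {0..1} (\<lambda>s. D s powr (- a - 2 * \<alpha>) * beta_weight \<alpha> s)"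
proof -
  let ?S = "{0<..<1::real}"
  define X where "X = 1 - \<rho>"
  define Y where "Y = 1 + \<rho>"
  have XY: "X > 0" "Y > 0" using \<rho> by (auto simp: X_def Y_def)
  have E: "X * Y = 1 - \<rho>\<^sup>2" by (simp add: X_def Y_def algebra_simps power2_eq_square)
  have D1: "D s = X\<^sup>2 * (1 - s) + Y\<^sup>2 * s" for s
    by (simp add: D_def X_def Y_def algebra_simps power2_eq_square)
  have Dpos: "D s > 0" if "s \<in> {0..1}" for s
    using that \<rho> unfolding D_def by (intro add_pos_nonneg) auto
  define g where "g s = X\<^sup>2 * (1 - s) / D s" for s
  have g1: "1 - g s = Y\<^sup>2 * s / D s" if "s \<in> ?S" for s
    using Dpos[of s] that by (simp add: g_def field_simps D1)
  have Dg: "D (g s) = (X * Y)\<^sup>2 / D s" if s: "s \<in> ?S" for s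
  proof -
    have "D (g s) = X\<^sup>2 * (1 - g s) + Y\<^sup>2 * g s" by (rule D1)
    also have "\<dots> = (X * Y)\<^sup>2 / D s"
      unfolding g1[OF s] by (simp add: g_def power_mult_distrib add_divide_distrib[symmetric] algebra_simps)
    finally show ?thesis .
  qed
  have gS: "g s \<in> ?S" if s: "s \<in> ?S" for s
  proof -
    have "g s > 0" "1 - g s > 0"
      using g1[OF s] s XY Dpos[of s] by (simp_all add: g_def)
    then show ?thesis by simp
  qed
  have gg: "g (g s) = s" if s: "s \<in> ?S" for s
  proof -
    have "g (g s) = X\<^sup>2 * (1 - g s) / D (g s)" by (simp add: g_def)
    also have "\<dots> = s"
      unfolding g1[OF s] Dg[OF s] using XY Dpos[of s] s by (simp add: power_mult_distrib)
    finally show ?thesis .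
  qed
  have img: "g ` ?S = ?S" using gS gg by (force simp: image_iff)
  have inj: "inj_on g ?S" by (rule inj_on_inverseI[of _ g]) (rule gg)
  have der: "(g has_field_derivative - ((X * Y)\<^sup>2 / (D s)\<^sup>2)) (at s within ?S)" if s: "s \<in> ?S" for s
  proof -
    have "D s \<noteq> 0" using Dpos[of s] s by simp
    moreover have "(D has_field_derivative (4 * \<rho>)) (at s within ?S)"
      unfolding D_def by (auto intro!: derivative_eq_intros)
    ultimately have "(g has_field_derivative ((- X\<^sup>2) * D s - (X\<^sup>2 * (1 - s)) * (4 * \<rho>)) / (D s * D s)) (at s within ?S)"
      unfolding g_def by (auto intro!: derivative_eq_intros)
    also have "(- X\<^sup>2) * D s - (X\<^sup>2 * (1 - s)) * (4 * \<rho>) = - ((X * Y)\<^sup>2)"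
      by (simp add: D_def X_def Y_def algebra_simps power2_eq_square)
    finally show ?thesis by (simp add: power2_eq_square)
  qed
  define f where "f s = D s powr a * beta_weight \<alpha> s" for s
  have "continuous_on {0..1} D" unfolding D_def by (intro continuous_intros)
  then have c: "continuous_on {0..1} (\<lambda>s. D s powr a)"
    using Dpos by (intro continuous_intros) force+
  \<comment> \<open>The change of variables is made on the open interval because the weight is singular at the
    end points when \<open>\<alpha> < 1\<close>.\<close>
  have "f absolutely_integrable_on g ` ?S"
    unfolding img f_def absolutely_integrable_on_Icc_iff_Ioo[symmetric]
    by (rule beta_weight_absolutely_integrable[OF \<alpha> c])
  then have "integral ?S (\<lambda>s. \<bar>- ((X * Y)\<^sup>2 / (D s)\<^sup>2)\<bar> * f (g s)) = integral ?S f"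
    using has_absolute_integral_change_of_variables_1'[OF _ der inj, of f "integral ?S f"] by (simp add: img)
  also have "integral ?S (\<lambda>s. \<bar>- ((X * Y)\<^sup>2 / (D s)\<^sup>2)\<bar> * f (g s))
     = integral ?S (\<lambda>s. (X * Y) powr (2 * a + 2 * \<alpha>) * (D s powr (- a - 2 * \<alpha>) * beta_weight \<alpha> s))"
  proof (rule integral_cong)
    fix s assume s: "s \<in> ?S"
    show "\<bar>- ((X * Y)\<^sup>2 / (D s)\<^sup>2)\<bar> * f (g s) = (X * Y) powr (2 * a + 2 * \<alpha>) * (D s powr (- a - 2 * \<alpha>) * beta_weight \<alpha> s)"
      using reflection_powr_identity[of X Y "D s" s "1 - s" a \<alpha>] XY Dpos[of s] s
      by (simp add: f_def beta_weight_def Dg[OF s] g1[OF s]) (simp add: g_def)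
  qed
  finally show ?thesis
    by (simp add: E integral_open_interval_real f_def[abs_def])
qed

text \<open>The mean is the hypergeometric function \<open>F (-a, 1 - a - n/2; n/2; \<bar>x\<bar>\<^sup>2)\<close>, and the identity is Euler's
  transformation of it. It trades the exponent that comes from the Poisson kernel, for which the mean
  may blow up at the boundary, for one with a bounded mean.\<close>

lemma sqdist_mean_reflection:
  fixes x :: "real^'n::finite"
  assumes n: "2 \<le> CARD('n)" and x: "x \<in> ball 0 1"
  shows "sqdist_mean a x = (1 - x \<bullet> x) powr (2 * a + real CARD('n) - 1)
    * sqdist_mean (- a - real CARD('n) + 1) x"
proof -
  define \<alpha> where "\<alpha> = (real CARD('n) - 1) / 2"
  have \<alpha>: "\<alpha> > 0" using n by (simp add: \<alpha>_def)
  have B: "Beta \<alpha> \<alpha> > 0" using \<alpha> by (simp add: Beta_def Gamma_real_pos)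
  note mean = sqdist_mean_eq_beta_integral[OF n x, folded \<alpha>_def]
  have "Beta \<alpha> \<alpha> * sqdist_mean a x = (1 - (norm x)\<^sup>2) powr (2 * a + 2 * \<alpha>) * (Beta \<alpha> \<alpha> * sqdist_mean (- a - 2 * \<alpha>) x)"
    unfolding mean using x \<alpha> by (intro beta_integral_reflection) auto
  moreover have "- a - 2 * \<alpha> = - a - real CARD('n) + 1" "2 * a + 2 * \<alpha> = 2 * a + real CARD('n) - 1"
    by (simp_all add: \<alpha>_def field_simps)
  ultimately show ?thesis using B by (simp add: dot_square_norm)
qed

lemma C2_on_sqdist_mean:
  assumes n: "2 \<le> CARD('n::finite)"
  shows "C2_on (sqdist_mean m :: real^'n \<Rightarrow> real) (\<lambda>x. \<integral>z. sqdist_powr_grad m x z \<partial>sphere_measure)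
    (\<lambda>x. \<integral>z. sqdist_powr_hess m x z \<partial>sphere_measure) (ball 0 1)"
  unfolding sqdist_mean_def[abs_def]
proof (rule C2_on_integral_sphere[OF n open_ball])
  fix z :: "real^'n" assume "z \<in> sphere 0 1"
  then have "ball 0 1 \<subseteq> - {z}" by auto
  then show "C2_on (\<lambda>x. sqdist_powr m x z) (\<lambda>x. sqdist_powr_grad m x z) (\<lambda>x. sqdist_powr_hess m x z) (ball 0 1)"
    by (rule C2_on_subset[OF C2_on_sqdist_powr])
qed (rule continuous_on_sqdist_powr)+

lemma trace_sqdist_mean:
  fixes x :: "real^'n::finite"
  assumes n: "2 \<le> CARD('n)" and x: "x \<in> ball 0 1"
  shows "trace (\<integral>z. sqdist_powr_hess m x z \<partial>sphere_measure)
    = 2 * m * (2 * m + real CARD('n) - 2) * sqdist_mean (m - 1) x"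
proof -
  have "trace (\<integral>z. sqdist_powr_hess m x z \<partial>sphere_measure) = (\<integral>z. trace (sqdist_powr_hess m x z) \<partial>sphere_measure)"
    by (rule trace_integral_sphere[OF n continuous_on_slice[OF continuous_on_sqdist_powr(3) x]])
  also have "\<dots> = (\<integral>z. 2 * m * (2 * m + real CARD('n) - 2) * sqdist_powr (m - 1) x z \<partial>sphere_measure)"
    by (intro integral_sphere_cong n trace_sqdist_powr_hess ball_sphere_ne[OF x])
  also have "\<dots> = 2 * m * (2 * m + real CARD('n) - 2) * sqdist_mean (m - 1) x"
    unfolding sqdist_mean_def by (rule Bochner_Integration.integral_mult_right_zero)
  finally show ?thesis .
qed

lemma sqdist_mean_nonneg: "0 \<le> sqdist_mean m x"
  unfolding sqdist_mean_def by (intro Bochner_Integration.integral_nonneg sqdist_powr_nonneg)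

lemma sqdist_mean_zero:
  assumes n: "2 \<le> CARD('n::finite)"
  shows "sqdist_mean m (0 :: real^'n) = 1"
  unfolding sqdist_mean_def
  using integral_sphere_cong[OF n sqdist_powr_zero[where m = m]]
  by (simp only: integral_sphere_const[OF n])

text \<open>Under these hypotheses the mean is superharmonic. Being radial, it takes the value at \<open>x\<close> on a
  whole sphere, and the value \<open>1\<close> at the centre cannot be smaller.\<close>

lemma sqdist_mean_le_one:
  fixes x :: "real^'n::finite"
  assumes n: "2 \<le> CARD('n)" and x: "x \<in> ball 0 1"
    and m: "m \<le> 0" "2 * m + real CARD('n) - 2 \<ge> 0"
  shows "sqdist_mean m x \<le> 1"
proof -
  have "-1 * sqdist_mean m (0 :: real^'n) \<le> - sqdist_mean m x"
  proof (rule subharmonic_max_principle[OF C2_on_cmult[OF C2_on_sqdist_mean[OF n]]])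
    show "cball 0 (norm x) \<subseteq> ball 0 1" using x by auto
    show "-1 * sqdist_mean m y \<le> - sqdist_mean m x" if "norm y = norm x" for y :: "real^'n"
    proof -
      have "y \<in> ball 0 1" using that x by simp
      then show ?thesis
        using integral_sqdist_powr_radial[OF n that, of m] by (simp add: sqdist_mean_def)
    qed
    show "0 \<le> trace (-1 *\<^sub>R (\<integral>z. sqdist_powr_hess m y z \<partial>sphere_measure))" if "y \<in> ball 0 (norm x)" for y :: "real^'n"
    proof -
      have y: "y \<in> ball 0 1" using that x by simp
      have "m * (2 * m + real CARD('n) - 2) * sqdist_mean (m - 1) y \<le> 0"
        using m by (intro mult_nonpos_nonneg sqdist_mean_nonneg) auto
      then have "-1 * (2 * (m * (2 * m + real CARD('n) - 2) * sqdist_mean (m - 1) y)) \<ge> 0" by linarith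
      then show ?thesis unfolding trace_scaleR trace_sqdist_mean[OF n y] by (simp only: mult.assoc)
    qed
  qed simp
  then show ?thesis by (simp add: sqdist_mean_zero[OF n])
qed

text \<open>For positive \<open>m\<close> the power is continuous even where the distance vanishes, so the mean extends
  continuously across the unit sphere.\<close>

lemma continuous_on_sqdist_mean:
  assumes n: "2 \<le> CARD('n::finite)" and m: "m > 0"
  shows "continuous_on UNIV (sqdist_mean m :: real^'n \<Rightarrow> real)"
  unfolding sqdist_mean_def[abs_def] sqdist_powr_def
  by (intro continuous_on_integral_sphere[OF n] continuous_on_powr' continuous_intros) (use m in auto)

lemma tendsto_sqdist_mean_boundary:
  assumes n: "2 \<le> CARD('n::finite)" and m: "m > 0"
  shows "((\<lambda>r. sqdist_mean m (r *\<^sub>R e :: real^'n)) \<longlongrightarrow> sqdist_mean m e) (at_left 1)"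
proof -
  have "continuous_on UNIV (\<lambda>r. sqdist_mean m (r *\<^sub>R e :: real^'n))"
    by (rule continuous_on_compose2[OF continuous_on_sqdist_mean[OF n m]]) (auto intro!: continuous_intros)
  then have "((\<lambda>r. sqdist_mean m (r *\<^sub>R e :: real^'n)) \<longlongrightarrow> sqdist_mean m (1 *\<^sub>R e)) (at 1)"
    unfolding continuous_on_def by (elim ballE[of _ _ 1]) auto
  then show ?thesis by (auto intro: tendsto_within_subset)
qed

text \<open>For positive \<open>m\<close> the mean is subharmonic and radial, hence bounded inside by its value on any larger
  sphere; that radius then tends to \<open>1\<close>.\<close>

lemma sqdist_mean_le_boundary:
  fixes x :: "real^'n::finite" and i :: 'n
  assumes n: "2 \<le> CARD('n)" and x: "x \<in> ball 0 1" and m: "m > 0"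
  shows "sqdist_mean m x \<le> sqdist_mean m (axis i 1 :: real^'n)"
proof (rule tendsto_lowerbound[OF tendsto_sqdist_mean_boundary[OF n m]])
  have "sqdist_mean m x \<le> sqdist_mean m (r *\<^sub>R axis i 1 :: real^'n)" if r: "norm x < r" "r < 1" for r
  proof (rule subharmonic_max_principle[OF C2_on_sqdist_mean[OF n]])
    have r0: "r > 0" using r norm_ge_zero[of x] by linarith
    show "cball 0 r \<subseteq> ball 0 1" "x \<in> cball 0 r" using r by auto
    show "sqdist_mean m y \<le> sqdist_mean m (r *\<^sub>R axis i 1 :: real^'n)" if "norm y = r" for y :: "real^'n"
    proof -
      have "y \<in> ball 0 1" "norm y = norm (r *\<^sub>R axis i 1 :: real^'n)" using that r r0 by auto
      then show ?thesis
        using integral_sqdist_powr_radial[OF n, of y "r *\<^sub>R axis i 1" m] by (simp add: sqdist_mean_def)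
    qed
    show "0 \<le> trace (\<integral>z. sqdist_powr_hess m y z \<partial>sphere_measure)" if "y \<in> ball 0 r" for y :: "real^'n"
    proof -
      have y: "y \<in> ball 0 1" using that r by simp
      show ?thesis unfolding trace_sqdist_mean[OF n y]
        using m n by (intro mult_nonneg_nonneg sqdist_mean_nonneg) auto
    qed
  qed
  then show "eventually (\<lambda>r. sqdist_mean m x \<le> sqdist_mean m (r *\<^sub>R axis i 1 :: real^'n)) (at_left 1)"
    using x eventually_at_left_field by (force intro: exI[of _ "norm x"])
qed simp

text \<open>At the boundary the squared distance is \<open>4 s\<close>, and the power \<open>s powr m\<close> only shifts the first parameter of the
  Beta integral.\<close>

lemma sqdist_mean_boundary:
  fixes i :: "'n::finite"
  assumes n: "2 \<le> CARD('n)" and m: "m > 0"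
  defines "\<alpha> \<equiv> (real CARD('n) - 1) / 2"
  shows "sqdist_mean m (axis i 1 :: real^'n) = 4 powr m * Beta (\<alpha> + m) \<alpha> / Beta \<alpha> \<alpha>"
proof -
  have \<alpha>: "\<alpha> > 0" using n by (simp add: \<alpha>_def)
  have B: "Beta \<alpha> \<alpha> > 0" using \<alpha> by (simp add: Beta_def Gamma_real_pos)
  have "sqdist_mean m (axis i 1 :: real^'n)
      = (\<integral>z. (4 * ((1 - z $ i) / 2)) powr m \<partial>(sphere_measure :: (real^'n) measure))"
    unfolding sqdist_mean_def using sqdist_powr_axis[of _ m 1 i] by (intro integral_sphere_cong n) simp
  moreover have "continuous_on {0..1} (\<lambda>s. (4 * s) powr m)"
    using m by (intro continuous_on_powr' continuous_intros) auto
  ultimately have "Beta \<alpha> \<alpha> * sqdist_mean m (axis i 1 :: real^'n) = integral {0..1} (\<lambda>s. (4 * s) powr m * beta_weight \<alpha> s)"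
    using integral_sphere_coordinate[OF n, of "\<lambda>s. (4 * s) powr m" i] by (simp add: \<alpha>_def)
  also have "\<dots> = integral {0..1} (\<lambda>s. 4 powr m * (s powr (\<alpha> + m - 1) * (1 - s) powr (\<alpha> - 1)))"
    by (rule integral_cong) (auto simp: beta_weight_def powr_mult powr_add[symmetric] algebra_simps)
  also have "\<dots> = 4 powr m * Beta (\<alpha> + m) \<alpha>"
    using has_integral_Beta_real[of "\<alpha> + m" \<alpha>] \<alpha> m by (simp add: integral_unique)
  finally show ?thesis using B by (simp add: field_simps)
qed

lemma Gamma_legendre_duplication_real:
  fixes z :: real
  assumes "z > 0"
  shows "Gamma z * Gamma (z + 1/2) = 2 powr (1 - 2 * z) * sqrt pi * Gamma (2 * z)"
proof -
  have "complex_of_real z \<notin> \<int>\<^sub>\<le>\<^sub>0" "complex_of_real z + 1/2 \<notin> \<int>\<^sub>\<le>\<^sub>0"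
    using assms by (auto elim!: nonpos_Ints_cases simp: complex_eq_iff)
  then have "Gamma (complex_of_real z) * Gamma (complex_of_real z + 1/2) =
     exp ((1 - 2 * complex_of_real z) * of_real (ln 2)) * of_real (sqrt pi) * Gamma (2 * complex_of_real z)"
    by (rule Gamma_legendre_duplication)
  also have "complex_of_real z + 1/2 = complex_of_real (z + 1/2)" by simp
  also have "exp ((1 - 2 * complex_of_real z) * of_real (ln 2)) = complex_of_real (2 powr (1 - 2 * z))"
    by (simp add: powr_def exp_of_real[symmetric] algebra_simps)
  also have "2 * complex_of_real z = complex_of_real (2 * z)" by simp
  finally have "complex_of_real (Gamma z * Gamma (z + 1/2)) = complex_of_real (2 powr (1 - 2 * z) * sqrt pi * Gamma (2 * z))"
    by (simp only: Gamma_complex_of_real of_real_mult[symmetric])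
  then show ?thesis by (simp only: of_real_eq_iff)
qed

text \<open>The Beta quotient contains \<open>Gamma (n - 1) / Gamma ((n - 1) / 2)\<close>, which the duplication formula rewrites by
  \<open>Gamma (n / 2)\<close>.\<close>

lemma sqdist_mean_boundary_Gamma:
  fixes i :: "'n::finite" and q :: real
  assumes n: "2 \<le> CARD('n)" and q: "q > 2 - 2 / real CARD('n)"
  defines "N \<equiv> real CARD('n)"
  shows "sqdist_mean (N * q / 2 - N + 1) (axis i 1 :: real^'n)
    = 2 powr (N * q - N) * Gamma (N / 2) * Gamma ((1 + N * q - N) / 2) / (sqrt pi * Gamma (N * q / 2))"
proof -
  define \<alpha> where "\<alpha> = (N - 1) / 2"
  define m where "m = N * q / 2 - N + 1"
  have N: "N \<ge> 2" using n by (simp add: N_def)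
  then have \<alpha>: "\<alpha> > 0" by (simp add: \<alpha>_def)
  have "N * q > N * (2 - 2 / N)" using q N unfolding N_def[symmetric] by (intro mult_strict_left_mono) auto
  then have m: "m > 0" using N by (simp add: m_def algebra_simps)
  have G: "Gamma (N / 2) = 2 powr (2 - N) * sqrt pi * Gamma (2 * \<alpha>) / Gamma \<alpha>"
  proof -
    have "\<alpha> + 1/2 = N / 2" "1 - 2 * \<alpha> = 2 - N" by (simp_all add: \<alpha>_def field_simps)
    then have "Gamma \<alpha> * Gamma (N / 2) = 2 powr (2 - N) * sqrt pi * Gamma (2 * \<alpha>)"
      using Gamma_legendre_duplication_real[OF \<alpha>] by (simp only:)
    then show ?thesis using Gamma_real_pos[OF \<alpha>] by (simp add: field_simps)
  qed
  have "4 powr m = 2 powr (2 * m)"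
    using powr_powr[of 2 2 m] by simp
  also have "\<dots> = 2 powr (N * q - N) * 2 powr (2 - N)"
    by (simp add: m_def powr_add[symmetric] algebra_simps)
  finally have p4: "4 powr m = 2 powr (N * q - N) * 2 powr (2 - N)" .
  have "sqdist_mean m (axis i 1 :: real^'n) = 4 powr m * Beta (\<alpha> + m) \<alpha> / Beta \<alpha> \<alpha>"
    unfolding \<alpha>_def N_def by (rule sqdist_mean_boundary[OF n m])
  also have "\<dots> = 4 powr m * Gamma (\<alpha> + m) * Gamma (2 * \<alpha>) / (Gamma (2 * \<alpha> + m) * Gamma \<alpha>)"
    using Gamma_real_pos[OF \<alpha>] Gamma_real_pos[of "2 * \<alpha>"] Gamma_real_pos[of "2 * \<alpha> + m"] \<alpha> m
    by (simp add: Beta_def field_simps)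
  also have "\<alpha> + m = (1 + N * q - N) / 2" by (simp add: \<alpha>_def m_def field_simps)
  also have "2 * \<alpha> + m = N * q / 2" by (simp add: \<alpha>_def m_def field_simps)
  also have "4 powr m * Gamma ((1 + N * q - N) / 2) * Gamma (2 * \<alpha>) / (Gamma (N * q / 2) * Gamma \<alpha>)
      = 2 powr (N * q - N) * Gamma (N / 2) * Gamma ((1 + N * q - N) / 2) / (sqrt pi * Gamma (N * q / 2))"
    unfolding G p4 by (simp add: field_simps)
  finally show ?thesis by (simp add: m_def)
qed

lemma hardy_const_eq:
  fixes i :: "'n::finite"
  assumes n: "2 \<le> CARD('n)"
  shows "hardy_const CARD('n) q = (if q \<le> 2 - 2 / real CARD('n) then 1
    else sqdist_mean (real CARD('n) * q / 2 - real CARD('n) + 1) (axis i 1 :: real^'n) powr (1 / q))"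
  unfolding hardy_const_def using sqdist_mean_boundary_Gamma[OF n, of q i] by simp

text \<open>The reflection identity with \<open>a = - (n q / 2)\<close>. The exponent of \<open>1 - x \<bullet> x\<close> is \<open>q\<close>, from the numerator of the
  kernel, plus \<open>n - 1 - n q\<close>, from the reflection.\<close>

lemma integral_poisson_kernel_powr:
  fixes x :: "real^'n::finite"
  assumes n: "2 \<le> CARD('n)" and x: "x \<in> ball 0 1"
  defines "N \<equiv> real CARD('n)"
  shows "(\<integral>z. poisson_kernel x z powr q \<partial>sphere_measure)
    = (1 - x \<bullet> x) powr (- ((N - 1) * (q - 1))) * sqdist_mean (N * q / 2 - N + 1) x"
proof -
  have x1: "1 - x \<bullet> x > 0" using norm_less_one_inner[OF x] by simp
  have "(\<integral>z. poisson_kernel x z powr q \<partial>sphere_measure)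
      = (\<integral>z. (1 - x \<bullet> x) powr q * sqdist_powr (- (N * q / 2)) x z \<partial>sphere_measure)"
    using x1 by (simp add: poisson_kernel_def sqdist_powr_def powr_mult powr_powr N_def mult.commute)
  also have "\<dots> = (1 - x \<bullet> x) powr q * sqdist_mean (- (N * q / 2)) x"
    unfolding sqdist_mean_def by (rule Bochner_Integration.integral_mult_right_zero)
  also have "sqdist_mean (- (N * q / 2)) x
      = (1 - x \<bullet> x) powr (2 * (- (N * q / 2)) + N - 1) * sqdist_mean (- (- (N * q / 2)) - N + 1) x"
    unfolding N_def by (rule sqdist_mean_reflection[OF n x])
  also have "(1 - x \<bullet> x) powr q * ((1 - x \<bullet> x) powr (2 * (- (N * q / 2)) + N - 1) * sqdist_mean (- (- (N * q / 2)) - N + 1) x)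
     = (1 - x \<bullet> x) powr (q + (2 * (- (N * q / 2)) + N - 1)) * sqdist_mean (- (- (N * q / 2)) - N + 1) x"
    by (simp add: powr_add)
  also have "q + (2 * (- (N * q / 2)) + N - 1) = - ((N - 1) * (q - 1))" by (simp add: algebra_simps)
  finally show ?thesis by simp
qed

text \<open>The condition \<open>q \<le> 2 - 2/n\<close> says exactly that the exponent \<open>m = n q / 2 - n + 1\<close> is nonpositive, and
  \<open>q \<ge> 1\<close> says that \<open>2 m + n - 2 \<ge> 0\<close>.\<close>

lemma sqdist_mean_le_hardy_const:
  fixes x :: "real^'n::finite" and q :: real
  assumes n: "2 \<le> CARD('n)" and x: "x \<in> ball 0 1" and q: "q \<ge> 1"
  shows "sqdist_mean (real CARD('n) * q / 2 - real CARD('n) + 1) x \<le> hardy_const CARD('n) q powr q"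
proof -
  define N where "N = real CARD('n)"
  define m where "m = N * q / 2 - N + 1"
  have N: "N \<ge> 2" using n by (simp add: N_def)
  have Nq: "N * q \<ge> N" using N q by simp
  show ?thesis
  proof (cases "q \<le> 2 - 2 / N")
    case True
    then have "N * q \<le> N * (2 - 2 / N)" using N by (intro mult_left_mono) auto
    then have "m \<le> 0" using N by (simp add: m_def algebra_simps)
    moreover have "2 * m + N - 2 \<ge> 0" using Nq by (simp add: m_def)
    ultimately have "sqdist_mean m x \<le> 1" using n x unfolding N_def by (intro sqdist_mean_le_one)
    then show ?thesis using True by (simp add: hardy_const_def N_def m_def)
  next
    case False
    then have "N * q > N * (2 - 2 / N)" using N by (intro mult_strict_left_mono) auto
    then have "m > 0" using N by (simp add: m_def algebra_simps)
    then have "sqdist_mean m x \<le> sqdist_mean m (axis undefined 1 :: real^'n)"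
      by (rule sqdist_mean_le_boundary[OF n x])
    also have "\<dots> = hardy_const CARD('n) q powr q"
      using False q by (simp add: hardy_const_eq[OF n, of q undefined] powr_powr N_def m_def sqdist_mean_nonneg)
    finally show ?thesis by (simp add: m_def N_def)
  qed
qed


section \<open>The pointwise estimate\<close>

lemma continuous_on_powr_nonneg:
  fixes f :: "'a::topological_space \<Rightarrow> real"
  assumes "continuous_on S f" "\<And>x. x \<in> S \<Longrightarrow> 0 \<le> f x" "p > 0"
  shows "continuous_on S (\<lambda>x. f x powr p)"
  by (intro continuous_on_powr' assms continuous_intros) (use assms in auto)

text \<open>Hoelder's inequality with positive upper bounds in place of the two norms. A function of norm zero
  then needs no separate treatment: its norm is replaced by an arbitrarily small bound.\<close>

lemma holder_sphere:
  fixes f g :: "real^'n::finite \<Rightarrow> real"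
  assumes n: "2 \<le> CARD('n)" and pq: "p > 1" "q > 1" "1 / p + 1 / q = 1"
    and f: "continuous_on (sphere 0 1) f" "\<And>z. z \<in> sphere 0 1 \<Longrightarrow> 0 \<le> f z"
    and g: "continuous_on (sphere 0 1) g" "\<And>z. z \<in> sphere 0 1 \<Longrightarrow> 0 \<le> g z"
    and A: "A > 0" "(\<integral>z. f z powr p \<partial>sphere_measure) \<le> A powr p"
    and B: "B > 0" "(\<integral>z. g z powr q \<partial>sphere_measure) \<le> B powr q"
  shows "(\<integral>z. f z * g z \<partial>sphere_measure) \<le> A * B"
proof -
  let ?S = "sphere_measure :: (real^'n) measure"
  have fp: "continuous_on (sphere 0 1) (\<lambda>z. f z powr p)"
    by (rule continuous_on_powr_nonneg[OF f]) (use pq in auto)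
  have gq: "continuous_on (sphere 0 1) (\<lambda>z. g z powr q)"
    by (rule continuous_on_powr_nonneg[OF g]) (use pq in auto)
  have "(\<integral>z. f z * g z \<partial>?S)
      \<le> (\<integral>z. A * B / (p * A powr p) * f z powr p + A * B / (q * B powr q) * g z powr q \<partial>?S)"
  proof (intro integral_sphere_mono n continuous_on_add continuous_on_mult continuous_on_const f(1) g(1) fp gq)
    fix z :: "real^'n" assume z: "z \<in> sphere 0 1"
    have "(f z / A) * (g z / B) \<le> (f z / A) powr p / p + (g z / B) powr q / q"
      using f(2)[OF z] g(2)[OF z] A B pq by (intro Youngs_inequality) auto
    then have "A * B * ((f z / A) * (g z / B)) \<le> A * B * ((f z / A) powr p / p + (g z / B) powr q / q)"
      using A B by (intro mult_left_mono) auto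
    then show "f z * g z \<le> A * B / (p * A powr p) * f z powr p + A * B / (q * B powr q) * g z powr q"
      using f(2)[OF z] g(2)[OF z] A B by (simp add: powr_divide field_simps)
  qed
  also have "\<dots> = A * B / (p * A powr p) * (\<integral>z. f z powr p \<partial>?S) + A * B / (q * B powr q) * (\<integral>z. g z powr q \<partial>?S)"
    using integrable_sphere_continuous[OF n fp] integrable_sphere_continuous[OF n gq] by simp
  also have "\<dots> \<le> A * B / (p * A powr p) * A powr p + A * B / (q * B powr q) * B powr q"
    using A B pq by (intro add_mono mult_left_mono) auto
  also have "\<dots> = A * B * (1 / p + 1 / q)"
    using A B pq by (simp add: field_simps)
  finally show ?thesis using pq by simp
qed

lemma hardy_mean_le:
  fixes u :: "real^'n::finite \<Rightarrow> real"
  assumes n: "2 \<le> CARD('n)" and u: "u \<in> hardy_space (ereal p)" and p: "p > 0" and r: "r \<in> {0<..<1}"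
  shows "(\<integral>z. \<bar>u (r *\<^sub>R z)\<bar> powr p \<partial>sphere_measure) \<le> enn2real (hardy_mean_sup p u)"
proof -
  have h: "harmonic_on u (ball 0 1)" and fin: "hardy_mean_sup p u < \<infinity>"
    using u by (auto simp: hardy_space_def)
  have c: "continuous_on (sphere 0 1) (\<lambda>z. u (r *\<^sub>R z))"
    by (rule continuous_on_compose2[OF harmonic_on_continuous[OF h]]) (use r in \<open>auto intro!: continuous_intros\<close>)
  have "continuous_on (sphere 0 1) (\<lambda>z. \<bar>u (r *\<^sub>R z)\<bar> powr p)"
    using p by (intro continuous_on_powr_nonneg continuous_intros c) auto
  then have "ennreal (\<integral>z. \<bar>u (r *\<^sub>R z)\<bar> powr p \<partial>sphere_measure)
      = (\<integral>\<^sup>+z. ennreal (\<bar>u (r *\<^sub>R z)\<bar> powr p) \<partial>sphere_measure)"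
    by (intro nn_integral_eq_integral[symmetric] integrable_sphere_continuous n) auto
  also have "\<dots> \<le> hardy_mean_sup p u"
    unfolding hardy_mean_sup_def by (rule SUP_upper[OF r])
  finally have "enn2real (ennreal (\<integral>z. \<bar>u (r *\<^sub>R z)\<bar> powr p \<partial>sphere_measure)) \<le> enn2real (hardy_mean_sup p u)"
    using fin by (intro enn2real_mono) auto
  then show ?thesis by (simp add: Bochner_Integration.integral_nonneg)
qed

lemma hardy_const_pos:
  assumes n: "2 \<le> CARD('n::finite)" and q: "q \<ge> 1"
  shows "hardy_const CARD('n) q > 0"
proof -
  have "1 \<le> hardy_const CARD('n) q powr q"
    using sqdist_mean_le_hardy_const[OF n _ q, of 0] by (simp add: sqdist_mean_zero[OF n])
  moreover have "hardy_const CARD('n) q \<ge> 0" by (simp add: hardy_const_def)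
  ultimately show ?thesis by (cases "hardy_const CARD('n) q = 0") auto
qed

lemma conjugate_exponent:
  fixes p q :: real
  assumes "p > 1" "1 / p + 1 / q = 1"
  shows "q > 1" "q / p = q - 1" "p * (q - 1) = q" "1 - 1 / p = 1 / q" "(q - 1) / q = 1 / p"
proof -
  have p: "1 / p < 1" "1 / p > 0" using assms by auto
  then have q1: "1 / q > 0" "1 / q < 1" using assms by linarith+
  then have q0: "q > 0" by (simp add: zero_less_divide_iff)
  then show "q > 1" using q1 by (simp add: field_simps)
  show "1 - 1 / p = 1 / q" using assms by simp
  have "1 / p = 1 - 1 / q" using assms by simp
  then show "(q - 1) / q = 1 / p" using q0 by (simp add: field_simps)
  then show a: "q / p = q - 1" using q0 by (simp add: field_simps)
  show "p * (q - 1) = q" unfolding a[symmetric] using assms by simp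
qed

text \<open>The exponents match because \<open>(q - 1) / q = 1 / p\<close>.\<close>

lemma integral_poisson_kernel_powr_le:
  fixes x :: "real^'n::finite"
  assumes n: "2 \<le> CARD('n)" and x: "x \<in> ball 0 1" and pq: "p > 1" "1 / p + 1 / q = 1"
  shows "(\<integral>z. poisson_kernel x z powr q \<partial>sphere_measure)
    \<le> (hardy_const CARD('n) q / (1 - x \<bullet> x) powr ((real CARD('n) - 1) / p)) powr q"
proof -
  define N where "N = real CARD('n)"
  note q = conjugate_exponent[OF pq]
  have x1: "1 - x \<bullet> x > 0" using norm_less_one_inner[OF x] by simp
  have K: "hardy_const CARD('n) q > 0" using hardy_const_pos[OF n] q(1) by simp
  have "(\<integral>z. poisson_kernel x z powr q \<partial>sphere_measure)
    \<le> (1 - x \<bullet> x) powr (- ((N - 1) * (q - 1))) * hardy_const CARD('n) q powr q"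
    unfolding integral_poisson_kernel_powr[OF n x] N_def
    using q(1) by (intro mult_left_mono sqdist_mean_le_hardy_const n x) auto
  also have "(N - 1) * (q - 1) = (N - 1) / p * q"
    by (simp add: q(2)[symmetric])
  also have "(1 - x \<bullet> x) powr (- ((N - 1) / p * q)) * hardy_const CARD('n) q powr q
      = (hardy_const CARD('n) q / (1 - x \<bullet> x) powr ((N - 1) / p)) powr q"
    using x1 K by (simp add: powr_divide powr_powr powr_minus_divide)
  finally show ?thesis by (simp add: N_def)
qed

text \<open>The dilate \<open>u (r y)\<close> is harmonic near the closed ball, so it is the Poisson integral of its boundary
  values, whose \<open>p\<close>-th mean is at most the supremum in the definition of the Hardy norm. Hoelder's
  inequality bounds \<open>u (r x)\<close>, and \<open>r\<close> tends to \<open>1\<close>.\<close>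

lemma hardy_pointwise_bound:
  fixes u :: "real^'n::finite \<Rightarrow> real"
  assumes n: "2 \<le> CARD('n)" and pq: "p > 1" "1 / p + 1 / q = 1"
    and u: "u \<in> hardy_space (ereal p)" and x: "x \<in> ball 0 1"
  shows "\<bar>u x\<bar> \<le> hardy_const CARD('n) q / (1 - (norm x)\<^sup>2) powr ((real CARD('n) - 1) / p) * hardy_norm (ereal p) u"
proof -
  define B where "B = hardy_const CARD('n) q / (1 - x \<bullet> x) powr ((real CARD('n) - 1) / p)"
  define M where "M = enn2real (hardy_mean_sup p u)"
  note q = conjugate_exponent[OF pq]
  have x1: "1 - x \<bullet> x > 0" using norm_less_one_inner[OF x] by simp
  have B: "B > 0" using hardy_const_pos[OF n, of q] q(1) x1 by (simp add: B_def)
  have h: "harmonic_on u (ball 0 1)" using u by (simp add: hardy_space_def)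
  have scaled: "\<bar>u (r *\<^sub>R x)\<bar> \<le> A * B" if r: "r \<in> {0<..<1}" and A: "A > 0" "M \<le> A powr p" for r A
  proof -
    let ?v = "\<lambda>y. u (r *\<^sub>R y)"
    have hv: "harmonic_on ?v (ball 0 (1 / r))" using harmonic_on_scaleR[OF h] r by simp
    have "1 < 1 / r" using r by simp
    then have sub: "cball 0 1 \<subseteq> ball (0::real^'n) (1 / r)" by auto
    have cv: "continuous_on (sphere 0 1) ?v"
      by (rule continuous_on_subset[OF harmonic_on_continuous[OF hv] subset_trans[OF sphere_cball sub]])
    note cP = continuous_on_poisson_kernel_sphere[OF x]
    have "\<bar>?v x\<bar> = norm (\<integral>z. poisson_kernel x z * ?v z \<partial>sphere_measure)"
      using poisson_representation[OF n hv sub x] by (simp add: poisson_integral_def)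
    also have "\<dots> \<le> (\<integral>z. norm (poisson_kernel x z * ?v z) \<partial>sphere_measure)"
      by (rule integral_norm_bound)
    also have "\<dots> = (\<integral>z. \<bar>?v z\<bar> * poisson_kernel x z \<partial>sphere_measure)"
      using poisson_kernel_nonneg[OF x] by (simp add: abs_mult mult.commute)
    also have "\<dots> \<le> A * B"
    proof (rule holder_sphere[OF n pq(1) q(1) pq(2)])
      show "(\<integral>z. \<bar>?v z\<bar> powr p \<partial>sphere_measure) \<le> A powr p"
        using hardy_mean_le[OF n u _ r] pq(1) A(2) by (simp add: M_def)
      show "(\<integral>z. poisson_kernel x z powr q \<partial>sphere_measure) \<le> B powr q"
        unfolding B_def by (rule integral_poisson_kernel_powr_le[OF n x pq])
    qed (use poisson_kernel_nonneg[OF x] A B in \<open>auto intro!: continuous_intros cv cP\<close>)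
    finally show ?thesis .
  qed
  have "isCont u (1 *\<^sub>R x)"
    using harmonic_on_continuous[OF h] x by (simp add: continuous_on_eq_continuous_at)
  moreover have "isCont (\<lambda>r. r *\<^sub>R x) 1" by simp
  ultimately have "isCont (\<lambda>r. u (r *\<^sub>R x)) 1"
    using isCont_o2[of 1 "\<lambda>r. r *\<^sub>R x" u] by blast
  then have "((\<lambda>r. u (r *\<^sub>R x)) \<longlongrightarrow> u x) (at 1)" by (simp add: isCont_def)
  then have "((\<lambda>r. u (r *\<^sub>R x)) \<longlongrightarrow> u x) (at_left 1)" by (rule tendsto_within_subset) simp
  then have lim: "((\<lambda>r. \<bar>u (r *\<^sub>R x)\<bar>) \<longlongrightarrow> \<bar>u x\<bar>) (at_left 1)" by (rule tendsto_rabs)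
  have "\<bar>u x\<bar> \<le> B * hardy_norm (ereal p) u + e" if e: "e > 0" for e
  proof -
    \<comment> \<open>The added term keeps \<open>A\<close> positive when the norm is zero; multiplied by \<open>B\<close> it costs exactly \<open>e\<close>.\<close>
    define A where "A = M powr (1 / p) + e / B"
    have A: "A > 0" using e B by (simp add: A_def add_nonneg_pos)
    have "M = (M powr (1 / p)) powr p" using pq(1) by (simp add: powr_powr M_def)
    also have "\<dots> \<le> A powr p" using pq(1) e B by (intro powr_mono2) (auto simp: A_def)
    finally have MA: "M \<le> A powr p" .
    have "eventually (\<lambda>r. r \<in> {0<..<1}) (at_left (1::real))"
      by (rule eventually_at_left_real) simp
    then have "eventually (\<lambda>r. \<bar>u (r *\<^sub>R x)\<bar> \<le> A * B) (at_left 1)"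
      by eventually_elim (rule scaled[OF _ A MA])
    then have "\<bar>u x\<bar> \<le> A * B" by (intro tendsto_upperbound[OF lim]) auto
    also have "\<dots> = B * hardy_norm (ereal p) u + e"
      using B by (simp add: A_def hardy_norm_def M_def field_simps)
    finally show ?thesis .
  qed
  then have "\<bar>u x\<bar> \<le> B * hardy_norm (ereal p) u" by (rule field_le_epsilon)
  then show ?thesis by (simp add: B_def dot_square_norm)
qed

section \<open>Sharpness\<close>

lemma integral_sphere_pos:
  fixes f :: "real^'n::finite \<Rightarrow> real"
  assumes n: "2 \<le> CARD('n)" and f: "continuous_on (sphere 0 1) f" "\<And>z. z \<in> sphere 0 1 \<Longrightarrow> 0 < f z"
  shows "0 < integral\<^sup>L sphere_measure f"
proof -
  have "sphere (0::real^'n) 1 \<noteq> {}" using norm_axis_1[of undefined] by (metis mem_sphere_0 empty_iff)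
  then obtain z0 where z0: "z0 \<in> sphere 0 1" "\<And>z. z \<in> sphere 0 1 \<Longrightarrow> f z0 \<le> f z"
    using continuous_attains_inf[OF compact_sphere _ f(1)] by blast
  have "f z0 = (\<integral>z. f z0 \<partial>(sphere_measure :: (real^'n) measure))"
    by (rule integral_sphere_const[OF n, symmetric])
  also have "\<dots> \<le> integral\<^sup>L sphere_measure f"
    by (intro integral_sphere_mono n f continuous_intros z0)
  finally show ?thesis using f(2)[OF z0(1)] by simp
qed

lemma integral_sphere_swap:
  fixes F :: "real^'n::finite \<Rightarrow> real^'n \<Rightarrow> real"
  assumes n: "2 \<le> CARD('n)"
    and F: "continuous_on (sphere 0 1 \<times> sphere 0 1) (\<lambda>p. F (fst p) (snd p))"
  shows "(\<integral>w. \<integral>z. F z w \<partial>sphere_measure \<partial>sphere_measure) = (\<integral>z. \<integral>w. F z w \<partial>sphere_measure \<partial>sphere_measure)"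
proof -
  let ?S = "sphere_measure :: (real^'n) measure"
  let ?T = "sphere 0 1 \<times> sphere 0 1 :: ((real^'n) \<times> (real^'n)) set"
  interpret fm: finite_measure ?S by (rule finite_measure_sphere_measure[OF n])
  interpret pair_sigma_finite ?S ?S ..
  interpret fp: finite_measure "?S \<Otimes>\<^sub>M ?S"
    by (intro finite_measure_pair_measure fm.finite_measure_axioms)
  have sp: "space (?S \<Otimes>\<^sub>M ?S) = ?T" by (simp add: space_pair_measure space_sphere_measure[OF n])
  have id: "(\<lambda>x. x) \<in> ?S \<rightarrow>\<^sub>M borel"
    by (intro measurable_sphere_continuous n continuous_intros)
  have "(\<lambda>p. (fst p, snd p)) \<in> ?S \<Otimes>\<^sub>M ?S \<rightarrow>\<^sub>M borel \<Otimes>\<^sub>M borel"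
    using measurable_compose[OF measurable_fst id] measurable_compose[OF measurable_snd id]
    by (intro measurable_Pair) auto
  then have "(\<lambda>p. p) \<in> ?S \<Otimes>\<^sub>M ?S \<rightarrow>\<^sub>M borel" by (simp add: borel_prod)
  then have idT: "(\<lambda>p. p) \<in> ?S \<Otimes>\<^sub>M ?S \<rightarrow>\<^sub>M restrict_space borel ?T"
    by (intro measurable_restrict_space2) (auto simp: sp)
  have m: "(\<lambda>p. F (fst p) (snd p)) \<in> borel_measurable (?S \<Otimes>\<^sub>M ?S)"
    by (rule measurable_compose[OF idT borel_measurable_continuous_on_restrict[OF F]])
  have "bounded ((\<lambda>p. F (fst p) (snd p)) ` ?T)"
    by (intro compact_imp_bounded compact_continuous_image F compact_Times) auto
  then obtain B where B: "norm (F (fst p) (snd p)) \<le> B" if "p \<in> ?T" for p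
    unfolding bounded_iff by blast
  have "integrable (?S \<Otimes>\<^sub>M ?S) (\<lambda>p. F (fst p) (snd p))"
    by (intro fp.integrable_const_bound[where B = B] m AE_I2 B) (simp only: sp)
  then show ?thesis
    by (intro Fubini_integral) (simp add: case_prod_beta')
qed

lemma poisson_kernel_symmetric:
  assumes "z \<in> sphere 0 1" "w \<in> sphere 0 1"
  shows "poisson_kernel (r *\<^sub>R z) w = poisson_kernel (r *\<^sub>R w) z"
proof -
  have "(r *\<^sub>R z - w) \<bullet> (r *\<^sub>R z - w) = (r *\<^sub>R w - z) \<bullet> (r *\<^sub>R w - z)"
    unfolding sqdist_expand using assms by (simp add: dot_square_norm inner_commute)
  moreover have "(r *\<^sub>R z) \<bullet> (r *\<^sub>R z) = (r *\<^sub>R w) \<bullet> (r *\<^sub>R w)"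
    using assms by (simp add: dot_square_norm)
  ultimately show ?thesis by (simp only: poisson_kernel_def sqdist_powr_def)
qed

text \<open>For unit vectors \<open>\<bar>r z - w\<bar> = \<bar>r w - z\<bar>\<close>, so the kernel is symmetric and has total mass \<open>1\<close> in either
  variable. The iterated integrals are interchanged to use this.\<close>

lemma integral_poisson_integral:
  fixes f :: "real^'n::finite \<Rightarrow> real"
  assumes n: "2 \<le> CARD('n)" and f: "continuous_on (sphere 0 1) f" and r: "r \<in> {0<..<1}"
  shows "(\<integral>z. poisson_integral f (r *\<^sub>R z) \<partial>sphere_measure) = integral\<^sup>L sphere_measure f"
proof -
  have rb: "r *\<^sub>R z \<in> ball 0 1" if "z \<in> sphere 0 1" for z :: "real^'n" using that r by simp
  have cP: "continuous_on (sphere 0 1 \<times> sphere 0 1) (\<lambda>p::(real^'n)\<times>(real^'n). poisson_kernel (r *\<^sub>R fst p) (snd p))"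
    using continuous_on_compose2[OF continuous_on_poisson_kernel, of "sphere 0 1 \<times> sphere 0 1" "\<lambda>p. (r *\<^sub>R fst p, snd p)"] rb
    by (force intro!: continuous_intros)
  have cf: "continuous_on (sphere 0 1 \<times> sphere 0 1) (\<lambda>p::(real^'n)\<times>(real^'n). f (snd p))"
    by (rule continuous_on_compose2[OF f]) (auto intro!: continuous_intros)
  have "(\<integral>z. poisson_integral f (r *\<^sub>R z) \<partial>sphere_measure)
      = (\<integral>w. \<integral>z. poisson_kernel (r *\<^sub>R z) w * f w \<partial>sphere_measure \<partial>sphere_measure)"
    unfolding poisson_integral_def
    by (rule integral_sphere_swap[OF n, symmetric]) (intro continuous_intros cP cf)
  also have "\<dots> = (\<integral>w. f w * (\<integral>z. poisson_kernel (r *\<^sub>R z) w \<partial>sphere_measure) \<partial>sphere_measure)"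
    by (simp add: mult.commute)
  also have "\<dots> = integral\<^sup>L sphere_measure f"
  proof (rule integral_sphere_cong[OF n])
    fix w :: "real^'n" assume w: "w \<in> sphere 0 1"
    have "(\<integral>z. poisson_kernel (r *\<^sub>R z) w \<partial>sphere_measure) = (\<integral>z. poisson_kernel (r *\<^sub>R w) z \<partial>sphere_measure)"
      by (intro integral_sphere_cong n poisson_kernel_symmetric w)
    then show "f w * (\<integral>z. poisson_kernel (r *\<^sub>R z) w \<partial>sphere_measure) = f w"
      using integral_poisson_kernel[OF n rb[OF w]] by simp
  qed
  finally show ?thesis .
qed

text \<open>Jensen's inequality for the probability measure with density \<open>P x\<close>, obtained from Hoelder's inequality
  by splitting the kernel as \<open>P x powr (1/p) \<cdot> P x powr (1/q)\<close>.\<close>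

lemma poisson_integral_powr_le:
  fixes f :: "real^'n::finite \<Rightarrow> real"
  assumes n: "2 \<le> CARD('n)" and pq: "p > 1" "1 / p + 1 / q = 1"
    and f: "continuous_on (sphere 0 1) f" "\<And>z. z \<in> sphere 0 1 \<Longrightarrow> 0 < f z" and x: "x \<in> ball 0 1"
  shows "\<bar>poisson_integral f x\<bar> powr p \<le> poisson_integral (\<lambda>z. f z powr p) x"
proof -
  note q = conjugate_exponent[OF pq]
  note cP = continuous_on_poisson_kernel_sphere[OF x]
  note Ppos = poisson_kernel_pos[OF x]
  define J where "J = poisson_integral (\<lambda>z. f z powr p) x"
  have fp: "continuous_on (sphere 0 1) (\<lambda>z. f z powr p)"
    using f pq(1) by (intro continuous_on_powr_nonneg) (auto intro: less_imp_le)
  have cPp: "continuous_on (sphere 0 1) (\<lambda>z. poisson_kernel x z powr a)" if "a > 0" for a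
    using that Ppos by (intro continuous_on_powr_nonneg cP) (auto intro: less_imp_le)
  have J: "J > 0"
    unfolding J_def poisson_integral_def using f(2) Ppos
    by (intro integral_sphere_pos n continuous_on_mult cP fp) (auto intro!: mult_pos_pos less_imp_neq[symmetric])
  have "poisson_integral f x = (\<integral>z. (poisson_kernel x z powr (1 / p) * f z) * poisson_kernel x z powr (1 / q) \<partial>sphere_measure)"
    unfolding poisson_integral_def
  proof (rule integral_sphere_cong[OF n])
    fix z :: "real^'n" assume "z \<in> sphere 0 1"
    then have "poisson_kernel x z > 0" by (rule Ppos)
    moreover have "poisson_kernel x z powr (1 / p) * poisson_kernel x z powr (1 / q) = poisson_kernel x z powr (1 / p + 1 / q)"
      by (simp add: powr_add)
    ultimately show "poisson_kernel x z * f z = poisson_kernel x z powr (1 / p) * f z * poisson_kernel x z powr (1 / q)"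
      using pq(2) by (simp add: mult_ac)
  qed
  also have "\<dots> \<le> J powr (1 / p) * 1"
  proof (rule holder_sphere[OF n pq(1) q(1) pq(2)])
    have "(\<integral>z. (poisson_kernel x z powr (1 / p) * f z) powr p \<partial>sphere_measure) = J"
      unfolding J_def poisson_integral_def
      using Ppos f(2) pq(1) by (intro integral_sphere_cong n) (simp add: powr_mult powr_powr less_imp_le)
    then show "(\<integral>z. (poisson_kernel x z powr (1 / p) * f z) powr p \<partial>sphere_measure) \<le> (J powr (1 / p)) powr p"
      using J pq(1) by (simp add: powr_powr)
    have "(\<integral>z. (poisson_kernel x z powr (1 / q)) powr q \<partial>sphere_measure) = (\<integral>z. poisson_kernel x z \<partial>sphere_measure)"
      using Ppos q(1) by (intro integral_sphere_cong n) (simp add: powr_powr less_imp_le)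
    then show "(\<integral>z. (poisson_kernel x z powr (1 / q)) powr q \<partial>sphere_measure) \<le> 1 powr q"
      by (simp add: integral_poisson_kernel[OF n x])
  qed (use J f(2) pq(1) q(1) in \<open>auto intro!: continuous_intros cPp f(1) mult_nonneg_nonneg less_imp_le[OF f(2)]\<close>)
  finally have le: "poisson_integral f x \<le> J powr (1 / p)" by simp
  have "poisson_integral f x > 0"
    unfolding poisson_integral_def using f(2) Ppos
    by (intro integral_sphere_pos n continuous_intros cP f) (auto intro!: mult_pos_pos)
  then have "\<bar>poisson_integral f x\<bar> powr p \<le> (J powr (1 / p)) powr p"
    using le pq(1) by (intro powr_mono2) auto
  also have "\<dots> = J" using J pq(1) by (simp add: powr_powr)
  finally show ?thesis by (simp add: J_def)
qed

text \<open>Poisson integration does not increase the \<open>L\<^sup>p\<close> norm: Jensen's inequality at each point, then the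
  preservation of the mean.\<close>

lemma hardy_mean_sup_poisson_integral:
  fixes f :: "real^'n::finite \<Rightarrow> real"
  assumes n: "2 \<le> CARD('n)" and pq: "p > 1" "1 / p + 1 / q = 1"
    and f: "continuous_on (sphere 0 1) f" "\<And>z. z \<in> sphere 0 1 \<Longrightarrow> 0 < f z"
  shows "hardy_mean_sup p (poisson_integral f) \<le> ennreal (\<integral>z. f z powr p \<partial>sphere_measure)"
  unfolding hardy_mean_sup_def
proof (rule SUP_least)
  fix r :: real assume r: "r \<in> {0<..<1}"
  have rb: "r *\<^sub>R z \<in> ball 0 1" if "z \<in> sphere 0 1" for z :: "real^'n" using that r by simp
  have fp: "continuous_on (sphere 0 1) (\<lambda>z. f z powr p)"
    using f pq(1) by (intro continuous_on_powr_nonneg) (auto intro: less_imp_le)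
  have c: "continuous_on (sphere 0 1) (\<lambda>z. poisson_integral h (r *\<^sub>R z))"
    if h: "continuous_on (sphere 0 1) h" for h :: "real^'n \<Rightarrow> real"
    by (rule continuous_on_compose2[OF harmonic_on_continuous[OF harmonic_poisson_integral[OF n h]]])
       (use rb in \<open>auto intro!: continuous_intros simp del: mem_ball\<close>)
  have c1: "continuous_on (sphere 0 1) (\<lambda>z. \<bar>poisson_integral f (r *\<^sub>R z)\<bar> powr p)"
    using pq(1) by (intro continuous_on_powr_nonneg continuous_intros c f) auto
  have "(\<integral>\<^sup>+z. ennreal (\<bar>poisson_integral f (r *\<^sub>R z)\<bar> powr p) \<partial>sphere_measure)
      = ennreal (\<integral>z. \<bar>poisson_integral f (r *\<^sub>R z)\<bar> powr p \<partial>sphere_measure)"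
    by (intro nn_integral_eq_integral integrable_sphere_continuous n c1) auto
  also have "\<dots> \<le> ennreal (\<integral>z. poisson_integral (\<lambda>z. f z powr p) (r *\<^sub>R z) \<partial>sphere_measure)"
    by (intro ennreal_leI integral_sphere_mono n c1 c fp poisson_integral_powr_le[OF n pq f rb])
  also have "\<dots> = ennreal (\<integral>z. f z powr p \<partial>sphere_measure)"
    by (simp add: integral_poisson_integral[OF n fp r])
  finally show "(\<integral>\<^sup>+z. ennreal (\<bar>poisson_integral f (r *\<^sub>R z)\<bar> powr p) \<partial>sphere_measure)
      \<le> ennreal (\<integral>z. f z powr p \<partial>sphere_measure)" .
qed

text \<open>The Poisson integral \<open>u\<close> of \<open>P x powr (q - 1)\<close> gives equality in Hoelder's inequality at \<open>x\<close>. With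
  \<open>I = \<integral> P x z powr q d\<sigma>\<close> one has \<open>u x = I\<close>, while the norm of \<open>u\<close> is at most \<open>I powr (1/p)\<close>, because
  \<open>(q - 1) p = q\<close>. So an admissible \<open>C\<close> dominates \<open>I powr (1/q)\<close> after rescaling.\<close>

lemma pointwise_constant_lower_bound:
  fixes x :: "real^'n::finite"
  assumes n: "2 \<le> CARD('n)" and pq: "p > 1" "1 / p + 1 / q = 1" and x: "x \<in> ball 0 1"
    and C: "\<And>u. u \<in> hardy_space (ereal p) \<Longrightarrow>
      \<bar>u x\<bar> \<le> C / (1 - (norm x)\<^sup>2) powr ((real CARD('n) - 1) / p) * hardy_norm (ereal p) u"
  shows "sqdist_mean (real CARD('n) * q / 2 - real CARD('n) + 1) x powr (1 / q) \<le> C"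
proof -
  note q = conjugate_exponent[OF pq]
  note cP = continuous_on_poisson_kernel_sphere[OF x]
  note Ppos = poisson_kernel_pos[OF x]
  define N where "N = real CARD('n)"
  define G where "G = sqdist_mean (N * q / 2 - N + 1) x"
  define t where "t = 1 - (norm x)\<^sup>2"
  have t: "t > 0" using norm_less_one_inner[OF x] by (simp add: t_def dot_square_norm)
  define f where "f z = poisson_kernel x z powr (q - 1)" for z
  define I where "I = (\<integral>z. poisson_kernel x z powr q \<partial>sphere_measure)"
  have cPp: "continuous_on (sphere 0 1) (\<lambda>z. poisson_kernel x z powr a)" if "a > 0" for a
    using that Ppos by (intro continuous_on_powr_nonneg cP) (auto intro: less_imp_le)
  have f: "continuous_on (sphere 0 1) f" "\<And>z. z \<in> sphere 0 1 \<Longrightarrow> 0 < f z"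
    using cPp[of "q - 1"] q(1) less_imp_neq[OF Ppos] unfolding f_def by auto
  have I: "I > 0"
    unfolding I_def using q(1) less_imp_neq[OF Ppos] by (intro integral_sphere_pos n cPp) auto
  have fp: "(\<integral>z. f z powr p \<partial>sphere_measure) = I"
    using q(3) by (simp add: f_def I_def powr_powr mult.commute)
  define u where "u = poisson_integral f"
  have sup: "hardy_mean_sup p u \<le> ennreal I"
    unfolding u_def fp[symmetric] by (rule hardy_mean_sup_poisson_integral[OF n pq f])
  have uh: "u \<in> hardy_space (ereal p)"
    using harmonic_poisson_integral[OF n f(1)] sup by (auto simp: hardy_space_def u_def intro: le_less_trans)
  have "enn2real (hardy_mean_sup p u) \<le> I"
    using enn2real_mono[OF sup] I by simp
  then have norm: "hardy_norm (ereal p) u \<le> I powr (1 / p)"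
    using pq(1) by (auto simp: hardy_norm_def intro!: powr_mono2)
  have "u x = I"
    unfolding u_def poisson_integral_def I_def f_def
  proof (rule integral_sphere_cong[OF n])
    fix z :: "real^'n" assume "z \<in> sphere 0 1"
    then have "poisson_kernel x z > 0" by (rule Ppos)
    then show "poisson_kernel x z * poisson_kernel x z powr (q - 1) = poisson_kernel x z powr q"
      using powr_add[of "poisson_kernel x z" 1 "q - 1"] by simp
  qed
  with C[OF uh] I have le: "I \<le> C / t powr ((N - 1) / p) * hardy_norm (ereal p) u"
    by (simp add: t_def N_def)
  have h0: "hardy_norm (ereal p) u \<ge> 0" by (simp add: hardy_norm_def)
  have C0: "C / t powr ((N - 1) / p) > 0"
    using le I h0 by (meson mult_nonpos_nonneg not_le order.strict_trans1)
  have "I \<le> C / t powr ((N - 1) / p) * I powr (1 / p)"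
    using le mult_left_mono[OF norm less_imp_le[OF C0]] by linarith
  then have "I / I powr (1 / p) \<le> C / t powr ((N - 1) / p)"
    using I by (simp add: pos_divide_le_eq)
  moreover have "I / I powr (1 / p) = I powr (1 / q)"
    using I powr_diff[of I 1 "1 / p"] by (simp add: q(4))
  moreover have "I powr (1 / q) = G powr (1 / q) / t powr ((N - 1) / p)"
  proof -
    have "I = t powr (- ((N - 1) * (q - 1))) * G"
      unfolding I_def G_def N_def t_def integral_poisson_kernel_powr[OF n x] by (simp add: dot_square_norm)
    then have "I powr (1 / q) = t powr (- ((N - 1) * (q - 1)) * (1 / q)) * G powr (1 / q)"
      using t by (simp add: powr_mult powr_powr G_def sqdist_mean_nonneg)
    also have "- ((N - 1) * (q - 1)) * (1 / q) = - ((N - 1) / p)"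
      using q(5) by (metis (no_types) minus_mult_left mult.assoc mult.right_neutral times_divide_eq_right)
    finally show ?thesis by (simp add: powr_minus field_simps)
  qed
  ultimately have "G powr (1 / q) / t powr ((N - 1) / p) \<le> C / t powr ((N - 1) / p)" by simp
  then show ?thesis using t by (simp add: divide_le_cancel G_def N_def)
qed

lemma hardy_space_one:
  assumes n: "2 \<le> CARD('n::finite)" and p: "1 < p"
  shows "(\<lambda>_::real^'n. 1) \<in> hardy_space p" "hardy_norm p (\<lambda>_::real^'n. 1) = 1"
proof -
  have h: "harmonic_on (\<lambda>_::real^'n. 1) (ball 0 1)"
    by (rule harmonic_onI[of _ _ "\<lambda>_. 0" "\<lambda>_. 0"]) (auto simp: C2_on_def trace_def)
  have "hardy_mean_sup a (\<lambda>_::real^'n. 1) = 1" for a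
  proof -
    have "{0<..<1::real} \<noteq> {}" by simp
    then show ?thesis
      by (simp add: hardy_mean_sup_def emeasure_sphere_measure_space[OF n])
  qed
  then show "(\<lambda>_::real^'n. 1) \<in> hardy_space p" "hardy_norm p (\<lambda>_::real^'n. 1) = 1"
    using h by (auto simp: hardy_space_def hardy_norm_def image_constant_conv)
qed

theorem theorem1p2:
  fixes p :: ereal and q :: real
  assumes "CARD('n::finite) \<ge> 2"
    and "1 < p"
    and "1 / p + 1 / ereal q = 1"
  shows "(\<forall>u\<in>(hardy_space p :: (real^'n \<Rightarrow> real) set). \<forall>x\<in>ball 0 1.
            \<bar>u x\<bar> \<le> hardy_const CARD('n) q
                     / (1 - (norm x)\<^sup>2) powr real_of_ereal (ereal (real CARD('n) - 1) / p)
                     * hardy_norm p u)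
       \<and> (\<forall>C < hardy_const CARD('n) q.
            \<not> (\<forall>u\<in>(hardy_space p :: (real^'n \<Rightarrow> real) set). \<forall>x\<in>ball 0 1.
                 \<bar>u x\<bar> \<le> C
                     / (1 - (norm x)\<^sup>2) powr real_of_ereal (ereal (real CARD('n) - 1) / p)
                     * hardy_norm p u))"
proof -
  note n = assms(1)
  define N where "N = real CARD('n)"
  have N: "N \<ge> 2" using n by (simp add: N_def)
  \<comment> \<open>The constant function \<open>1\<close>, evaluated at the centre.\<close>
  have trivial_sharp: "1 \<le> C"
    if C: "\<forall>u\<in>(hardy_space p :: (real^'n \<Rightarrow> real) set). \<forall>x\<in>ball 0 1.
                 \<bar>u x\<bar> \<le> C
                     / (1 - (norm x)\<^sup>2) powr real_of_ereal (ereal (real CARD('n) - 1) / p)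
                     * hardy_norm p u" for C
    using bspec[OF bspec[OF C hardy_space_one(1)[OF n assms(2)]], of 0]
    by (simp add: hardy_space_one(2)[OF n assms(2)])
  consider (inf) "p = \<infinity>" | (real) P where "p = ereal P" "P > 1"
    using assms(2) by (cases p) auto
  then show ?thesis
  proof cases
    case inf
    have "1 / ereal q = 1" using assms(3) inf by simp
    then have "q = 1" by (cases "q = 0") (auto simp: one_ereal_def)
    then have K: "hardy_const CARD('n) q = 1" using N by (simp add: hardy_const_def N_def)
    have "\<bar>u x\<bar> \<le> hardy_norm p u" if u: "u \<in> hardy_space p" and x: "x \<in> ball 0 1" for u :: "real^'n \<Rightarrow> real" and x
    proof -
      have "bounded (u ` ball 0 1)" using u inf by (simp add: hardy_space_def)
      then obtain B where "\<forall>y\<in>u ` ball 0 1. norm y \<le> B" unfolding bounded_iff by blast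
      then have "bdd_above ((\<lambda>x. \<bar>u x\<bar>) ` ball 0 1)" by (auto intro!: bdd_aboveI[of _ B])
      from cSUP_upper[OF x this] show ?thesis using inf by (simp add: hardy_norm_def)
    qed
    moreover have "(1 - (norm x)\<^sup>2) powr real_of_ereal (ereal (real CARD('n) - 1) / p) = 1"
      if "x \<in> ball 0 1" for x :: "real^'n"
      using norm_less_one_inner[OF that] inf by (simp add: dot_square_norm)
    ultimately have "\<forall>u\<in>(hardy_space p :: (real^'n \<Rightarrow> real) set). \<forall>x\<in>ball 0 1.
            \<bar>u x\<bar> \<le> hardy_const CARD('n) q
                     / (1 - (norm x)\<^sup>2) powr real_of_ereal (ereal (real CARD('n) - 1) / p)
                     * hardy_norm p u"
      by (simp add: K del: mem_ball)
    then show ?thesis using trivial_sharp unfolding K not_le[symmetric] by blast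
  next
    case real
    have pq: "1 / P + 1 / q = 1"
    proof -
      have "q \<noteq> 0" using assms(3) real by (auto simp: one_ereal_def)
      then have "ereal (1 / P + 1 / q) = 1" using assms(3) real by (simp add: one_ereal_def)
      then show ?thesis by (simp add: one_ereal_def)
    qed
    note q = conjugate_exponent[OF real(2) pq]
    have ex: "real_of_ereal (ereal (real CARD('n) - 1) / p) = (N - 1) / P"
      using real by (simp add: N_def)
    have "\<not> C < hardy_const CARD('n) q"
      if C: "\<forall>u\<in>(hardy_space p :: (real^'n \<Rightarrow> real) set). \<forall>x\<in>ball 0 1.
                 \<bar>u x\<bar> \<le> C
                     / (1 - (norm x)\<^sup>2) powr real_of_ereal (ereal (real CARD('n) - 1) / p)
                     * hardy_norm p u" for C
    proof (cases "q \<le> 2 - 2 / N")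
      case True
      then show ?thesis using trivial_sharp[OF C] by (simp add: hardy_const_def N_def)
    next
      case False
      \<comment> \<open>The lower bounds for \<open>C\<close> at points tending radially to the boundary converge to the constant.\<close>
      define m where "m = N * q / 2 - N + 1"
      define e where "e = (axis undefined 1 :: real^'n)"
      have "N * q > N * (2 - 2 / N)" using False N by (intro mult_strict_left_mono) auto
      then have m: "m > 0" using N by (simp add: m_def algebra_simps)
      have "sqdist_mean m (r *\<^sub>R e) powr (1 / q) \<le> C" if r: "r \<in> {0<..<1}" for r
      proof -
        have x: "r *\<^sub>R e \<in> ball 0 1" using r by (simp add: e_def)
        show ?thesis unfolding m_def N_def
        proof (rule pointwise_constant_lower_bound[OF n real(2) pq x])
          fix u :: "real^'n \<Rightarrow> real" assume "u \<in> hardy_space (ereal P)"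
          then show "\<bar>u (r *\<^sub>R e)\<bar> \<le> C / (1 - (norm (r *\<^sub>R e))\<^sup>2) powr ((real CARD('n) - 1) / P)
              * hardy_norm (ereal P) u"
            using bspec[OF bspec[OF C, of u] x] unfolding ex unfolding real(1) N_def by blast
        qed
      qed
      moreover have "eventually (\<lambda>r. r \<in> {0<..<1}) (at_left (1::real))"
        by (rule eventually_at_left_real) simp
      ultimately have ev: "eventually (\<lambda>r. sqdist_mean m (r *\<^sub>R e) powr (1 / q) \<le> C) (at_left 1)"
        by (auto elim: eventually_mono)
      have "((\<lambda>r. sqdist_mean m (r *\<^sub>R e) powr (1 / q)) \<longlongrightarrow> sqdist_mean m e powr (1 / q)) (at_left 1)"
        by (rule tendsto_powr2[OF tendsto_sqdist_mean_boundary[OF n m] tendsto_const])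
           (use q(1) in \<open>auto simp: sqdist_mean_nonneg\<close>)
      then have "sqdist_mean m e powr (1 / q) \<le> C" by (rule tendsto_upperbound[OF _ ev]) simp
      then show ?thesis
        using False by (simp add: hardy_const_eq[OF n, of q undefined] m_def N_def e_def)
    qed
    moreover have "\<bar>u x\<bar> \<le> hardy_const CARD('n) q
                     / (1 - (norm x)\<^sup>2) powr real_of_ereal (ereal (real CARD('n) - 1) / p)
                     * hardy_norm p u" if "u \<in> hardy_space p" "x \<in> ball 0 1" for u :: "real^'n \<Rightarrow> real" and x
      using hardy_pointwise_bound[OF n real(2) pq, of u x] that unfolding ex unfolding N_def real(1) by blast
    ultimately show ?thesis by blast
  qed
qed


end
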